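(* Let $p$ be an odd prime, $n$ a positive integer, $f_0 \in \mathrm{Irr}_p(n)$, and $k \in C_2 \cup C_3 \cup C_3^-$ (see context). Define nonnegative integers $e_0, e_1$ by: if $k \in C_2$, $e_0 = \nu_2(N(\pi_p^n - 1))$ and $e_1 = \nu_2(N(\pi_p^n + 1))$ (with the Gaussian-integer data of the context); if $k \in C_3 \cup C_3^-$, $e_0 = \nu_{\rho_0}(\pi_p^n - 1)$ and $e_1 = \nu_{\rho_0}(\pi_p^n + 1)$ (with the $\mathbf{Z}[\frac{1+\sqrt{-7}}{2}]$ data of the context). Construct polynomials as follows. If $f_0^{Q_k}$ is irreducible, set $f_1 := f_0^{Q_k}$; otherwise $f_0^{Q_k}$ factors as a product of two monic irreducible polynomials $g_1, g_2$ of degree $n$, where $g_1$ has a root in $\mathbf{F}_{p^n}$ that is not $\theta_k$-periodic, and set $f_1 := g_1$. For $i \geq 2$, inductively: if $f_{i-1}^{Q_k}$ is irreducible set $f_i := f_{i-1}^{Q_k}$; otherwise factor $f_{i-1}^{Q_k}$ into a product of two monic irreducible polynomials $g_1, g_2$ of the same degree and set $f_i := g_1$. Then there exist a nonnegative integer $s$ and a positive integer $t$ such that $s \leq \max\{e_0, e_1\}$, $s + t \leq e_0 + e_1$, $\{f_0, \dots, f_s\} \subseteq \mathrm{Irr}_p(n)$ and $\{f_{s+1}, \dots, f_{s+t}\} \subseteq \mathrm{Irr}_p(2n)$. Moreover: if $k \in C_2$, then $\{f_{s+t+2j-1}, f_{s+t+2j}\} \subseteq \mathrm{Irr}_p(2^{j+1}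 n)$ for every $j \geq 1$; if $k \in C_3 \cup C_3^-$, then $f_{s+t+j} \in \mathrm{Irr}_p(2^{j+1} n)$ for every $j \geq 1$.
   Context: $\mathrm{Irr}_p$ is the set of monic irreducible polynomials in $\mathbf{F}_p[x]$ and $\mathrm{Irr}_p(n)$ those of degree $n$. For $k \in \mathbf{F}_p^*$ and a power $q$ of $p$, $\theta_k : \mathbf{P}^1(\mathbf{F}_q) \to \mathbf{P}^1(\mathbf{F}_q)$ is given by $\theta_k(0) = \theta_k(\infty) = \infty$ and $\theta_k(x) = k(x + x^{-1})$ otherwise; an element $x$ is $\theta_k$-periodic if $\theta_k^r(x) = x$ for some $r \geq 1$. For $f \in \mathbf{F}_p[x]$ of positive degree $n$, its $Q_k$-transform is $f^{Q_k}(x) = (x/k)^n \, f(k(x + x^{-1}))$, a monic polynomial of degree $2n$ when $f$ is monic. The sets: $C_2 = \{k \in \mathbf{F}_p : k^2 + \frac14 = 0\}$, considered when $p \equiv 1 \pmod 4$; $C_3 = \{k \in \mathbf{F}_p : k^2 + \frac12 k + \frac12 = 0\}$ and $C_3^- = \{k \in \mathbf{F}_p : -k \in C_3\}$, considered when $p \equiv 1, 2, 4 \pmod 7$. Data for $k \in C_2$: $E$ is the curve $y^2 = x^3 + x$ over $\mathbf{F}_p$, with endomorphism ring identified with $\mathbf{Z}[i]$; $\pi_p \in \mathbf{Z}[i]$ represents the $p$-Frobenius endomorphism $(x,y)\mapsto(x^p,y^p)$; $N(a + ib) = a^2 + b^2$; $\nu_2(m)$ is the exponent of the largest power of $2$ dividing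 the positive integer $m$. Data for $k \in C_3 \cup C_3^-$: $R = \mathbf{Z}[\alpha]$, $\alpha = \frac{1 + \sqrt{-7}}{2}$; $E$ is the curve $y^2 = x^3 - 35x + 98$ over $\mathbf{F}_p$, with endomorphism ring identified with $R$; $\pi_p \in R$ represents the $p$-Frobenius endomorphism; $R/\pi_p R \cong \mathbf{F}_p$. Let $k' = k$ if $k \in C_3$ and $k' = -k$ if $k \in C_3^-$, and $\sigma \equiv 2k' + 1 \pmod p$. Then $\rho_0 = \alpha$ if $\alpha \equiv \sigma \pmod{\pi_p}$ and $\rho_0 = \overline{\alpha}$ if $\overline{\alpha} \equiv \sigma \pmod{\pi_p}$; $\nu_{\rho_0}(r)$ is the largest $e \geq 0$ with $\rho_0^e \mid r$ in $R$. *)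

theory Defs
  imports
    Complex_Main
    "HOL-Algebra.Algebraic_Closure_Type"
    "HOL-Algebra.QuotRing"
    "HOL-Algebra.Divisibility"
    "HOL-Number_Theory.Cong"
    "HOL-Computational_Algebra.Normalized_Fraction"
    "Berlekamp_Zassenhaus.Finite_Field"
begin

text \<open>
  The prime field with \<open>p\<close> elements is \<^typ>\<open>'p mod_ring\<close> with \<open>p = CARD('p)\<close>, and its extension
  with \<open>p ^ n\<close> elements is the subfield \<open>{x. x ^ (p ^ n) = x}\<close> of \<^typ>\<open>'p mod_ring alg_closure\<close>.
\<close>

definition Irr :: "'a::field poly set" where
  "Irr = {f. lead_coeff f = 1 \<and> Factorial_Ring.irreducible f}"

definition Irr_deg :: "nat \<Rightarrow> 'a::field poly set" where
  "Irr_deg n = {f \<in> Irr. Polynomial.degree f = n}"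

definition GF_ext :: "nat \<Rightarrow> 'p::prime_card mod_ring alg_closure set" where
  "GF_ext n = {x. x ^ (CARD('p) ^ n) = x}"


subsection \<open>The maps \<open>\<theta>\<^sub>k\<close> and the \<open>Q\<^sub>k\<close>-transform\<close>

datatype 'a proj_line = Fin 'a | Infty

fun theta :: "'a::field \<Rightarrow> 'a proj_line \<Rightarrow> 'a proj_line" where
  "theta k Infty = Infty"
| "theta k (Fin x) = (if x = 0 then Infty else Fin (k * (x + inverse x)))"

definition theta_periodic :: "'a::field \<Rightarrow> 'a proj_line \<Rightarrow> bool" where
  "theta_periodic k x \<longleftrightarrow> (\<exists>r\<ge>1. (theta k ^^ r) x = x)"

text \<open>
  For \<open>n = degree f\<close>, the term \<open>a\<^sub>i X\<^sup>i\<close> of \<open>f\<close> contributes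
  \<open>(X/k)\<^sup>n a\<^sub>i (k (X + 1/X))\<^sup>i = a\<^sub>i (X/k)\<^bsup>n-i\<^esup> (X\<^sup>2 + 1)\<^sup>i\<close> to \<open>(X/k)\<^sup>n f(k (X + 1/X))\<close>;
  the lemma below is this defining identity in the field of rational functions.
\<close>

definition Q_transform :: "'a::field \<Rightarrow> 'a poly \<Rightarrow> 'a poly" where
  "Q_transform k f =
     (\<Sum>i\<le>Polynomial.degree f.
        Polynomial.smult (Polynomial.coeff f i)
          ([:0, 1 / k:] ^ (Polynomial.degree f - i) * [:1, 0, 1:] ^ i))"

lemma Q_transform_rational_function:
  fixes k :: "'a::field" and f :: "'a poly"
  defines "T \<equiv> to_fract [:0, 1:]" and "c \<equiv> (\<lambda>a::'a. to_fract [:a:])"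
  assumes "k \<noteq> 0"
  shows "to_fract (Q_transform k f) =
           (T / c k) ^ Polynomial.degree f * poly (map_poly c f) (c k * (T + inverse T))"
proof -
  let ?n = "Polynomial.degree f"
  have c0: "c 0 = 0" by (simp add: c_def)
  have ck: "c k \<noteq> 0" using assms by (simp add: c_def)
  have T: "T \<noteq> 0" by (simp add: T_def)
  have c_eq_0: "c a = 0 \<longleftrightarrow> a = 0" for a by (simp add: c_def)
  have deg: "Polynomial.degree (map_poly c f) = ?n"
    by (rule degree_map_poly) (simp add: c_eq_0)
  have inv: "to_fract [:0, 1 / k:] = T / c k"
  proof -
    have "to_fract [:0, 1 / k:] * c k = T"
      using assms by (simp add: T_def c_def flip: to_fract_mult)
    thus ?thesis using ck by (simp add: field_simps)
  qed
  have sq: "to_fract [:1, 0, 1:] = T / c k * (c k * (T + inverse T))"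
  proof -
    have "[:1, 0, 1:] = [:0, 1:] * [:0, 1:] + (1 :: 'a poly)"
      by (simp add: one_pCons)
    hence "to_fract [:1, 0, 1:] = T * T + 1"
      by (simp only: T_def to_fract_add to_fract_mult to_fract_1)
    thus ?thesis using T ck by (simp add: field_simps)
  qed
  have smult: "to_fract (Polynomial.smult a g) = c a * to_fract g" for a g
    by (simp add: c_def flip: to_fract_mult)
  have pow: "to_fract (g ^ m) = to_fract g ^ m" for g :: "'a poly" and m
    by (induction m) simp_all
  have sum: "to_fract (\<Sum>i\<in>A. h i) = (\<Sum>i\<in>A. to_fract (h i))" for h :: "nat \<Rightarrow> 'a poly" and A
    by (induction A rule: infinite_finite_induct) simp_all
  have "to_fract (Q_transform k f) =
          (\<Sum>i\<le>?n. c (Polynomial.coeff f i) *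
             ((T / c k) ^ (?n - i) * (T / c k * (c k * (T + inverse T))) ^ i))"
    by (simp only: Q_transform_def sum smult to_fract_mult pow inv sq)
  also have "\<dots> = (\<Sum>i\<le>?n. (T / c k) ^ ?n * (c (Polynomial.coeff f i) * (c k * (T + inverse T)) ^ i))"
  proof (rule sum.cong)
    fix i assume "i \<in> {..?n}"
    hence "(T / c k) ^ ?n = (T / c k) ^ (?n - i) * (T / c k) ^ i"
      by (simp flip: power_add)
    thus "c (Polynomial.coeff f i) *
             ((T / c k) ^ (?n - i) * (T / c k * (c k * (T + inverse T))) ^ i) =
          (T / c k) ^ ?n * (c (Polynomial.coeff f i) * (c k * (T + inverse T)) ^ i)"
      by (simp only: power_mult_distrib mult_ac)
  qed simp
  also have "\<dots> = (T / c k) ^ ?n * poly (map_poly c f) (c k * (T + inverse T))"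
    by (simp add: poly_altdef deg coeff_map_poly c0 sum_distrib_left)
  finally show ?thesis .
qed


subsection \<open>The parameter sets\<close>

definition C2 :: "'p::prime_card mod_ring set" where
  "C2 = {k. [CARD('p) = 1] (mod 4) \<and> k\<^sup>2 + 1 / 4 = 0}"

definition C3 :: "'p::prime_card mod_ring set" where
  "C3 = {k. CARD('p) mod 7 \<in> {1, 2, 4} \<and> k\<^sup>2 + 1 / 2 * k + 1 / 2 = 0}"

definition C3_neg :: "'p::prime_card mod_ring set" where
  "C3_neg = {k. - k \<in> C3}"


subsection \<open>Elliptic curves \<open>y\<^sup>2 = x\<^sup>3 + A x + B\<close> and their endomorphism rings\<close>

datatype 'a ec_point = Affine 'a 'a | EC_Infinity

definition ec_points :: "'a::field \<Rightarrow> 'a \<Rightarrow> 'a ec_point set" where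
  "ec_points A B = insert EC_Infinity {Affine x y | x y. y\<^sup>2 = x ^ 3 + A * x + B}"

text \<open>The chord-and-tangent law in characteristic other than 2 (it does not involve \<open>B\<close>).\<close>

fun ec_add :: "'a::field \<Rightarrow> 'a ec_point \<Rightarrow> 'a ec_point \<Rightarrow> 'a ec_point" where
  "ec_add A EC_Infinity Q = Q"
| "ec_add A P EC_Infinity = P"
| "ec_add A (Affine x1 y1) (Affine x2 y2) =
     (if x1 = x2 \<and> y1 = - y2 then EC_Infinity
      else let l = (if x1 = x2 then (3 * x1\<^sup>2 + A) / (2 * y1) else (y2 - y1) / (x2 - x1));
               x3 = l\<^sup>2 - x1 - x2
           in Affine x3 (l * (x1 - x3) - y1))"

text \<open>A polynomial in two variables is an element of \<open>K[X][Y]\<close>.\<close>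

definition poly_xy :: "'a::field poly poly \<Rightarrow> 'a \<Rightarrow> 'a \<Rightarrow> 'a" where
  "poly_xy F x y = poly (poly F [:y:]) x"

text \<open>
  Over an algebraically closed field, an endomorphism is a homomorphism of the group of points
  that is either zero or given by a pair of rational functions in \<open>x\<close> and \<open>y\<close> at all points
  outside the finite set formed by \<^const>\<open>EC_Infinity\<close> and the zeros of the denominators.
\<close>

definition ec_rational_map :: "'a::field \<Rightarrow> 'a \<Rightarrow> ('a ec_point \<Rightarrow> 'a ec_point) \<Rightarrow> bool" where
  "ec_rational_map A B \<phi> \<longleftrightarrow>
     (\<exists>F1 G1 F2 G2.
        finite {(x, y). Affine x y \<in> ec_points A B \<and> (poly_xy G1 x y = 0 \<or> poly_xy G2 x y = 0)} \<and>
        (\<forall>x y. Affine x y \<in> ec_points A B \<and> poly_xy G1 x y \<noteq> 0 \<and> poly_xy G2 x y \<noteq> 0 \<longrightarrow>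
           \<phi> (Affine x y) =
             Affine (poly_xy F1 x y / poly_xy G1 x y) (poly_xy F2 x y / poly_xy G2 x y)))"

definition ec_endomorphisms :: "'a::field \<Rightarrow> 'a \<Rightarrow> ('a ec_point \<Rightarrow> 'a ec_point) set" where
  "ec_endomorphisms A B =
     {\<phi> \<in> ec_points A B \<rightarrow>\<^sub>E ec_points A B.
        (\<forall>P\<in>ec_points A B. \<forall>Q\<in>ec_points A B. \<phi> (ec_add A P Q) = ec_add A (\<phi> P) (\<phi> Q)) \<and>
        ((\<forall>P\<in>ec_points A B. \<phi> P = EC_Infinity) \<or> ec_rational_map A B \<phi>)}"

definition ec_End :: "'a::field \<Rightarrow> 'a \<Rightarrow> ('a ec_point \<Rightarrow> 'a ec_point) ring" where
  "ec_End A B =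
     \<lparr> carrier = ec_endomorphisms A B,
       monoid.mult = compose (ec_points A B),
       one = (\<lambda>P\<in>ec_points A B. P),
       ring.zero = (\<lambda>P\<in>ec_points A B. EC_Infinity),
       add = (\<lambda>\<phi> \<psi>. \<lambda>P\<in>ec_points A B. ec_add A (\<phi> P) (\<psi> P)) \<rparr>"

fun frobenius :: "nat \<Rightarrow> 'a::field ec_point \<Rightarrow> 'a ec_point" where
  "frobenius p EC_Infinity = EC_Infinity"
| "frobenius p (Affine x y) = Affine (x ^ p) (y ^ p)"


subsection \<open>The quadratic rings\<close>

text \<open>\<open>\<int>[w]\<close> for a quadratic algebraic integer \<open>w\<close>.\<close>

definition Z_adjoin :: "complex \<Rightarrow> complex ring" where
  "Z_adjoin w =
     \<lparr> carrier = {of_int a + of_int b * w | a b. True},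
       monoid.mult = (*), one = 1, ring.zero = 0, add = (+) \<rparr>"

definition alpha :: complex where
  "alpha = (1 + \<i> * of_real (sqrt 7)) / 2"

definition gauss_norm :: "complex \<Rightarrow> nat" where
  "gauss_norm z = nat (\<lfloor>Re z\<rfloor>\<^sup>2 + \<lfloor>Im z\<rfloor>\<^sup>2)"

definition ring_valuation :: "complex ring \<Rightarrow> complex \<Rightarrow> complex \<Rightarrow> nat" where
  "ring_valuation R \<rho> r = (GREATEST e. (\<rho> ^ e) divides\<^bsub>R\<^esub> r)"

text \<open>
  Under some identification of \<open>R\<close> with the ring of endomorphisms (over the algebraic closure) of
  the curve with coefficients \<open>A\<close>, \<open>B\<close> in the prime field, \<open>\<pi>\<close> corresponds to the Frobenius
  endomorphism.
\<close>

definition represents_frobenius ::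
    "complex ring \<Rightarrow> 'p::prime_card mod_ring \<Rightarrow> 'p mod_ring \<Rightarrow> complex \<Rightarrow> bool" where
  "represents_frobenius R A B \<pi> \<longleftrightarrow>
     \<pi> \<in> carrier R \<and>
     (\<exists>\<Phi> \<in> ring_iso R (ec_End (to_ac A) (to_ac B)).
        \<Phi> \<pi> = restrict (frobenius CARD('p)) (ec_points (to_ac A) (to_ac B)))"

definition rho0 :: "complex \<Rightarrow> int \<Rightarrow> complex" where
  "rho0 \<pi> \<sigma> = (if \<pi> divides\<^bsub>Z_adjoin alpha\<^esub> (alpha - of_int \<sigma>) then alpha else cnj alpha)"


subsection \<open>The construction of the sequence of polynomials\<close>

definition first_step ::
    "'p::prime_card mod_ring \<Rightarrow> nat \<Rightarrow> 'p mod_ring poly \<Rightarrow> 'p mod_ring poly \<Rightarrow> bool" where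
  "first_step k n f g \<longleftrightarrow>
     (if Factorial_Ring.irreducible (Q_transform k f) then g = Q_transform k f
      else \<exists>g1 g2. g1 \<in> Irr_deg n \<and> g2 \<in> Irr_deg n \<and> Q_transform k f = g1 * g2 \<and>
             (\<exists>x\<in>GF_ext n. poly (map_poly to_ac g1) x = 0 \<and>
                \<not> theta_periodic (to_ac k) (Fin x)) \<and>
             g = g1)"

definition next_step ::
    "'p::prime_card mod_ring \<Rightarrow> 'p mod_ring poly \<Rightarrow> 'p mod_ring poly \<Rightarrow> bool" where
  "next_step k f g \<longleftrightarrow>
     (if Factorial_Ring.irreducible (Q_transform k f) then g = Q_transform k f
      else \<exists>g1 g2. g1 \<in> Irr \<and> g2 \<in> Irr \<and> Polynomial.degree g1 = Polynomial.degree g2 \<and>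
             Q_transform k f = g1 * g2 \<and> g = g1)"

end

theory Submission
  imports Defs
begin

text \<open>
  In each case \<open>\<theta>\<^sub>k\<close> is, after a change of coordinate on the projective line, the action on
  \<open>x\<close>-coordinates of an endomorphism \<open>\<rho>\<close> of degree 2: \<open>\<rho>\<close> is an associate of \<open>1 + i\<close> for \<open>k \<in> C\<^sub>2\<close>,
  and one of \<open>\<alpha>\<close>, \<open>1 - \<alpha>\<close> for \<open>k \<in> C\<^sub>3\<close>. A point \<open>P\<close> has its coordinate in the field with \<open>p\<^sup>m\<close>
  elements iff \<open>\<pi>\<^sup>m P = \<plusminus> P\<close>, that is, iff \<open>\<pi>\<^sup>m - 1\<close> or \<open>\<pi>\<^sup>m + 1\<close> kills \<open>P\<close>, and \<open>\<theta>\<^sub>k\<close> is periodic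
  exactly at the points killed by an element prime to \<open>\<rho>\<close>. So the number of steps that a point needs
  to reach a cycle of \<open>\<theta>\<^sub>k\<close> is bounded by \<open>\<rho>\<close>-adic valuations of \<open>\<pi>\<^sup>m \<plusminus> 1\<close>, and since
  \<open>\<pi>\<^bsup>2m\<^esup> - 1 = (\<pi>\<^sup>m - 1) (\<pi>\<^sup>m - 1 + 2)\<close>, these valuations grow by \<open>\<nu>\<^sub>\<rho>(2)\<close> at each doubling of \<open>m\<close>. A root of
  \<open>f\<^sub>i\<close> lies \<open>i\<close> steps above a root of \<open>f\<^sub>0\<close>, so its depth determines its degree.

  For \<open>k \<in> C\<^sub>3\<close> the endomorphism \<open>\<rho>\<close> is an explicit isogeny with kernel of order 2. It multiplies the
  differential \<open>dx / y\<close> by \<open>2 k + 1\<close>, and an endomorphism that kills the differential factors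
  through Frobenius; hence \<open>\<pi>\<close> divides \<open>\<rho> - \<sigma>\<close>, which identifies \<open>\<rho>\<close> as \<open>\<rho>\<^sub>0\<close>.

  Associativity of the group law is never needed: a ring isomorphism onto the endomorphisms already
  makes each orbit of a point under the endomorphism ring a module over that ring.
\<close>

section \<open>The chord and tangent construction\<close>

text \<open>The isomorphism between the quadratic ring and the endomorphism ring is arbitrary, so an
  explicit isogeny does not come with a name in the ring: the element that represents it has to be
  deduced. For y^2 = x^3 + x it suffices to know that element up to conjugation, because the
  Gaussian norm cannot see the difference. For the other curve, 2 = alpha (1 - alpha) with two
  factors that are not associates, so it matters which of them the isogeny is. No theory of degrees
  or dual isogenies is invoked; the norm of the isogeny comes from its product with the isogeny for
  the conjugate root, which is doubling up to sign.

  The valuation of 2 is 2 in the Gaussian case and 1 in the other. This is why degrees come in pairs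
  in one tail of the claim and singly in the other. The growth of valuations also needs e0 + e1 to
  exceed the valuation of 2; a rational point of order 2 on each curve provides the lower bounds on
  e0 and e1.\<close>

fun ec_neg :: "'a::field ec_point \<Rightarrow> 'a ec_point" where
  "ec_neg EC_Infinity = EC_Infinity"
| "ec_neg (Affine x y) = Affine x (- y)"

lemma ec_infinity_in [simp]: "EC_Infinity \<in> ec_points A B"
  by (simp add: ec_points_def)

lemma Affine_in_ec_points [simp]:
  "Affine x y \<in> ec_points A B \<longleftrightarrow> y\<^sup>2 = x ^ 3 + A * x + B"
  by (auto simp: ec_points_def)

lemma ec_add_infinity_right [simp]: "ec_add A P EC_Infinity = P"
  by (cases P) auto

lemma ec_add_eq_infinity_iff: "ec_add A P Q = EC_Infinity \<longleftrightarrow> Q = ec_neg P"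
  by (cases P; cases Q) (auto simp: Let_def)

lemma ec_neg_neg [simp]: "ec_neg (ec_neg P) = P"
  by (cases P) auto

text \<open>Cancellation would need associativity, so the tangent formula is used instead: if the
  new abscissa is again x, the new ordinate is -y. This is what makes \<open>\<Phi> 0\<close> the
  zero map.\<close>

lemma ec_add_idem:
  fixes P :: "'a::field ec_point"
  assumes "(2::'a) \<noteq> 0" "ec_add A P P = P"
  shows "P = EC_Infinity"
proof (cases P)
  case (Affine x y)
  show ?thesis
  proof (cases "y = - y")
    case True
    then show ?thesis using assms Affine by simp
  next
    case False
    let ?l = "(3 * x\<^sup>2 + A) / (2 * y)"
    have 1: "?l\<^sup>2 - x - x = x" "?l * (x - (?l\<^sup>2 - x - x)) - y = y"
      using assms(2) Affine False by (auto simp: Let_def)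
    have "- y = y" using 1(2) unfolding 1(1) by simp
    with False show ?thesis by simp
  qed
qed simp

text \<open>The line \<open>y = l x + m\<close> meets the curve in the abscissae \<open>x1\<close>, \<open>x2\<close>, \<open>x3\<close>, by Vieta's formulas.\<close>

definition ec_line :: "'a::field \<Rightarrow> 'a \<Rightarrow> 'a \<Rightarrow> 'a \<Rightarrow> 'a \<Rightarrow> 'a \<Rightarrow> 'a \<Rightarrow> bool" where
  "ec_line A B l m x1 x2 x3 \<longleftrightarrow>
     x1 + x2 + x3 = l\<^sup>2 \<and> x1 * x2 + x1 * x3 + x2 * x3 = A - 2 * l * m \<and> x1 * x2 * x3 = m\<^sup>2 - B"

text \<open>In terms of lines, chord and tangent need no separate treatment: for
  \<open>x1 = x2\<close> the first two Vieta relations say that \<open>l\<close> is the slope of the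
  tangent.\<close>

lemma ec_add_line:
  fixes A :: "'a::field"
  assumes two: "(2::'a) \<noteq> 0"
    and "ec_line A B l m x1 x2 x3" "y1 = l * x1 + m" "y2 = l * x2 + m" "\<not> (x1 = x2 \<and> y1 = - y2)"
  shows "ec_add A (Affine x1 y1) (Affine x2 y2) = Affine x3 (- (l * x3 + m))"
proof -
  have e: "x1 + x2 + x3 = l\<^sup>2" "x1 * x2 + x1 * x3 + x2 * x3 = A - 2 * l * m"
    using assms(2) by (auto simp: ec_line_def)
  have "(if x1 = x2 then (3 * x1\<^sup>2 + A) / (2 * y1) else (y2 - y1) / (x2 - x1)) = l"
  proof (cases "x1 = x2")
    case True
    hence "y1 \<noteq> - y1" using assms(3-5) by auto
    hence y: "2 * y1 \<noteq> 0" using two by (metis add.inverse_unique mult_2)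
    have "3 * x1\<^sup>2 + A = l * (2 * y1)" using e True assms(3) by Groebner_Basis.algebra
    with y True show ?thesis by (simp add: divide_eq_eq)
  next
    case False
    have "y2 - y1 = l * (x2 - x1)" using assms(3,4) by Groebner_Basis.algebra
    with False show ?thesis by (simp add: divide_eq_eq)
  qed
  moreover have "l\<^sup>2 - x1 - x2 = x3" "l * (x1 - x3) - y1 = - (l * x3 + m)"
    using e assms(3) by Groebner_Basis.algebra+
  ultimately show ?thesis using assms(5) by (simp only: ec_add.simps Let_def if_False)
qed

lemma ec_line_exists:
  fixes A :: "'a::field"
  assumes two: "(2::'a) \<noteq> 0"
    and "y1\<^sup>2 = x1 ^ 3 + A * x1 + B" "y2\<^sup>2 = x2 ^ 3 + A * x2 + B" "\<not> (x1 = x2 \<and> y1 = - y2)"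
  obtains l m x3 where "ec_line A B l m x1 x2 x3" "y1 = l * x1 + m" "y2 = l * x2 + m"
proof -
  define l where "l = (if x1 = x2 then (3 * x1\<^sup>2 + A) / (2 * y1) else (y2 - y1) / (x2 - x1))"
  define m where "m = y1 - l * x1"
  define x3 where "x3 = l\<^sup>2 - x1 - x2"
  have A: "y2 = l * x2 + m \<and> x1 * x2 + x1 * x3 + x2 * x3 = A - 2 * l * m"
  proof (cases "x1 = x2")
    case True
    have "(y1 - y2) * (y1 + y2) = 0" using assms(2,3) True by Groebner_Basis.algebra
    hence y2: "y2 = y1" using assms(4) True by (simp add: eq_neg_iff_add_eq_0)
    hence "y1 \<noteq> - y1" using assms(4) True by auto
    hence y: "2 * y1 \<noteq> 0" using two by (metis add.inverse_unique mult_2)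
    have l: "l * (2 * y1) = 3 * x1\<^sup>2 + A" using y True by (simp add: l_def)
    show ?thesis using l y2 True unfolding m_def x3_def by Groebner_Basis.algebra
  next
    case False
    have l: "l * (x2 - x1) = y2 - y1" using False by (simp add: l_def)
    \<comment> \<open>The difference of the two curve equations, with a common factor
      \<open>x2 - x1\<close> to be cancelled.\<close>
    hence "(x2 - x1) * (l * (y1 + y2)) = (x2 - x1) * (x1\<^sup>2 + x1 * x2 + x2\<^sup>2 + A)"
      using assms(2,3) by Groebner_Basis.algebra
    hence "l * (y1 + y2) = x1\<^sup>2 + x1 * x2 + x2\<^sup>2 + A" using False by simp
    thus ?thesis using l unfolding m_def x3_def by Groebner_Basis.algebra
  qed
  have "x1 * x2 * x3 = m\<^sup>2 - B"
  proof -
    have "(l * x1 + m)\<^sup>2 - (x1 ^ 3 + A * x1 + B) = 0" using assms(2) by (simp add: m_def)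
    moreover have "m\<^sup>2 - B = x1 * (x1\<^sup>2 + (A - 2 * l * m) - l\<^sup>2 * x1) + ((l * x1 + m)\<^sup>2 - (x1 ^ 3 + A * x1 + B))"
      by Groebner_Basis.algebra
    ultimately have "m\<^sup>2 - B = x1 * (x1\<^sup>2 + (x1 * x2 + x1 * x3 + x2 * x3) - l\<^sup>2 * x1)"
      using A by simp
    also have "\<dots> = x1 * x2 * x3" unfolding x3_def by Groebner_Basis.algebra
    finally show ?thesis by simp
  qed
  moreover have "x1 + x2 + x3 = l\<^sup>2" "y1 = l * x1 + m" by (simp_all add: x3_def m_def)
  ultimately show ?thesis using A that[of l m x3] unfolding ec_line_def by blast
qed

lemma ec_line_on_curve:
  assumes "ec_line A B l m x1 x2 x3"
  shows "(l * x3 + m)\<^sup>2 = x3 ^ 3 + A * x3 + B"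
proof -
  have "(l * x3 + m)\<^sup>2 - (x3 ^ 3 + A * x3 + B) =
      - (x3\<^sup>2 * (x1 + x2 + x3 - l\<^sup>2)) + x3 * (x1 * x2 + x1 * x3 + x2 * x3 - (A - 2 * l * m))
      - (x1 * x2 * x3 - (m\<^sup>2 - B))"
    by Groebner_Basis.algebra
  also have "\<dots> = 0" using assms by (simp add: ec_line_def)
  finally show ?thesis by simp
qed

lemma ec_add_closed:
  fixes A :: "'a::field"
  assumes "(2::'a) \<noteq> 0" "P \<in> ec_points A B" "Q \<in> ec_points A B"
  shows "ec_add A P Q \<in> ec_points A B"
proof (cases "P = EC_Infinity \<or> Q = EC_Infinity \<or> Q = ec_neg P")
  case True
  thus ?thesis using assms ec_add_eq_infinity_iff[of A P Q] by auto
next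
  case False
  then obtain x1 y1 x2 y2 where PQ: "P = Affine x1 y1" "Q = Affine x2 y2"
    by (metis ec_point.exhaust)
  have n: "\<not> (x1 = x2 \<and> y1 = - y2)" using False PQ by auto
  obtain l m x3 where l: "ec_line A B l m x1 x2 x3" "y1 = l * x1 + m" "y2 = l * x2 + m"
    using ec_line_exists[OF assms(1) _ _ n, of A B] assms PQ by auto
  show ?thesis using ec_add_line[OF assms(1) l n] ec_line_on_curve[OF l(1)] PQ by (simp only: Affine_in_ec_points power2_minus)
qed

section \<open>Endomorphisms of degree 2\<close>

text \<open>
  Velu's formulas for the quotient by the point \<open>(e, 0)\<close> of order 2, followed by the scaling
  \<open>(x, y) \<mapsto> (w\<^sup>2 x, w\<^sup>3 y)\<close>, which in \<open>velu_curve\<close> leads back to the original curve.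
\<close>

fun velu :: "'a::field \<Rightarrow> 'a \<Rightarrow> 'a \<Rightarrow> 'a ec_point \<Rightarrow> 'a ec_point" where
  "velu e b w EC_Infinity = EC_Infinity"
| "velu e b w (Affine x y) =
     (if x = e then EC_Infinity
      else Affine (w\<^sup>2 * (x + b / (x - e))) (w ^ 3 * y * (1 - b / (x - e)\<^sup>2)))"

text \<open>The quotient curve has the coefficients \<open>A - 5 * b\<close> and
  \<open>B - 7 * e * b\<close>; \<open>wA\<close> and \<open>wB\<close> say that the scaling by
  \<open>w\<close> turns them back into \<open>A\<close> and \<open>B\<close>. \<open>b\<close> is
  the derivative of the cubic at its root \<open>e\<close>.\<close>

locale velu_curve =
  fixes A B e b w :: "'a::field"
  assumes two: "(2::'a) \<noteq> 0"
    and b_def: "b = 3 * e\<^sup>2 + A"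
    and root: "e ^ 3 + A * e + B = 0"
    and wA: "w ^ 4 * (A - 5 * b) = A"
    and wB: "w ^ 6 * (B - 7 * e * b) = B"
    and nonsing: "\<And>x. \<not> (x ^ 3 + A * x + B = 0 \<and> 3 * x\<^sup>2 + A = 0)"
begin

lemma b_nz: "b \<noteq> 0"
  using nonsing[of e] root b_def by auto

lemma velu_closed:
  assumes "P \<in> ec_points A B"
  shows "velu e b w P \<in> ec_points A B"
proof (cases P)
  case (Affine x y)
  show ?thesis
  proof (cases "x = e")
    case False
    define v where "v = 1 / (x - e)"
    have v: "v * (x - e) = 1" using False by (simp add: v_def)
    have y: "y\<^sup>2 = x ^ 3 + A * x + B" using assms Affine by simp
    \<comment> \<open>With the kernel point moved to the origin, \<open>A\<close> and
      \<open>B\<close> are polynomials in \<open>e\<close> and \<open>b\<close>, and the claim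
      becomes a polynomial identity modulo \<open>v * \<xi> = 1\<close>, without
      denominators.\<close>
    define \<xi> where "\<xi> = x - e"
    have v: "v * \<xi> = 1" and x: "x = \<xi> + e" using v by (auto simp: \<xi>_def)
    have A: "A = b - 3 * e\<^sup>2" and B: "B = 2 * e ^ 3 - b * e" using b_def root by Groebner_Basis.algebra+
    have y: "y\<^sup>2 = \<xi> ^ 3 + 3 * e * \<xi>\<^sup>2 + b * \<xi>" using y unfolding x A B by Groebner_Basis.algebra
    have "(\<xi> ^ 3 + 3 * e * \<xi>\<^sup>2 + b * \<xi>) * (1 - b * v\<^sup>2)\<^sup>2 =
       (\<xi> + e + b * v) ^ 3 + (b - 3 * e\<^sup>2 - 5 * b) * (\<xi> + e + b * v) + (2 * e ^ 3 - b * e - 7 * e * b)"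
      using v by Groebner_Basis.algebra
    hence "y\<^sup>2 * (1 - b * v\<^sup>2)\<^sup>2 = (x + b * v) ^ 3 + (A - 5 * b) * (x + b * v) + (B - 7 * e * b)"
      unfolding y x A B .
    hence "(w ^ 3 * y * (1 - b * v\<^sup>2))\<^sup>2 = w ^ 6 * ((x + b * v) ^ 3 + (A - 5 * b) * (x + b * v) + (B - 7 * e * b))"
      by Groebner_Basis.algebra
    also have "\<dots> = (w\<^sup>2 * (x + b * v)) ^ 3 + (w ^ 4 * (A - 5 * b)) * (w\<^sup>2 * (x + b * v)) + w ^ 6 * (B - 7 * e * b)"
      by Groebner_Basis.algebra
    finally have "(w ^ 3 * y * (1 - b * v\<^sup>2))\<^sup>2 = (w\<^sup>2 * (x + b * v)) ^ 3 + A * (w\<^sup>2 * (x + b * v)) + B"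
      by (simp only: wA wB)
    thus ?thesis using Affine False by (simp add: v_def power_divide)
  qed (use Affine in auto)
qed auto

lemma velu_neg: "velu e b w (ec_neg P) = ec_neg (velu e b w P)"
  by (cases P) auto

lemma ec_line_shift:
  assumes "ec_line A B l m x1 x2 x3"
  shows "(x1 - e) + (x2 - e) + (x3 - e) = l\<^sup>2 - 3 * e"
    and "(x1 - e) * (x2 - e) + (x1 - e) * (x3 - e) + (x2 - e) * (x3 - e) = b - 2 * l * (m + l * e)"
    and "(x1 - e) * (x2 - e) * (x3 - e) = (m + l * e)\<^sup>2"
proof -
  have L1: "x1 + x2 + x3 = l\<^sup>2" and L2: "x1 * x2 + x1 * x3 + x2 * x3 = A - 2 * l * m"
    and L3: "x1 * x2 * x3 = m\<^sup>2 - B" using assms by (auto simp: ec_line_def)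
  show "(x1 - e) + (x2 - e) + (x3 - e) = l\<^sup>2 - 3 * e" unfolding L1[symmetric] by Groebner_Basis.algebra
  have "(x1 - e) * (x2 - e) + (x1 - e) * (x3 - e) + (x2 - e) * (x3 - e)
     = (x1 * x2 + x1 * x3 + x2 * x3) - 2 * e * (x1 + x2 + x3) + 3 * e\<^sup>2" by Groebner_Basis.algebra
  also have "\<dots> = b - 2 * l * (m + l * e)" unfolding L1 L2 b_def by Groebner_Basis.algebra
  finally show "(x1 - e) * (x2 - e) + (x1 - e) * (x3 - e) + (x2 - e) * (x3 - e) = b - 2 * l * (m + l * e)" .
  have "(x1 - e) * (x2 - e) * (x3 - e)
     = x1 * x2 * x3 - e * (x1 * x2 + x1 * x3 + x2 * x3) + e\<^sup>2 * (x1 + x2 + x3) - e ^ 3" by Groebner_Basis.algebra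
  also have "\<dots> = (m + l * e)\<^sup>2 - (e ^ 3 + A * e + B)" unfolding L1 L2 L3 by Groebner_Basis.algebra
  finally show "(x1 - e) * (x2 - e) * (x3 - e) = (m + l * e)\<^sup>2" by (simp add: root)
qed

text \<open>The claims are symmetric in the three points, so they only involve the elementary
  symmetric functions of the \<open>z\<close> (given by the line) and of their inverses
  \<open>v\<close>, whose product is the square of \<open>r\<close>. Here \<open>\<mu>\<close> is
  the height of the line over the abscissa \<open>e\<close>; \<open>L\<close> and \<open>M\<close>
  are slope and intercept of the line through the images before the scaling by
  \<open>w\<close>.\<close>

lemma velu_line_shifted:
  fixes l \<mu> z1 z2 z3 v1 v2 v3 :: 'a
  assumes v: "v1 * z1 = 1" "v2 * z2 = 1" "v3 * z3 = 1"
    and S: "z1 + z2 + z3 = l\<^sup>2 - 3 * e" "z1 * z2 + z1 * z3 + z2 * z3 = b - 2 * l * \<mu>" "z1 * z2 * z3 = \<mu>\<^sup>2"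
    and r: "r * \<mu> = 1"
  defines "L \<equiv> l - b * r" and "M \<equiv> \<mu> - 3 * e * l + b * l\<^sup>2 * r + 2 * e * (l - b * r)"
    and "Z1 \<equiv> z1 + e + b * v1" and "Z2 \<equiv> z2 + e + b * v2" and "Z3 \<equiv> z3 + e + b * v3"
  shows "Z1 + Z2 + Z3 = L\<^sup>2"
    and "Z1 * Z2 + Z1 * Z3 + Z2 * Z3 = (A - 5 * b) - 2 * L * M"
    and "Z1 * Z2 * Z3 = M\<^sup>2 - (B - 7 * e * b)"
proof -
  have A: "A = b - 3 * e\<^sup>2" and B: "B = 2 * e ^ 3 - b * e" using b_def root by Groebner_Basis.algebra+
  have "v1 * v2 * v3 * (z1 * z2 * z3) = 1" using v by Groebner_Basis.algebra
  hence t3: "v1 * v2 * v3 = r\<^sup>2" using r unfolding S by Groebner_Basis.algebra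
  have "v1 * v2 + v1 * v3 + v2 * v3 = v1 * v2 * v3 * (z1 + z2 + z3)" using v by Groebner_Basis.algebra
  hence t2: "v1 * v2 + v1 * v3 + v2 * v3 = r\<^sup>2 * (l\<^sup>2 - 3 * e)" unfolding t3 S .
  have "v1 + v2 + v3 = v1 * v2 * v3 * (z1 * z2 + z1 * z3 + z2 * z3)" using v by Groebner_Basis.algebra
  hence t1: "v1 + v2 + v3 = r\<^sup>2 * (b - 2 * l * \<mu>)" unfolding t3 S .
  have "Z1 + Z2 + Z3 = (z1 + z2 + z3) + 3 * e + b * (v1 + v2 + v3)"
    unfolding Z1_def Z2_def Z3_def by Groebner_Basis.algebra
  also have "\<dots> = L\<^sup>2" unfolding S t1 L_def using r by Groebner_Basis.algebra
  finally show "Z1 + Z2 + Z3 = L\<^sup>2" .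
  have "Z1 * Z2 + Z1 * Z3 + Z2 * Z3 = (z1 * z2 + z1 * z3 + z2 * z3) + 2 * e * (z1 + z2 + z3) + 3 * e\<^sup>2
     + b * ((z1 + z2 + z3) * (v1 + v2 + v3) - 3) + 2 * e * b * (v1 + v2 + v3)
     + b\<^sup>2 * (v1 * v2 + v1 * v3 + v2 * v3)"
    unfolding Z1_def Z2_def Z3_def using v by Groebner_Basis.algebra
  also have "\<dots> = (A - 5 * b) - 2 * L * M"
    unfolding S t1 t2 L_def M_def A using r by Groebner_Basis.algebra
  finally show "Z1 * Z2 + Z1 * Z3 + Z2 * Z3 = (A - 5 * b) - 2 * L * M" .
  have "Z1 * Z2 * Z3 = z1 * z2 * z3 + e * (z1 * z2 + z1 * z3 + z2 * z3) + e\<^sup>2 * (z1 + z2 + z3) + e ^ 3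
     + b * (z1 * z2 * z3) * ((v1 + v2 + v3)\<^sup>2 - 2 * (v1 * v2 + v1 * v3 + v2 * v3))
     + b\<^sup>2 * (v1 * v2 * v3) * ((z1 + z2 + z3)\<^sup>2 - 2 * (z1 * z2 + z1 * z3 + z2 * z3))
     + b ^ 3 * (v1 * v2 * v3) + e * b * ((z1 + z2 + z3) * (v1 + v2 + v3) - 3)
     + e\<^sup>2 * b * (v1 + v2 + v3) + e * b\<^sup>2 * (v1 * v2 + v1 * v3 + v2 * v3)"
    unfolding Z1_def Z2_def Z3_def using v by Groebner_Basis.algebra
  also have "\<dots> = M\<^sup>2 - (B - 7 * e * b)"
    unfolding S t1 t2 t3 M_def B using r by Groebner_Basis.algebra
  finally show "Z1 * Z2 * Z3 = M\<^sup>2 - (B - 7 * e * b)" .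
qed

lemma velu_line:
  assumes l: "ec_line A B l m x1 x2 x3" and n: "x1 \<noteq> e" "x2 \<noteq> e" "x3 \<noteq> e"
  defines "Xf \<equiv> \<lambda>x. w\<^sup>2 * (x + b / (x - e))" and "Yf \<equiv> \<lambda>x. w ^ 3 * (l * x + m) * (1 - b / (x - e)\<^sup>2)"
  obtains l' m' where "ec_line A B l' m' (Xf x1) (Xf x2) (Xf x3)"
    "Yf x1 = l' * Xf x1 + m'" "Yf x2 = l' * Xf x2 + m'" "Yf x3 = l' * Xf x3 + m'"
proof -
  define \<mu> where "\<mu> = m + l * e"
  define v where "v = (\<lambda>x. 1 / (x - e))"
  have v: "v x * (x - e) = 1" if "x \<noteq> e" for x
    using that by (auto simp: v_def)
  note s1 = ec_line_shift(1)[OF l] and s2 = ec_line_shift(2)[OF l, folded \<mu>_def] and s3 = ec_line_shift(3)[OF l, folded \<mu>_def]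
  have "\<mu> \<noteq> 0" using s3 n by auto
  define r where "r = 1 / \<mu>"
  have r: "r * \<mu> = 1" using \<open>\<mu> \<noteq> 0\<close> by (simp add: r_def)
  define L' M' where LM: "L' = l - b * r" "M' = \<mu> - 3 * e * l + b * l\<^sup>2 * r + 2 * e * (l - b * r)"
  have Yq: "(l * x + m) * (1 - b * (v x)\<^sup>2) = L' * (x + b * v x) + M'"
    if "x \<noteq> e" "(l * x + m)\<^sup>2 = x ^ 3 + A * x + B" for x
  proof -
    define z where "z = x - e"
    have x: "x = z + e" by (simp add: z_def)
    have u: "v x * z = 1" using v[OF that(1)] by (simp add: z_def)
    have a: "(l * z + \<mu>)\<^sup>2 = z * (z\<^sup>2 + 3 * e * z + b)"
      using that(2) root unfolding x \<mu>_def b_def by Groebner_Basis.algebra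
    \<comment> \<open>A polynomial identity whose last summand is a multiple of the curve equation
      \<open>a\<close> and therefore vanishes.\<close>
    have "((l * z + \<mu>) * (z\<^sup>2 - b)) * \<mu> = z * ((l * \<mu> - b) * (z\<^sup>2 + 3 * e * z + b) + (\<mu>\<^sup>2 - 3 * e * \<mu> * l + b * l\<^sup>2) * z)
        - b * ((l * z + \<mu>)\<^sup>2 - z * (z\<^sup>2 + 3 * e * z + b))"
      by Groebner_Basis.algebra
    note id = this
    define t where "t = v x"
    have u: "t * z = 1" using u by (simp add: t_def)
    have "(l * z + \<mu>) * (1 - b * t\<^sup>2) = r * t\<^sup>2 * (((l * z + \<mu>) * (z\<^sup>2 - b)) * \<mu>)"
      using u r by Groebner_Basis.algebra
    also have "\<dots> = r * t\<^sup>2 * (z * ((l * \<mu> - b) * (z\<^sup>2 + 3 * e * z + b) + (\<mu>\<^sup>2 - 3 * e * \<mu> * l + b * l\<^sup>2) * z))"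
      by (simp only: id a diff_self mult_zero_right diff_zero)
    also have "\<dots> = (l - b * r) * (z + 3 * e + b * t) + (\<mu> - 3 * e * l + b * l\<^sup>2 * r)"
      using u r by Groebner_Basis.algebra
    also have "\<dots> = L' * (z + e + b * t) + M'" unfolding LM by Groebner_Basis.algebra
    finally have "(l * z + \<mu>) * (1 - b * t\<^sup>2) = L' * (z + e + b * t) + M'" .
    moreover have "l * z + \<mu> = l * x + m" "z + e = x" by (simp_all add: z_def \<mu>_def algebra_simps)
    ultimately show ?thesis by (simp only: t_def)
  qed
  have oc: "(l * x1 + m)\<^sup>2 = x1 ^ 3 + A * x1 + B" "(l * x2 + m)\<^sup>2 = x2 ^ 3 + A * x2 + B"
    "(l * x3 + m)\<^sup>2 = x3 ^ 3 + A * x3 + B" using ec_line_on_curve[of A B l m x2 x3 x1] ec_line_on_curve[of A B l m x1 x3 x2] ec_line_on_curve[OF l] l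
    by (simp_all add: ec_line_def mult_ac add_ac)
  define Z where "Z = (\<lambda>x. x + b * v x)"
  have z: "Z x1 + Z x2 + Z x3 = L'\<^sup>2"
    "Z x1 * Z x2 + Z x1 * Z x3 + Z x2 * Z x3 = (A - 5 * b) - 2 * L' * M'"
    "Z x1 * Z x2 * Z x3 = M'\<^sup>2 - (B - 7 * e * b)"
    using velu_line_shifted[OF v[OF n(1)] v[OF n(2)] v[OF n(3)] s1 s2 s3 r] by (simp_all add: Z_def LM)
  have Xf: "Xf x = w\<^sup>2 * Z x" for x
    by (auto simp: Xf_def Z_def v_def)
  have Yf: "Yf x = w * L' * Xf x + w ^ 3 * M'" if "x \<noteq> e" "(l * x + m)\<^sup>2 = x ^ 3 + A * x + B" for x
  proof -
    have "Yf x = w ^ 3 * ((l * x + m) * (1 - b * (v x)\<^sup>2))" by (simp add: Yf_def v_def power_divide)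
    also have "\<dots> = w ^ 3 * (L' * Z x + M')" unfolding Yq[OF that] Z_def ..
    finally show ?thesis unfolding Xf by Groebner_Basis.algebra
  qed
  show ?thesis
  proof (rule that[of "w * L'" "w ^ 3 * M'"])
    have "w\<^sup>2 * Z x1 + w\<^sup>2 * Z x2 + w\<^sup>2 * Z x3 = (w * L')\<^sup>2" using z(1) by Groebner_Basis.algebra
    moreover have "w\<^sup>2 * Z x1 * (w\<^sup>2 * Z x2) + w\<^sup>2 * Z x1 * (w\<^sup>2 * Z x3) + w\<^sup>2 * Z x2 * (w\<^sup>2 * Z x3)
       = w ^ 4 * (A - 5 * b) - 2 * (w * L') * (w ^ 3 * M')"
      using z(2) by Groebner_Basis.algebra
    moreover have "w\<^sup>2 * Z x1 * (w\<^sup>2 * Z x2) * (w\<^sup>2 * Z x3) = (w ^ 3 * M')\<^sup>2 - w ^ 6 * (B - 7 * e * b)"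
      using z(3) by Groebner_Basis.algebra
    ultimately show "ec_line A B (w * L') (w ^ 3 * M') (Xf x1) (Xf x2) (Xf x3)"
      unfolding ec_line_def Xf wA wB by blast
  qed (use Yf n oc in auto)
qed

text \<open>If none of the three collinear points is the kernel point, the images lie on a line
  again by \<open>velu_line\<close>. If one of them is, the shifted abscissae of the other two have
  product \<open>b\<close>, which means that these two differ by the kernel point up to sign, and
  their images agree up to sign.\<close>

lemma velu_add:
  assumes P: "P \<in> ec_points A B" and Q: "Q \<in> ec_points A B"
  shows "velu e b w (ec_add A P Q) = ec_add A (velu e b w P) (velu e b w Q)"
proof (cases "P = EC_Infinity \<or> Q = EC_Infinity")
  case False
  then obtain x1 y1 x2 y2 where PQ: "P = Affine x1 y1" "Q = Affine x2 y2"
    by (metis ec_point.exhaust)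
  show ?thesis
  proof (cases "x1 = x2 \<and> y1 = - y2")
    case True
    hence "Q = ec_neg P" using PQ by simp
    thus ?thesis using ec_add_eq_infinity_iff[of A P Q]
        ec_add_eq_infinity_iff[of A "velu e b w P" "velu e b w Q"] velu_neg by simp
  next
    case False
    have oc: "y1\<^sup>2 = x1 ^ 3 + A * x1 + B" "y2\<^sup>2 = x2 ^ 3 + A * x2 + B" using P Q PQ by auto
    obtain l m x3 where l: "ec_line A B l m x1 x2 x3" "y1 = l * x1 + m" "y2 = l * x2 + m"
      by (rule ec_line_exists[OF two oc False])
    have add: "ec_add A P Q = Affine x3 (- (l * x3 + m))"
      using ec_add_line[OF two l False] PQ by simp
    note s2 = ec_line_shift(2)[OF l(1)] and s3 = ec_line_shift(3)[OF l(1)]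
    \<comment> \<open>The two points differ by the kernel point \<open>(e, 0)\<close>.\<close>
    have T: "velu e b w (Affine x (l * x + m)) = velu e b w (Affine z (- (l * z + m)))"
      if "m + l * e = 0" "(x - e) * (z - e) = b" for x z
    proof -
      have nz: "x - e \<noteq> 0" "z - e \<noteq> 0" using that(2) b_nz by auto
      have z: "b / (x - e) = z - e" "b / (z - e) = x - e"
        using that(2) nz by (simp_all add: divide_eq_eq mult.commute)
      have z2: "b / (x - e)\<^sup>2 = (z - e) / (x - e)" "b / (z - e)\<^sup>2 = (x - e) / (z - e)"
        using z by (simp_all add: power2_eq_square divide_divide_eq_left[symmetric])
      have m: "m = - (l * e)" using that(1) by (simp add: eq_neg_iff_add_eq_0)
      have "(l * x + m) * (1 - (z - e) / (x - e)) = - (l * z + m) * (1 - (x - e) / (z - e))"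
        using nz unfolding m by (simp add: field_simps)
      thus ?thesis using nz unfolding velu.simps z2 z by (simp add: mult.assoc)
    qed
    consider (e1) "x1 = e" | (e2) "x1 \<noteq> e" "x2 = e" | (e3) "x1 \<noteq> e" "x2 \<noteq> e" "x3 = e"
      | (gen) "x1 \<noteq> e" "x2 \<noteq> e" "x3 \<noteq> e" by blast
    thus ?thesis
    proof cases
      case e1
      hence m: "m + l * e = 0" using s3 by simp
      have "(x2 - e) * (x3 - e) = b" using s2 unfolding m e1 by simp
      from T[OF m this] show ?thesis using add e1 PQ l by simp
    next
      case e2
      hence m: "m + l * e = 0" using s3 by simp
      have "(x1 - e) * (x3 - e) = b" using s2 unfolding m e2 by simp
      from T[OF m this] show ?thesis using add e2 PQ l by simp
    next
      case e3
      hence m: "m + l * e = 0" using s3 by simp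
      have "(x1 - e) * (x2 - e) = b" using s2 unfolding m e3 by simp
      from T[OF m this] have "velu e b w P = ec_neg (velu e b w Q)"
        using velu_neg[of Q] PQ l by simp
      hence "ec_add A (velu e b w P) (velu e b w Q) = EC_Infinity"
        by (simp add: ec_add_eq_infinity_iff)
      thus ?thesis using add e3 by simp
    next
      case gen
      define Xf Yf where XY: "Xf = (\<lambda>x. w\<^sup>2 * (x + b / (x - e)))"
        "Yf = (\<lambda>x. w ^ 3 * (l * x + m) * (1 - b / (x - e)\<^sup>2))"
      obtain l' m' where l': "ec_line A B l' m' (Xf x1) (Xf x2) (Xf x3)"
        and y: "Yf x1 = l' * Xf x1 + m'" "Yf x2 = l' * Xf x2 + m'" "Yf x3 = l' * Xf x3 + m'"
        unfolding XY by (rule velu_line[OF l(1) gen])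
      \<comment> \<open>Opposite image points on a common line \<open>y = l' x + m'\<close> have
        ordinate 0, and their abscissa counts twice among the intersections. It would be a double
        root of the cubic, against \<open>nonsing\<close>.\<close>
      have ninv: "\<not> (Xf x1 = Xf x2 \<and> Yf x1 = - Yf x2)"
      proof
        assume h: "Xf x1 = Xf x2 \<and> Yf x1 = - Yf x2"
        define x where "x = Xf x1"
        have y0: "l' * x + m' = 0"
        proof -
          have "l' * x + m' = - (l' * x + m')"
            using h[THEN conjunct2] unfolding y h[THEN conjunct1, symmetric] x_def .
          thus ?thesis using two by (metis add.right_inverse mult_2 mult_eq_0_iff)
        qed
        have "ec_line A B l' m' x x (Xf x3)" using l' h by (simp add: x_def)
        hence c: "x + x + Xf x3 = l'\<^sup>2" "x * x + x * Xf x3 + x * Xf x3 = A - 2 * l' * m'" "x * x * Xf x3 = m'\<^sup>2 - B"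
          by (auto simp: ec_line_def)
        have m': "m' = - (l' * x)" using y0 by (simp add: eq_neg_iff_add_eq_0 add.commute)
        have X3: "Xf x3 = l'\<^sup>2 - 2 * x" using c(1) by (simp add: algebra_simps)
        have "3 * x\<^sup>2 + A = 0" using c(2) unfolding X3 m' by Groebner_Basis.algebra
        moreover have "x ^ 3 + A * x + B = x * (3 * x\<^sup>2 + A) + (x * x * (l'\<^sup>2 - 2 * x) - ((- (l' * x))\<^sup>2 - B))"
          by Groebner_Basis.algebra
        ultimately have "3 * x\<^sup>2 + A = 0" "x ^ 3 + A * x + B = 0"
          using c(3) unfolding X3 m' by (simp_all only: mult_zero_right diff_self add_0)
        thus False using nonsing by blast
      qed
      have v: "velu e b w P = Affine (Xf x1) (Yf x1)" "velu e b w Q = Affine (Xf x2) (Yf x2)" using gen PQ l by (auto simp: XY)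
      show ?thesis unfolding v add ec_add_line[OF two l' y(1,2) ninv]
        unfolding y(3)[symmetric] using gen by (simp add: XY algebra_simps)
    qed
  qed
qed auto

end

section \<open>Complex multiplication and the dynamics of \<open>\<theta>\<^sub>k\<close>\<close>

lemma Z_adjoin_mem_iff: "x \<in> carrier (Z_adjoin w) \<longleftrightarrow> (\<exists>a b. x = of_int a + of_int b * w)"
  by (auto simp: Z_adjoin_def)

lemma Z_adjoin_ops [simp]:
  "monoid.mult (Z_adjoin w) = (*)" "monoid.one (Z_adjoin w) = 1"
  "ring.zero (Z_adjoin w) = 0" "ring.add (Z_adjoin w) = (+)"
  by (simp_all add: Z_adjoin_def)

lemma finite_roots_power_eq:
  assumes "2 \<le> (N::nat)"
  shows "finite {x::'a::field. x ^ N = x}"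
proof -
  let ?q = "Polynomial.monom 1 N - Polynomial.monom 1 1 :: 'a poly"
  have "Polynomial.coeff ?q N = 1" using assms by simp
  hence "?q \<noteq> 0" by (metis coeff_0 zero_neq_one)
  hence "finite {x. poly ?q x = 0}" by (rule poly_roots_finite)
  thus ?thesis by (simp add: poly_monom)
qed

section \<open>Arithmetic and divisibility in the quadratic ring\<close>

locale quadratic_ring =
  fixes w :: complex and t d :: int
  assumes w_square: "w * w = of_int t * w + of_int d"
begin

abbreviation "R \<equiv> carrier (Z_adjoin w)"

lemma of_int_in_R [simp, intro]: "of_int a \<in> R"
  unfolding Z_adjoin_mem_iff by (intro exI[of _ a] exI[of _ 0]) simp

lemma one_in_R [simp, intro]: "1 \<in> R"
  using of_int_in_R[of 1] by simp

lemma zero_in_R [simp, intro]: "0 \<in> R"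
  using of_int_in_R[of 0] by simp

lemma numeral_in_R [simp, intro]: "numeral m \<in> R"
  using of_int_in_R[of "numeral m"] by simp

lemma w_in_R [simp, intro]: "w \<in> R"
  unfolding Z_adjoin_mem_iff by (intro exI[of _ 0] exI[of _ 1]) simp

lemma add_in_R [simp, intro]: "x \<in> R \<Longrightarrow> y \<in> R \<Longrightarrow> x + y \<in> R"
  unfolding Z_adjoin_mem_iff
proof (elim exE)
  fix a b a' b' assume "x = of_int a + of_int b * w" "y = of_int a' + of_int b' * w"
  thus "\<exists>a b. x + y = of_int a + of_int b * w"
    by (intro exI[of _ "a + a'"] exI[of _ "b + b'"]) (simp add: algebra_simps)
qed

lemma mult_in_R [simp, intro]: "x \<in> R \<Longrightarrow> y \<in> R \<Longrightarrow> x * y \<in> R"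
  unfolding Z_adjoin_mem_iff
proof (elim exE)
  fix a b a' b' assume xy: "x = of_int a + of_int b * w" "y = of_int a' + of_int b' * w"
  have "x * y = of_int (a * a') + of_int (a * b' + b * a') * w + of_int (b * b') * (w * w)"
    by (simp add: xy algebra_simps)
  also have "\<dots> = of_int (a * a' + b * b' * d) + of_int (a * b' + b * a' + b * b' * t) * w"
    unfolding w_square by (simp add: algebra_simps)
  finally show "\<exists>a b. x * y = of_int a + of_int b * w" by blast
qed

lemma uminus_in_R [simp, intro]: "x \<in> R \<Longrightarrow> - x \<in> R"
  using mult_in_R[OF of_int_in_R[of "-1"], of x] by simp

lemma diff_in_R [simp, intro]: "x \<in> R \<Longrightarrow> y \<in> R \<Longrightarrow> x - y \<in> R"
  using add_in_R[of x "- y"] by simp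

lemma power_in_R [simp, intro]: "x \<in> R \<Longrightarrow> x ^ n \<in> R"
  by (induction n) auto

definition rdvd :: "complex \<Rightarrow> complex \<Rightarrow> bool" (infix \<open>rdvd\<close> 50) where
  "a rdvd b \<longleftrightarrow> (\<exists>c\<in>R. b = a * c)"

lemma rdvd_iff: "a rdvd b \<longleftrightarrow> a divides\<^bsub>Z_adjoin w\<^esub> b"
  by (auto simp: rdvd_def factor_def)

lemma rdvd_add: "a rdvd b \<Longrightarrow> a rdvd c \<Longrightarrow> a rdvd (b + c)"
  unfolding rdvd_def by (metis add_in_R distrib_left)

lemma rdvd_mult: "a rdvd b \<Longrightarrow> c \<in> R \<Longrightarrow> a rdvd (b * c)"
  unfolding rdvd_def by (metis mult_in_R mult.assoc)

lemma rdvd_self_mult: "c \<in> R \<Longrightarrow> a rdvd (a * c)"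
  unfolding rdvd_def by blast

lemma rdvd_uminus: "a rdvd b \<Longrightarrow> a rdvd (- b)"
  using rdvd_mult[of a b "-1"] by simp

lemma rdvd_diff: "a rdvd b \<Longrightarrow> a rdvd c \<Longrightarrow> a rdvd (b - c)"
  using rdvd_add[of a b "- c"] rdvd_uminus[of a c] by simp

end

section \<open>The action of the quadratic ring on the points\<close>

locale cm_action = quadratic_ring w t d for w t d +
  fixes A B :: "'a::field" and \<Phi> :: "complex \<Rightarrow> 'a ec_point \<Rightarrow> 'a ec_point"
  assumes two: "(2::'a) \<noteq> 0"
    and iso: "\<Phi> \<in> ring_iso (Z_adjoin w) (ec_End A B)"
begin

abbreviation "E \<equiv> ec_points A B"

lemma Phi_hom: "\<Phi> \<in> Ring.ring_hom (Z_adjoin w) (ec_End A B)"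
  using iso by (simp add: ring_iso_def)

lemma Phi_endo: "a \<in> R \<Longrightarrow> \<Phi> a \<in> ec_endomorphisms A B"
  using Ring.ring_hom_closed[OF Phi_hom] by (simp add: ec_End_def)

lemma Phi_surj: "\<phi> \<in> ec_endomorphisms A B \<Longrightarrow> \<exists>a\<in>R. \<Phi> a = \<phi>"
proof -
  have "\<Phi> ` R = ec_endomorphisms A B" using iso by (simp add: ring_iso_def bij_betw_def ec_End_def)
  moreover assume "\<phi> \<in> ec_endomorphisms A B"
  ultimately have "\<phi> \<in> \<Phi> ` R" by simp
  then obtain a where "a \<in> R" "\<phi> = \<Phi> a" by (rule imageE)
  thus ?thesis by (intro bexI[of _ a]) simp_all
qed

lemma Phi_inj: "a \<in> R \<Longrightarrow> b \<in> R \<Longrightarrow> \<Phi> a = \<Phi> b \<Longrightarrow> a = b"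
  using iso unfolding ring_iso_def bij_betw_def inj_on_def by auto

lemma Phi_closed [simp, intro]: "a \<in> R \<Longrightarrow> P \<in> E \<Longrightarrow> \<Phi> a P \<in> E"
  using Phi_endo[of a] unfolding ec_endomorphisms_def by auto

lemma Phi_ext: "a \<in> R \<Longrightarrow> b \<in> R \<Longrightarrow> (\<And>P. P \<in> E \<Longrightarrow> \<Phi> a P = \<Phi> b P) \<Longrightarrow> a = b"
proof (rule Phi_inj)
  assume "a \<in> R" "b \<in> R" and eq: "\<And>P. P \<in> E \<Longrightarrow> \<Phi> a P = \<Phi> b P"
  thus "\<Phi> a = \<Phi> b" using Phi_endo[of a] Phi_endo[of b]
    unfolding ec_endomorphisms_def by (intro PiE_ext[of _ E "\<lambda>_. E" _ ]) auto
qed auto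

lemma Phi_plus: "a \<in> R \<Longrightarrow> b \<in> R \<Longrightarrow> P \<in> E \<Longrightarrow> \<Phi> (a + b) P = ec_add A (\<Phi> a P) (\<Phi> b P)"
  using Ring.ring_hom_add[OF Phi_hom, of a b] by (simp add: ec_End_def)

lemma Phi_times: "a \<in> R \<Longrightarrow> b \<in> R \<Longrightarrow> P \<in> E \<Longrightarrow> \<Phi> (a * b) P = \<Phi> a (\<Phi> b P)"
  using Ring.ring_hom_mult[OF Phi_hom, of a b] by (simp add: ec_End_def compose_def)

lemma Phi_1 [simp]: "P \<in> E \<Longrightarrow> \<Phi> 1 P = P"
  using Ring.ring_hom_one[OF Phi_hom] by (simp add: ec_End_def)

lemma Phi_0 [simp]: "P \<in> E \<Longrightarrow> \<Phi> 0 P = EC_Infinity"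
  using Phi_plus[of 0 0 P] ec_add_idem[OF two, of A "\<Phi> 0 P"] by simp

lemma Phi_infinity [simp]: "a \<in> R \<Longrightarrow> \<Phi> a EC_Infinity = EC_Infinity"
  using Phi_times[of a 0 EC_Infinity] by simp

lemma Phi_uminus: "a \<in> R \<Longrightarrow> P \<in> E \<Longrightarrow> \<Phi> (- a) P = ec_neg (\<Phi> a P)"
  using Phi_plus[of a "- a" P] ec_add_eq_infinity_iff[of A "\<Phi> a P" "\<Phi> (- a) P"] by simp

lemma Phi_diff_eq_infinity:
  assumes "a \<in> R" "b \<in> R" "P \<in> E"
  shows "\<Phi> (a - b) P = EC_Infinity \<longleftrightarrow> \<Phi> a P = \<Phi> b P"
  using Phi_plus[of a "- b" P] Phi_uminus[of b P] assms
    ec_add_eq_infinity_iff[of A "\<Phi> a P" "\<Phi> (-b) P"] by (auto) (metis ec_neg_neg)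

lemma Phi_sum_eq_infinity:
  assumes "a \<in> R" "b \<in> R" "P \<in> E"
  shows "\<Phi> (a + b) P = EC_Infinity \<longleftrightarrow> \<Phi> a P = ec_neg (\<Phi> b P)"
  using Phi_diff_eq_infinity[of a "- b" P] Phi_uminus[of b P] assms by simp

lemma ann_add:
  "a \<in> R \<Longrightarrow> b \<in> R \<Longrightarrow> P \<in> E \<Longrightarrow> \<Phi> a P = EC_Infinity \<Longrightarrow> \<Phi> b P = EC_Infinity \<Longrightarrow> \<Phi> (a + b) P = EC_Infinity"
  by (simp add: Phi_plus)

lemma ann_mult: "a \<in> R \<Longrightarrow> b \<in> R \<Longrightarrow> P \<in> E \<Longrightarrow> \<Phi> b P = EC_Infinity \<Longrightarrow> \<Phi> (a * b) P = EC_Infinity"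
  by (simp add: Phi_times)

lemma eq_0_if_kills: "a \<in> R \<Longrightarrow> (\<And>P. P \<in> E \<Longrightarrow> \<Phi> a P = EC_Infinity) \<Longrightarrow> a = 0"
  by (rule Phi_ext) auto

end

text \<open>\<open>xm\<close> is the \<open>x\<close>-coordinate in the parameter of the line on which \<open>\<rho>\<close> acts as \<open>\<theta>\<^sub>k\<close>.\<close>

locale cm_theta = cm_action w t d A B \<Phi>
  for w t d and A B :: "'a::field" and \<Phi> +
  fixes \<rho> \<pi> :: complex and k :: 'a and xm :: "'a ec_point \<Rightarrow> 'a proj_line" and p :: nat
  assumes rho_in [simp]: "\<rho> \<in> R" and pi_in [simp]: "\<pi> \<in> R" and p_ge_2: "p \<ge> 2"
    and xm_rho: "\<And>P. P \<in> E \<Longrightarrow> xm (\<Phi> \<rho> P) = theta k (xm P)"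
    and xm_pi: "\<And>P. P \<in> E \<Longrightarrow> xm (\<Phi> \<pi> P) = map_proj_line (\<lambda>z. z ^ p) (xm P)"
    and xm_eq: "\<And>P Q. P \<in> E \<Longrightarrow> Q \<in> E \<Longrightarrow> xm P = xm Q \<longleftrightarrow> Q = P \<or> Q = ec_neg P"
    and xm_surj: "\<And>z. \<exists>P\<in>E. xm P = Fin z"
    and rho_mod: "\<And>a. a \<in> R \<Longrightarrow> \<rho> rdvd a \<or> \<rho> rdvd (a - 1)"
    and rho_nonunit: "\<not> \<rho> rdvd 1"
begin

lemma rho_nz: "\<rho> \<noteq> 0"
  using rho_mod[of 0] rho_mod[of 2] rho_nonunit by (auto simp: rdvd_def)

text \<open>By \<open>rho_mod\<close> and \<open>rho_nonunit\<close> the residue ring modulo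
  \<open>\<rho>\<close> has just the classes of 0 and 1, so an element that \<open>\<rho>\<close>
  does not divide is 1 modulo \<open>\<rho>\<close>.\<close>

lemma rho_prime:
  assumes "a \<in> R" "b \<in> R" "\<rho> rdvd (a * b)"
  shows "\<rho> rdvd a \<or> \<rho> rdvd b"
proof (rule ccontr)
  assume n: "\<not> ?thesis"
  hence "\<rho> rdvd (a - 1)" using rho_mod assms(1) by blast
  from rdvd_mult[OF this assms(2)] have "\<rho> rdvd (a * b - b)" by (simp add: algebra_simps)
  from rdvd_diff[OF assms(3) this] n show False by simp
qed

lemma xm_rho_power: "P \<in> E \<Longrightarrow> xm (\<Phi> (\<rho> ^ i) P) = (theta k ^^ i) (xm P)"
  by (induction i) (auto simp: Phi_times xm_rho)

lemma xm_pi_power: "P \<in> E \<Longrightarrow> xm (\<Phi> (\<pi> ^ i) P) = map_proj_line (\<lambda>z. z ^ (p ^ i)) (xm P)"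
proof (induction i)
  case 0
  thus ?case by (cases "xm P") auto
next
  case (Suc i)
  thus ?case by (cases "xm P") (auto simp: Phi_times xm_pi power_mult[symmetric] mult.commute)
qed

lemma fixed_iff:
  assumes "P \<in> E" "xm P = Fin z"
  shows "z ^ (p ^ N) = z \<longleftrightarrow> \<Phi> (\<pi> ^ N - 1) P = EC_Infinity \<or> \<Phi> (\<pi> ^ N + 1) P = EC_Infinity"
proof -
  have "z ^ (p ^ N) = z \<longleftrightarrow> xm P = xm (\<Phi> (\<pi> ^ N) P)"
    using assms by (auto simp: xm_pi_power)
  also have "\<dots> \<longleftrightarrow> \<Phi> (\<pi> ^ N) P = P \<or> \<Phi> (\<pi> ^ N) P = ec_neg P"
    using assms(1) xm_eq[of P "\<Phi> (\<pi> ^ N) P"] by simp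
  also have "\<dots> \<longleftrightarrow> \<Phi> (\<pi> ^ N - 1) P = EC_Infinity \<or> \<Phi> (\<pi> ^ N + 1) P = EC_Infinity"
    using assms by (auto simp: Phi_diff_eq_infinity Phi_sum_eq_infinity)
  finally show ?thesis .
qed

text \<open>\<open>m\<close> is 1 modulo \<open>\<rho>\<close>, so \<open>1 = m - \<rho> * c\<close>
  for some \<open>c\<close>. This Bezout relation removes the factors \<open>\<rho>\<close> one at a
  time.\<close>

lemma ann_cancel_rho:
  assumes "P \<in> E" "m \<in> R" "\<not> \<rho> rdvd m" "\<Phi> m P = EC_Infinity" "b \<in> R" "\<Phi> (\<rho> ^ i * b) P = EC_Infinity"
  shows "\<Phi> b P = EC_Infinity"
  using assms(6)
proof (induction i)
  case (Suc i)
  obtain c where c: "c \<in> R" "m - 1 = \<rho> * c" using rho_mod assms(2,3) unfolding rdvd_def by blast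
  have "\<Phi> ((\<rho> ^ i * b) * m + (- c) * (\<rho> ^ Suc i * b)) P = EC_Infinity"
    using assms c Suc.prems by (intro ann_add[OF _ _ _ ann_mult ann_mult]) auto
  moreover have "(\<rho> ^ i * b) * m + (- c) * (\<rho> ^ Suc i * b) = (\<rho> ^ i * b) * (m - \<rho> * c)"
    by (simp add: algebra_simps)
  moreover have "m - \<rho> * c = 1" using c(2) by (simp add: algebra_simps)
  ultimately have "\<Phi> (\<rho> ^ i * b) P = EC_Infinity" by (simp only: mult_1_right)
  thus ?case by (rule Suc.IH)
qed simp

lemma theta_power_eq:
  assumes "P \<in> E" "(theta k ^^ i) (xm P) = (theta k ^^ j) (xm P)"
  shows "\<Phi> (\<rho> ^ j - \<rho> ^ i) P = EC_Infinity \<or> \<Phi> (\<rho> ^ j + \<rho> ^ i) P = EC_Infinity"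
proof -
  have "xm (\<Phi> (\<rho> ^ i) P) = xm (\<Phi> (\<rho> ^ j) P)" using assms by (simp add: xm_rho_power)
  hence "\<Phi> (\<rho> ^ j) P = \<Phi> (\<rho> ^ i) P \<or> \<Phi> (\<rho> ^ j) P = ec_neg (\<Phi> (\<rho> ^ i) P)"
    using xm_eq assms(1) by auto
  thus ?thesis using assms(1) by (auto simp: Phi_diff_eq_infinity Phi_sum_eq_infinity)
qed

text \<open>\<open>\<pi>\<close> and \<open>\<rho>\<close> commute, hence so do Frobenius and
  \<open>theta k\<close>.\<close>

lemma theta_fixed_field:
  assumes "P \<in> E" "xm P = Fin z" "z ^ (p ^ N) = z"
  shows "(theta k ^^ i) (xm P) \<in> insert Infty (Fin ` {x. x ^ (p ^ N) = x})"
proof -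
  let ?q = "map_proj_line (\<lambda>z. z ^ (p ^ N))"
  have "?q ((theta k ^^ i) (xm P)) = xm (\<Phi> (\<pi> ^ N * \<rho> ^ i) P)"
    using assms by (simp add: Phi_times xm_pi_power xm_rho_power)
  also have "\<dots> = xm (\<Phi> (\<rho> ^ i * \<pi> ^ N) P)" by (simp add: mult.commute)
  also have "\<dots> = (theta k ^^ i) (xm P)"
    using assms by (simp add: Phi_times xm_pi_power xm_rho_power)
  finally show ?thesis by (cases "(theta k ^^ i) (xm P)") auto
qed

text \<open>The orbit stays in a finite field, so it repeats: some
  \<open>\<rho> ^ i * (\<rho> ^ (j - i) \<plusminus> 1)\<close> kills \<open>Q\<close>. As
  \<open>m\<close>, which is prime to \<open>\<rho>\<close>, kills \<open>Q\<close> as well, the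
  factor \<open>\<rho> ^ i\<close> can be cancelled, and \<open>Q\<close> is periodic without a
  preperiod.\<close>

lemma theta_periodic_of_ann:
  assumes P: "P \<in> E" and m: "m \<in> R" "\<not> \<rho> rdvd m" and ann: "\<Phi> (\<rho> ^ e * m) P = EC_Infinity"
    and z: "xm P = Fin z" "z ^ (p ^ N) = z" "N > 0"
  shows "theta_periodic k ((theta k ^^ e) (xm P))"
proof -
  define Q where "Q = \<Phi> (\<rho> ^ e) P"
  have Q: "Q \<in> E" "\<Phi> m Q = EC_Infinity"
    using P m ann by (auto simp: Q_def Phi_times[symmetric] mult.commute)
  have xQ: "(theta k ^^ i) (xm Q) = (theta k ^^ (i + e)) (xm P)" for i
    using P by (simp add: Q_def xm_rho_power funpow_add)
  have "2 \<le> p ^ N" using p_ge_2 z(3) self_le_power[of p N] by linarith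
  hence "finite (insert Infty (Fin ` {x::'a. x ^ (p ^ N) = x}))"
    using finite_roots_power_eq by blast
  moreover have "range (\<lambda>i. (theta k ^^ i) (xm Q)) \<subseteq> insert Infty (Fin ` {x. x ^ (p ^ N) = x})"
    using theta_fixed_field[OF P z(1,2)] unfolding xQ by blast
  ultimately have "finite (range (\<lambda>i. (theta k ^^ i) (xm Q)))" by (rule rev_finite_subset)
  hence "\<not> inj (\<lambda>i. (theta k ^^ i) (xm Q))" using finite_imageD infinite_UNIV_nat by blast
  then obtain i j where ij: "i < j" "(theta k ^^ i) (xm Q) = (theta k ^^ j) (xm Q)"
    unfolding inj_def by (metis linorder_neqE_nat)
  have pw: "\<rho> ^ j = \<rho> ^ i * \<rho> ^ (j - i)" using ij(1) by (simp flip: power_add)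
  from theta_power_eq[OF Q(1) ij(2)]
  have "\<Phi> (\<rho> ^ i * (\<rho> ^ (j - i) - 1)) Q = EC_Infinity \<or> \<Phi> (\<rho> ^ i * (\<rho> ^ (j - i) + 1)) Q = EC_Infinity"
    unfolding pw by (simp add: algebra_simps)
  hence "\<Phi> (\<rho> ^ (j - i) - 1) Q = EC_Infinity \<or> \<Phi> (\<rho> ^ (j - i) + 1) Q = EC_Infinity"
    using ann_cancel_rho[OF Q(1) m Q(2)] by auto
  hence "\<Phi> (\<rho> ^ (j - i)) Q = Q \<or> \<Phi> (\<rho> ^ (j - i)) Q = ec_neg Q"
    using Q(1) by (auto simp: Phi_diff_eq_infinity Phi_sum_eq_infinity)
  hence "xm Q = xm (\<Phi> (\<rho> ^ (j - i)) Q)" using xm_eq Q(1) by auto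
  hence "(theta k ^^ (j - i)) (xm Q) = xm Q" using Q(1) by (simp add: xm_rho_power)
  thus ?thesis using ij(1) xQ[of 0] unfolding theta_periodic_def
    by (intro exI[of _ "j - i"]) auto
qed

text \<open>Conversely, a period \<open>r\<close> at \<open>\<Phi> (\<rho> ^ M) P\<close> provides
  an annihilator \<open>\<rho> ^ r \<plusminus> 1\<close> prime to \<open>\<rho>\<close>, and
  against it the extra factor \<open>\<rho> ^ i\<close> cancels.\<close>

lemma ann_of_theta_periodic:
  assumes P: "P \<in> E" and per: "theta_periodic k ((theta k ^^ M) (xm P))" and m: "m \<in> R"
    and i: "\<Phi> (\<rho> ^ i * (\<rho> ^ M * m)) P = EC_Infinity"
  shows "\<Phi> (\<rho> ^ M * m) P = EC_Infinity"
proof -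
  define Q where "Q = \<Phi> (\<rho> ^ M) P"
  have Q: "Q \<in> E" using P by (simp add: Q_def)
  obtain r where r: "r \<ge> 1" "(theta k ^^ r) (xm Q) = xm Q"
    using per P unfolding theta_periodic_def Q_def by (auto simp: xm_rho_power)
  obtain m' where m': "m' \<in> R" "\<not> \<rho> rdvd m'" "\<Phi> m' Q = EC_Infinity"
  proof -
    have rr: "\<rho> rdvd (\<rho> ^ r)" using r(1) rdvd_self_mult[of "\<rho> ^ (r - 1)" \<rho>]
      by (simp flip: power_Suc)
    have "\<Phi> (\<rho> ^ r - 1) Q = EC_Infinity \<or> \<Phi> (\<rho> ^ r + 1) Q = EC_Infinity"
      using theta_power_eq[OF Q, of 0 r] r(2) by simp
    moreover have "\<not> \<rho> rdvd (\<rho> ^ r - 1)" using rdvd_diff[OF rr, of "\<rho> ^ r - 1"] rho_nonunit by auto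
    moreover have "\<not> \<rho> rdvd (\<rho> ^ r + 1)" using rdvd_diff[OF _ rr, of "\<rho> ^ r + 1"] rho_nonunit by auto
    moreover have "\<rho> ^ r - 1 \<in> R" "\<rho> ^ r + 1 \<in> R" by auto
    ultimately show ?thesis using that by blast
  qed
  define S where "S = \<Phi> (\<rho> ^ M * m) P"
  have S: "S \<in> E" using P m by (simp add: S_def)
  have "S = \<Phi> m Q" using P m by (simp add: S_def Q_def Phi_times[symmetric] mult.commute)
  hence "\<Phi> m' S = \<Phi> (m * m') Q" using m' m Q by (simp add: Phi_times[symmetric] mult.commute)
  hence "\<Phi> m' S = EC_Infinity" using m' m Q by (simp add: Phi_times)
  moreover have "\<Phi> (\<rho> ^ i * 1) S = EC_Infinity" using i P m by (simp add: S_def Phi_times)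
  ultimately have "\<Phi> 1 S = EC_Infinity" using ann_cancel_rho[OF S m'(1,2)] by blast
  thus ?thesis using S by (simp add: S_def)
qed

lemma theta_periodic_step: "theta_periodic k x \<Longrightarrow> theta_periodic k ((theta k ^^ i) x)"
  unfolding theta_periodic_def
proof (elim exE conjE)
  fix r assume r: "1 \<le> r" "(theta k ^^ r) x = x"
  have "(theta k ^^ r) ((theta k ^^ i) x) = (theta k ^^ (r + i)) x" by (simp add: funpow_add)
  also have "\<dots> = (theta k ^^ (i + r)) x" by (simp add: add.commute)
  also have "\<dots> = (theta k ^^ i) x" using r(2) by (simp add: funpow_add)
  finally show "\<exists>r\<ge>1. (theta k ^^ r) ((theta k ^^ i) x) = (theta k ^^ i) x" using r(1) by blast
qed

text \<open>Ultrametric equality: the valuation of \<open>g\<close> exceeds that of 2, so the sum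
  has the valuation of 2. With \<open>g = \<pi> ^ N - 1\<close> this is the valuation of
  \<open>\<pi> ^ N + 1\<close>.\<close>

lemma valuation_tower:
  assumes v: "2 = \<rho> ^ v * u" "u \<in> R" "\<not> \<rho> rdvd u"
    and g: "g = \<rho> ^ e * m" "m \<in> R" "\<not> \<rho> rdvd m" "v < e"
  obtains m' where "m' \<in> R" "\<not> \<rho> rdvd m'" "g + 2 = \<rho> ^ v * m'"
proof -
  have e: "\<rho> ^ e = \<rho> ^ v * (\<rho> * \<rho> ^ (e - v - 1))"
  proof -
    have "e = v + Suc (e - v - 1)" using g(4) by simp
    hence "\<rho> ^ e = \<rho> ^ (v + Suc (e - v - 1))" by (rule arg_cong)
    thus ?thesis by (simp only: power_add power_Suc)
  qed
  let ?m = "\<rho> * (\<rho> ^ (e - v - 1) * m) + u"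
  have "\<rho> rdvd (\<rho> * (\<rho> ^ (e - v - 1) * m))" using g by (intro rdvd_self_mult) auto
  hence "\<not> \<rho> rdvd ?m" using rdvd_diff[of \<rho> ?m "\<rho> * (\<rho> ^ (e - v - 1) * m)"] v(3) by auto
  moreover have "g + 2 = \<rho> ^ v * ?m" unfolding g(1) e v(1) by (simp add: algebra_simps)
  ultimately show ?thesis using that[of ?m] g v by auto
qed

text \<open>The witness \<open>d0\<close> is the number of steps from \<open>z 0\<close> to a cycle, so that \<open>i + d0\<close> is the depth of \<open>z i\<close>.\<close>

theorem theta_preimages_in_field_iff:
  assumes v: "2 = \<rho> ^ v * u" "u \<in> R" "\<not> \<rho> rdvd u"
    and g0: "\<pi> ^ n - 1 = \<rho> ^ e0 * m0" "m0 \<in> R" "\<not> \<rho> rdvd m0"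
    and g1: "\<pi> ^ n + 1 = \<rho> ^ e1 * m1" "m1 \<in> R" "\<not> \<rho> rdvd m1"
    and e: "v < e0 + e1" and n: "n > 0"
    and z: "\<And>i. theta k (Fin (z (Suc i))) = Fin (z i)" "z 0 ^ (p ^ n) = z 0"
      "\<not> theta_periodic k (Fin (z 1))"
  shows "\<exists>d0. \<forall>i. (z i ^ (p ^ n) = z i \<longrightarrow> i + d0 \<le> max e0 e1) \<and>
      (\<forall>j\<ge>1. z i ^ (p ^ (2 ^ j * n)) = z i \<longleftrightarrow> i + d0 \<le> e0 + e1 + (j - 1) * v)"
proof -
  have pw: "(theta k ^^ j) (Fin (z (i + j))) = Fin (z i)" for i j
    using z(1) by (induction j arbitrary: i) (auto simp: funpow_swap1)
  have per1: "\<exists>d\<le>max e0 e1. theta_periodic k ((theta k ^^ d) (Fin (z i)))" if "z i ^ (p ^ n) = z i" for i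
  proof -
    obtain P where P: "P \<in> E" "xm P = Fin (z i)" using xm_surj by blast
    from fixed_iff[OF P, of n] that consider "\<Phi> (\<rho> ^ e0 * m0) P = EC_Infinity"
      | "\<Phi> (\<rho> ^ e1 * m1) P = EC_Infinity" using g0 g1 by auto
    thus ?thesis
      using theta_periodic_of_ann[OF P(1) g0(2,3) _ P(2) that n] theta_periodic_of_ann[OF P(1) g1(2,3) _ P(2) that n]
        P(2) by cases (metis max.cobounded1 max.cobounded2)+
  qed
  define d0 where "d0 = (LEAST d. theta_periodic k ((theta k ^^ d) (Fin (z 0))))"
  have d0: "theta_periodic k ((theta k ^^ d0) (Fin (z 0)))"
    unfolding d0_def using per1[of 0] z(2) by (metis (mono_tags, lifting) LeastI)
  have depth: "theta_periodic k ((theta k ^^ M) (Fin (z i))) \<longleftrightarrow> i + d0 \<le> M" for i M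
  proof
    assume "i + d0 \<le> M"
    then obtain c where M: "M = (c + d0) + i" by (metis add.commute add.assoc le_Suc_ex)
    show "theta_periodic k ((theta k ^^ M) (Fin (z i)))"
      unfolding M funpow_add comp_apply pw[of i 0, simplified] by (rule theta_periodic_step[OF d0])
  next
    assume per: "theta_periodic k ((theta k ^^ M) (Fin (z i)))"
    show "i + d0 \<le> M"
    proof (cases "i \<le> M")
      case True
      have "(theta k ^^ M) (Fin (z i)) = (theta k ^^ ((M - i) + i)) (Fin (z i))" using True by simp
      also have "\<dots> = (theta k ^^ (M - i)) (Fin (z 0))" unfolding funpow_add comp_apply pw[of i 0, simplified] ..
      finally have "d0 \<le> M - i" unfolding d0_def using per by (metis Least_le)
      thus ?thesis using True by simp
    next
      \<comment> \<open>For \<open>i > M\<close> the iterate is \<open>z (i - M)\<close>, which lies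
        on or above \<open>z 1\<close>; if it were periodic, so would be \<open>z 1\<close>.\<close>
      case False
      then obtain c where i: "i = Suc c + M" by (metis add.commute less_imp_Suc_add not_le add_Suc_right)
      have "theta_periodic k (Fin (z (1 + c)))" using per pw[where i = "Suc c" and j = M] unfolding i by simp
      from theta_periodic_step[OF this, of c] show ?thesis using z(3) pw[where i = 1 and j = c] by simp
    qed
  qed
  have tower: "\<exists>m. m \<in> R \<and> \<not> \<rho> rdvd m \<and> \<pi> ^ (2 ^ j * n) - 1 = \<rho> ^ (e0 + e1 + (j - 1) * v) * m" if "j \<ge> 1" for j
    using that
  proof (induction j rule: nat_induct_at_least)
    case base
    have "\<pi> ^ (2 * n) - 1 = (\<pi> ^ n - 1) * (\<pi> ^ n + 1)" by (simp add: algebra_simps power_mult power2_eq_square mult.commute[of 2])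
    also have "\<dots> = \<rho> ^ (e0 + e1) * (m0 * m1)" unfolding g0 g1 by (simp add: power_add)
    finally show ?case using g0 g1 rho_prime by (intro exI[of _ "m0 * m1"]) auto
  next
    case (Suc j)
    let ?e = "e0 + e1 + (j - 1) * v"
    obtain m where m: "m \<in> R" "\<not> \<rho> rdvd m" "\<pi> ^ (2 ^ j * n) - 1 = \<rho> ^ ?e * m" using Suc by blast
    obtain m' where m': "m' \<in> R" "\<not> \<rho> rdvd m'" "\<pi> ^ (2 ^ j * n) - 1 + 2 = \<rho> ^ v * m'"
      by (rule valuation_tower[OF v m(3,1,2)]) (use e in auto)
    have "2 ^ Suc j * n = 2 ^ j * n + 2 ^ j * n" by simp
    hence "\<pi> ^ (2 ^ Suc j * n) = \<pi> ^ (2 ^ j * n) * \<pi> ^ (2 ^ j * n)" by (simp only: power_add)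
    hence "\<pi> ^ (2 ^ Suc j * n) - 1 = (\<pi> ^ (2 ^ j * n) - 1) * (\<pi> ^ (2 ^ j * n) - 1 + 2)"
      by (simp only:) (simp add: algebra_simps)
    also have "\<dots> = \<rho> ^ (?e + v) * (m * m')" unfolding m'(3) unfolding m(3) by (simp add: power_add)
    also have "?e + v = e0 + e1 + (Suc j - 1) * v" using Suc.hyps by (cases j) auto
    finally show ?case using m m' rho_prime by (intro exI[of _ "m * m'"]) auto
  qed
  show ?thesis
  proof (intro exI[of _ d0] allI conjI impI)
    fix i assume "z i ^ p ^ n = z i"
    then obtain d where "d \<le> max e0 e1" "i + d0 \<le> d" using per1 depth by blast
    thus "i + d0 \<le> max e0 e1" by simp
  next
    fix i j :: nat assume j: "j \<ge> 1"
    let ?M = "e0 + e1 + (j - 1) * v" and ?N = "2 ^ j * n"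
    obtain m where m: "m \<in> R" "\<not> \<rho> rdvd m" "\<pi> ^ ?N - 1 = \<rho> ^ ?M * m" using tower j by blast
    obtain m' where m': "m' \<in> R" "\<not> \<rho> rdvd m'" "\<pi> ^ ?N - 1 + 2 = \<rho> ^ v * m'"
      by (rule valuation_tower[OF v m(3,1,2)]) (use e in auto)
    obtain P where P: "P \<in> E" "xm P = Fin (z i)" using xm_surj by blast
    have N: "?N > 0" using n by simp
    show "z i ^ (p ^ ?N) = z i \<longleftrightarrow> i + d0 \<le> ?M"
    proof
      assume fx: "z i ^ (p ^ ?N) = z i"
      \<comment> \<open>The second factor has valuation only \<open>v\<close>, so the points that it
        kills have depth at most \<open>v\<close>, which is below \<open>?M\<close>.\<close>
      from fixed_iff[OF P, of ?N] fx consider "\<Phi> (\<rho> ^ ?M * m) P = EC_Infinity"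
        | "\<Phi> (\<rho> ^ v * m') P = EC_Infinity" unfolding m(3)[symmetric] m'(3)[symmetric] by (auto simp: add.commute)
      hence "i + d0 \<le> ?M \<or> i + d0 \<le> v"
        using theta_periodic_of_ann[OF P(1) m(1,2) _ P(2) fx N] theta_periodic_of_ann[OF P(1) m'(1,2) _ P(2) fx N]
          P(2) depth by cases auto
      thus "i + d0 \<le> ?M" using e by linarith
    next
      assume le: "i + d0 \<le> ?M"
      have per: "theta_periodic k ((theta k ^^ ?M) (xm P))" using depth le P(2) by simp
      \<comment> \<open>The point \<open>\<Phi> (\<rho> ^ i) P\<close> lies over \<open>z 0\<close>,
        so \<open>\<pi> ^ n\<close> fixes it up to sign and \<open>\<pi> ^ ?N\<close> fixes it. Thus
        \<open>\<pi> ^ ?N - 1\<close> kills \<open>P\<close> up to a factor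
        \<open>\<rho> ^ i\<close>, which periodicity removes.\<close>
      have P0: "\<Phi> (\<rho> ^ i) P \<in> E" "xm (\<Phi> (\<rho> ^ i) P) = Fin (z 0)"
        using P pw[of i 0] by (auto simp: xm_rho_power)
      have "\<Phi> (\<pi> ^ n - 1) (\<Phi> (\<rho> ^ i) P) = EC_Infinity \<or> \<Phi> (\<pi> ^ n + 1) (\<Phi> (\<rho> ^ i) P) = EC_Infinity"
        using fixed_iff[OF P0, of n] z(2) by simp
      hence h: "\<Phi> ((\<pi> ^ n - 1) * (\<pi> ^ n + 1)) (\<Phi> (\<rho> ^ i) P) = EC_Infinity"
        using ann_mult[of "\<pi> ^ n - 1" "\<pi> ^ n + 1"] ann_mult[of "\<pi> ^ n + 1" "\<pi> ^ n - 1"] P0(1)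
        by (auto simp: mult.commute)
      have "(\<pi> ^ n - 1) * (\<pi> ^ n + 1) = \<pi> ^ (2 * n) - 1"
        by (simp add: algebra_simps power_mult power2_eq_square mult.commute[of 2])
      hence "\<Phi> (\<pi> ^ (2 * n)) (\<Phi> (\<rho> ^ i) P) = \<Phi> (\<rho> ^ i) P" using h P0(1) by (simp add: Phi_diff_eq_infinity)
      hence "\<Phi> ((\<pi> ^ (2 * n)) ^ c) (\<Phi> (\<rho> ^ i) P) = \<Phi> (\<rho> ^ i) P" for c
        using P0(1) by (induction c) (auto simp: Phi_times)
      from this[of "2 ^ (j - 1)"] have "\<Phi> (\<pi> ^ ?N) (\<Phi> (\<rho> ^ i) P) = \<Phi> (\<rho> ^ i) P"
        using arg_cong[of "2 * n * 2 ^ (j - 1)" ?N "\<lambda>c. \<pi> ^ c"] j by (cases j) (simp_all add: power_mult mult_ac)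
      hence "\<Phi> (\<pi> ^ ?N - 1) (\<Phi> (\<rho> ^ i) P) = EC_Infinity" using P0(1) by (simp add: Phi_diff_eq_infinity)
      hence "\<Phi> (\<rho> ^ i * (\<rho> ^ ?M * m)) P = EC_Infinity"
        using P m by (simp add: Phi_times[symmetric] mult.commute)
      from ann_of_theta_periodic[OF P(1) per m(1) this] have "\<Phi> (\<pi> ^ ?N - 1) P = EC_Infinity" using m by simp
      thus "z i ^ (p ^ ?N) = z i" using fixed_iff[OF P] by blast
    qed
  qed
qed

end

section \<open>Irreducible polynomials and the \<open>Q\<^sub>k\<close>-transform\<close>

interpretation to_ac_hom: inj_idom_hom to_ac
  by unfold_locales auto

interpretation map_to_ac: map_poly_inj_idom_hom to_ac ..

abbreviation ac_poly :: "'a::field poly \<Rightarrow> 'a alg_closure poly" where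
  "ac_poly \<equiv> map_poly to_ac"

lemma power_card_hom:
  "comm_ring_hom (\<lambda>x :: 'p::prime_card mod_ring alg_closure. x ^ (CARD('p) ^ n))"
  by unfold_locales
    (auto simp: power_mult_distrib intro!: freshmans_dream'[where n = n] prime_card)

lemma power_card_add:
  fixes x y :: "'p::prime_card mod_ring alg_closure"
  shows "(x + y) ^ (CARD('p) ^ n) = x ^ (CARD('p) ^ n) + y ^ (CARD('p) ^ n)"
  by (rule freshmans_dream'[where n = n]) (auto intro: prime_card)

lemma power_card_diff:
  fixes x y :: "'p::prime_card mod_ring alg_closure"
  shows "(x - y) ^ (CARD('p) ^ n) = x ^ (CARD('p) ^ n) - y ^ (CARD('p) ^ n)"
  using power_card_add[of "x - y" y n] by (simp add: algebra_simps)

lemma power_card_inj: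
  fixes x y :: "'p::prime_card mod_ring alg_closure"
  shows "x ^ (CARD('p) ^ n) = y ^ (CARD('p) ^ n) \<longleftrightarrow> x = y"
proof
  assume "x ^ (CARD('p) ^ n) = y ^ (CARD('p) ^ n)"
  hence "(x - y) ^ (CARD('p) ^ n) = 0" by (simp add: power_card_diff)
  thus "x = y" by simp
qed simp

lemma power_card_minus:
  fixes x :: "'p::prime_card mod_ring alg_closure"
  shows "(- x) ^ (CARD('p) ^ n) = - (x ^ (CARD('p) ^ n))"
  using power_card_diff[of 0 x n] by (simp add: power_0_left)

lemma to_ac_power_card:
  "to_ac a ^ (CARD('p) ^ n) = to_ac (a :: 'p::prime_card mod_ring)"
  using finite_field_power_card_power_eq_same[of "CARD('p) ^ n" n a]
  by (simp flip: to_ac_power)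

lemma to_ac_range:
  fixes x :: "'p::prime_card mod_ring alg_closure"
  assumes "x ^ CARD('p) = x"
  shows "x \<in> range to_ac"
proof -
  let ?S = "{x :: 'p mod_ring alg_closure. x ^ CARD('p) = x}"
  let ?q = "Polynomial.monom 1 CARD('p) - Polynomial.monom 1 1 :: 'p mod_ring alg_closure poly"
  have p: "CARD('p) > 1" by (rule nontriv)
  have c: "Polynomial.coeff ?q CARD('p) = 1" using p by simp
  hence q0: "?q \<noteq> 0" by (metis coeff_0 zero_neq_one)
  have "Polynomial.degree ?q \<le> CARD('p)"
    using p by (intro degree_diff_le degree_monom_le order.trans[OF degree_monom_le]) auto
  moreover have "card {x. poly ?q x = 0} \<le> Polynomial.degree ?q" by (rule card_poly_roots_bound[OF q0])
  moreover have S: "?S = {x. poly ?q x = 0}" by (simp add: poly_monom)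
  ultimately have "card ?S \<le> CARD('p)" by simp
  moreover have "card (range (to_ac :: 'p mod_ring \<Rightarrow> _)) = CARD('p)"
    by (simp add: card_image inj_to_ac)
  moreover have "range (to_ac :: 'p mod_ring \<Rightarrow> _) \<subseteq> ?S"
    using to_ac_power_card[where n = 1] by auto
  moreover have "finite ?S" unfolding S using q0 by (rule poly_roots_finite)
  ultimately have "range (to_ac :: 'p mod_ring \<Rightarrow> _) = ?S" by (intro card_seteq) auto
  thus ?thesis using assms by auto
qed

lemma poly_ac_power_card:
  fixes f :: "'p::prime_card mod_ring poly"
  shows "poly (ac_poly f) (x ^ (CARD('p) ^ n)) = poly (ac_poly f) x ^ (CARD('p) ^ n)"
proof -
  interpret F: comm_ring_hom "\<lambda>x :: 'p mod_ring alg_closure. x ^ (CARD('p) ^ n)"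
    by (rule power_card_hom)
  have "map_poly (\<lambda>x. x ^ (CARD('p) ^ n)) (ac_poly f) = ac_poly f"
    by (intro poly_eqI) (simp add: coeff_map_poly to_ac_power_card)
  thus ?thesis using F.poly_map_poly[of "ac_poly f" x] by simp
qed

section \<open>Minimal polynomials as products over Frobenius orbits\<close>

lemma finite_orbit:
  fixes f :: "'p::prime_card mod_ring poly"
  assumes "f \<noteq> 0" "poly (ac_poly f) z = 0"
  shows "\<exists>d>0. z ^ (CARD('p) ^ d) = z"
proof -
  have "finite {x. poly (ac_poly f) x = 0}" using assms(1) by (intro poly_roots_finite) simp
  moreover have "range (\<lambda>i. z ^ (CARD('p) ^ i)) \<subseteq> {x. poly (ac_poly f) x = 0}"
    using assms(2) by (auto simp: poly_ac_power_card)
  ultimately have "finite (range (\<lambda>i. z ^ (CARD('p) ^ i)))" by (rule rev_finite_subset)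
  hence "\<not> inj (\<lambda>i. z ^ (CARD('p) ^ i))" using finite_imageD infinite_UNIV_nat by blast
  then obtain i j where ij: "i < j" "z ^ (CARD('p) ^ i) = z ^ (CARD('p) ^ j)"
    unfolding inj_def by (metis linorder_neqE_nat)
  have "CARD('p) ^ j = CARD('p) ^ (j - i) * CARD('p) ^ i" using ij(1) by (simp flip: power_add)
  hence "(z ^ (CARD('p) ^ (j - i))) ^ (CARD('p) ^ i) = z ^ (CARD('p) ^ i)"
    using ij(2) by (simp flip: power_mult)
  hence "z ^ (CARD('p) ^ (j - i)) = z" by (simp only: power_card_inj)
  thus ?thesis using ij(1) by (intro exI[of _ "j - i"]) auto
qed

text \<open>The degree of \<open>z\<close> over the prime field, as the length of its Frobenius
  orbit.\<close>

definition frob_period :: "'p::prime_card mod_ring alg_closure \<Rightarrow> nat" where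
  "frob_period z = (LEAST d. d > 0 \<and> z ^ (CARD('p) ^ d) = z)"

lemma frob_period:
  fixes z :: "'p::prime_card mod_ring alg_closure"
  assumes "\<exists>d>0. z ^ (CARD('p) ^ d) = z"
  shows "frob_period z > 0" "z ^ (CARD('p) ^ N) = z \<longleftrightarrow> frob_period z dvd N"
proof -
  let ?d = "frob_period z"
  have d: "?d > 0 \<and> z ^ (CARD('p) ^ ?d) = z" unfolding frob_period_def
    using assms by (rule LeastI_ex)
  thus "?d > 0" by simp
  have pw: "z ^ (CARD('p) ^ (c * ?d)) = z" for c
  proof (induction c)
    case (Suc c)
    have "z ^ (CARD('p) ^ (Suc c * ?d)) = (z ^ (CARD('p) ^ ?d)) ^ (CARD('p) ^ (c * ?d))"
      by (simp add: power_add power_mult mult.commute)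
    thus ?case using Suc d by simp
  qed simp
  have "z ^ (CARD('p) ^ N) = z ^ (CARD('p) ^ (N mod ?d))"
  proof -
    have "z ^ (CARD('p) ^ N) = z ^ (CARD('p) ^ (N div ?d * ?d + N mod ?d))" by simp
    also have "\<dots> = (z ^ (CARD('p) ^ (N div ?d * ?d))) ^ (CARD('p) ^ (N mod ?d))"
      by (simp only: power_add power_mult)
    finally show ?thesis using pw by simp
  qed
  moreover have "z ^ (CARD('p) ^ (N mod ?d)) = z \<longleftrightarrow> N mod ?d = 0"
  proof
    assume h: "z ^ (CARD('p) ^ (N mod ?d)) = z"
    show "N mod ?d = 0"
    proof (rule ccontr)
      assume "N mod ?d \<noteq> 0"
      hence "?d \<le> N mod ?d" using h unfolding frob_period_def by (intro Least_le) auto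
      thus False using d mod_less_divisor[of ?d N] by linarith
    qed
  qed simp
  ultimately show "z ^ (CARD('p) ^ N) = z \<longleftrightarrow> ?d dvd N" by (simp add: dvd_eq_mod_eq_0)
qed

text \<open>Frobenius permutes the orbit cyclically, so it fixes the coefficients of the product
  over the orbit, which therefore come from the prime field. The product is irreducible because a
  polynomial over the prime field that vanishes at \<open>z\<close> vanishes on the whole
  orbit.\<close>

lemma min_poly_exists:
  fixes z :: "'p::prime_card mod_ring alg_closure"
  assumes "\<exists>d>0. z ^ (CARD('p) ^ d) = z"
  obtains g :: "'p mod_ring poly" where "g \<in> Irr" "Polynomial.degree g = frob_period z"
    "\<forall>x. poly (ac_poly g) x = 0 \<longleftrightarrow> (\<exists>m. x = z ^ (CARD('p) ^ m))"
proof -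
  let ?d = "frob_period z" and ?p = "CARD('p)"
  define c where "c m = z ^ (?p ^ m)" for m
  note d = frob_period[OF assms]
  have cd: "c ?d = c 0" using d(2)[of ?d] by (simp add: c_def)
  have cS: "c (Suc m) = c m ^ ?p" for m by (simp add: c_def power_mult[symmetric] mult.commute)
  have inj: "inj_on c {..<?d}"
  proof (intro inj_onI, rule ccontr)
    fix i j assume ij: "i \<in> {..<?d}" "j \<in> {..<?d}" "c i = c j" "i \<noteq> j"
    have *: False if "i < j" "j < ?d" "c i = c j" for i j
    proof -
      have "?p ^ j = ?p ^ (j - i) * ?p ^ i" using that by (simp flip: power_add)
      hence "(z ^ (?p ^ (j - i))) ^ (?p ^ i) = z ^ (?p ^ i)"
        using that(3) by (simp add: c_def flip: power_mult)
      hence "z ^ (?p ^ (j - i)) = z" by (simp only: power_card_inj)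
      hence "?d dvd j - i" using d(2) by simp
      thus False using that dvd_imp_le[of ?d "j - i"] by simp
    qed
    show False using *[of i j] *[of j i] ij by (cases "i < j") auto
  qed
  define G where "G = (\<Prod>m<?d. [:- c m, 1:])"
  have rG: "poly G x = 0 \<longleftrightarrow> (\<exists>m<?d. x = c m)" for x by (auto simp: G_def poly_prod)
  have "lead_coeff G = (\<Prod>m<?d. lead_coeff [:- c m, 1:])" unfolding G_def by (rule lead_coeff_prod)
  hence mon: "lead_coeff G = 1" "Polynomial.degree G = ?d"
    by (simp_all add: G_def degree_prod_eq_sum_degree)
  interpret F: comm_ring_hom "\<lambda>x :: 'p mod_ring alg_closure. x ^ ?p"
    using power_card_hom[of 1] by simp
  interpret F': map_poly_comm_ring_hom "\<lambda>x :: 'p mod_ring alg_closure. x ^ ?p" ..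
  have "map_poly (\<lambda>x. x ^ ?p) G = (\<Prod>m<?d. [:- c (Suc m), 1:])"
    by (simp add: G_def F'.hom_prod map_poly_pCons cS F.hom_uminus)
  also have "\<dots> = (\<Prod>m\<in>{1..<Suc ?d}. [:- c m, 1:])"
    by (rule prod.reindex_bij_witness[of _ "\<lambda>m. m - 1" Suc]) auto
  also have "\<dots> = G"
  proof -
    have "{1..<Suc ?d} = insert ?d {1..<?d}" "{..<?d} = insert 0 {1..<?d}" using d(1) by auto
    thus ?thesis using cd by (simp add: G_def)
  qed
  finally have cfix: "Polynomial.coeff G i ^ ?p = Polynomial.coeff G i" for i
    by (metis F.coeff_map_poly_hom)
  define g where "g = map_poly of_ac G"
  have gG: "ac_poly g = G"
    unfolding g_def using to_ac_range[OF cfix]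
    by (intro poly_eqI) (simp add: coeff_map_poly to_ac_of_ac)
  have dg: "Polynomial.degree g = ?d" using mon(2) gG by (metis map_to_ac.degree_map_poly_hom to_ac_hom.degree_map_poly_hom)
  have lg: "lead_coeff g = 1"
  proof -
    have "to_ac (lead_coeff g) = 1" using mon gG dg by (metis to_ac_hom.coeff_map_poly_hom)
    thus ?thesis by simp
  qed
  have r: "poly (ac_poly g) x = 0 \<longleftrightarrow> (\<exists>m. x = z ^ (?p ^ m))" for x
  proof -
    have "z ^ (?p ^ m) = c (m mod ?d)" for m
    proof -
      have "z ^ (?p ^ m) = z ^ (?p ^ (m div ?d * ?d + m mod ?d))" by simp
      also have "\<dots> = (z ^ (?p ^ (m div ?d * ?d))) ^ (?p ^ (m mod ?d))"
        by (simp only: power_add power_mult)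
      finally show ?thesis using d(2)[of "m div ?d * ?d"] by (simp add: c_def)
    qed
    thus ?thesis unfolding gG rG using d(1) by (auto simp: c_def) (metis mod_less_divisor)
  qed
  have g0: "g \<noteq> 0" using lg by auto
  have deg_root: "?d \<le> Polynomial.degree a" if a: "a \<noteq> 0" "poly (ac_poly a) z = 0" for a :: "'p mod_ring poly"
  proof -
    have "c ` {..<?d} \<subseteq> {x. poly (ac_poly a) x = 0}" using a by (auto simp: c_def poly_ac_power_card)
    moreover have "finite {x. poly (ac_poly a) x = 0}" using a(1) by (intro poly_roots_finite) simp
    ultimately have "card (c ` {..<?d}) \<le> card {x. poly (ac_poly a) x = 0}" by (rule card_mono[rotated])
    also have "\<dots> \<le> Polynomial.degree (ac_poly a)" using a(1) by (intro card_poly_roots_bound) simp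
    finally show ?thesis by (simp add: card_image[OF inj])
  qed
  have "Factorial_Ring.irreducible g"
  proof (rule Factorial_Ring.irreducibleI)
    show "g \<noteq> 0" by (rule g0)
    show "\<not> g dvd 1" using dg d(1) by (simp add: poly_dvd_1 is_unit_iff_degree g0)
    fix a b assume ab: "g = a * b"
    have nz: "a \<noteq> 0" "b \<noteq> 0" using ab g0 by auto
    have s: "Polynomial.degree a + Polynomial.degree b = ?d" using ab dg nz by (simp add: degree_mult_eq)
    have "poly (ac_poly g) z = 0" unfolding r by (intro exI[of _ 0]) simp
    hence "poly (ac_poly a) z = 0 \<or> poly (ac_poly b) z = 0" by (simp add: ab map_to_ac.hom_mult)
    hence "?d \<le> Polynomial.degree a \<or> ?d \<le> Polynomial.degree b" using deg_root nz by blast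
    hence "Polynomial.degree b = 0 \<or> Polynomial.degree a = 0" using s by auto
    thus "a dvd 1 \<or> b dvd 1" using nz by (auto simp: is_unit_iff_degree)
  qed
  thus ?thesis using that[of g] dg r lg unfolding Irr_def by blast
qed

lemma Irr_eqI:
  fixes f g :: "'p::prime_card mod_ring poly"
  assumes "f \<in> Irr" "g \<in> Irr" "poly (ac_poly f) z = 0" "poly (ac_poly g) z = 0"
  shows "f = g"
proof -
  have "\<not> coprime f g"
  proof
    assume "coprime f g"
    hence "fst (bezout_coefficients f g) * f + snd (bezout_coefficients f g) * g = 1"
      by (simp add: bezout_coefficients_fst_snd)
    from arg_cong[OF this, of "\<lambda>h. poly (ac_poly h) z"] show False
      using assms(3,4) by (simp add: map_to_ac.hom_add map_to_ac.hom_mult)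
  qed
  moreover have "prime_elem f" "prime_elem g" using assms(1,2) by (auto simp: Irr_def intro: irreducible_imp_prime_elem)
  ultimately have "f dvd g" "g dvd f"
    using prime_elem_imp_coprime[of f g] prime_elem_imp_coprime[of g f] by (auto simp: coprime_commute)
  hence "normalize f = normalize g" by (rule Rings.associatedI)
  moreover have "normalize f = f" "normalize g = g" using assms(1,2) by (auto simp: Irr_def normalize_poly_eq_map_poly)
  ultimately show ?thesis by simp
qed

lemma Irr_degree_pos: "f \<in> Irr \<Longrightarrow> Polynomial.degree (f :: 'a::field poly) > 0"
  unfolding Irr_def using Factorial_Ring.irreducible_def is_unit_iff_degree by blast

text \<open>This is the dictionary between degrees of irreducible polynomials and the fields that
  contain their roots; moreover all the roots are conjugate under Frobenius.\<close>

lemma Irr_root: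
  fixes f :: "'p::prime_card mod_ring poly"
  assumes "f \<in> Irr" "poly (ac_poly f) z = 0"
  shows "z ^ (CARD('p) ^ N) = z \<longleftrightarrow> Polynomial.degree f dvd N"
    and "poly (ac_poly f) x = 0 \<longleftrightarrow> (\<exists>m. x = z ^ (CARD('p) ^ m))"
proof -
  have "f \<noteq> 0" using assms(1) by (auto simp: Irr_def)
  hence ex: "\<exists>d>0. z ^ (CARD('p) ^ d) = z" using finite_orbit assms(2) by blast
  obtain g :: "'p mod_ring poly" where g: "g \<in> Irr" "Polynomial.degree g = frob_period z"
    "\<forall>x. poly (ac_poly g) x = 0 \<longleftrightarrow> (\<exists>m. x = z ^ (CARD('p) ^ m))"
    by (rule min_poly_exists[OF ex])
  have "poly (ac_poly g) z = 0" using g(3) by (auto intro!: exI[of _ 0])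
  hence "f = g" using Irr_eqI assms g(1) by blast
  thus "z ^ (CARD('p) ^ N) = z \<longleftrightarrow> Polynomial.degree f dvd N"
    "poly (ac_poly f) x = 0 \<longleftrightarrow> (\<exists>m. x = z ^ (CARD('p) ^ m))"
    using g frob_period(2)[OF ex] by auto
qed

section \<open>Roots and factors of the transform\<close>

lemma ex_root: "Polynomial.degree f > 0 \<Longrightarrow> \<exists>z. poly (ac_poly f) z = 0"
  by (intro alg_closed_imp_poly_has_root) simp

lemma ac_poly_linear: "ac_poly [:0, 1 / k:] = [:0, 1 / to_ac k:]"
  by (intro poly_eqI) (simp add: coeff_map_poly coeff_pCons split: nat.split)

lemma poly_ac_Q_transform:
  fixes f :: "'a::field poly"
  assumes "k \<noteq> 0" "w \<noteq> 0"
  shows "poly (ac_poly (Q_transform k f)) w =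
    (w / to_ac k) ^ Polynomial.degree f * poly (ac_poly f) (to_ac k * (w + inverse w))"
proof -
  let ?n = "Polynomial.degree f" and ?k = "to_ac k"
  have k: "?k \<noteq> 0" using assms by simp
  have "poly (ac_poly (Q_transform k f)) w =
    (\<Sum>i\<le>?n. to_ac (Polynomial.coeff f i) * ((w / ?k) ^ (?n - i) * (1 + w * w) ^ i))"
    by (simp add: Q_transform_def map_to_ac.hom_sum poly_sum to_ac_hom.map_poly_hom_smult map_to_ac.hom_mult
        map_to_ac.hom_power map_poly_pCons ac_poly_linear)
  also have "\<dots> = (\<Sum>i\<le>?n. (w / ?k) ^ ?n * (to_ac (Polynomial.coeff f i) * (?k * (w + inverse w)) ^ i))"
  proof (rule sum.cong)
    fix i assume "i \<in> {..?n}"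
    hence "(w / ?k) ^ ?n = (w / ?k) ^ (?n - i) * (w / ?k) ^ i" by (simp flip: power_add)
    moreover have "1 + w * w = (w / ?k) * (?k * (w + inverse w))"
      using assms(2) k by (simp add: distrib_left)
    hence "(1 + w * w) ^ i = (w / ?k) ^ i * (?k * (w + inverse w)) ^ i" by (simp only: power_mult_distrib)
    ultimately show "to_ac (Polynomial.coeff f i) * ((w / ?k) ^ (?n - i) * (1 + w * w) ^ i) =
        (w / ?k) ^ ?n * (to_ac (Polynomial.coeff f i) * (?k * (w + inverse w)) ^ i)"
      by (simp only: mult_ac)
  qed simp
  also have "\<dots> = (w / ?k) ^ ?n * poly (ac_poly f) (?k * (w + inverse w))"
    by (simp add: poly_altdef sum_distrib_left)
  finally show ?thesis .
qed

text \<open>Only the top summand survives at 0. So 0 is never a root, and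
  \<open>poly_ac_Q_transform\<close>, which needs a nonzero argument, applies to all the
  roots.\<close>

lemma poly_ac_Q_transform_0:
  assumes "lead_coeff f = (1::'a::field)"
  shows "poly (ac_poly (Q_transform k f)) 0 = 1"
proof -
  let ?n = "Polynomial.degree f"
  have "poly (ac_poly (Q_transform k f)) 0 =
    (\<Sum>i\<le>?n. to_ac (Polynomial.coeff f i) * 0 ^ (?n - i))"
    by (simp add: Q_transform_def map_to_ac.hom_sum poly_sum to_ac_hom.map_poly_hom_smult map_to_ac.hom_mult
        map_to_ac.hom_power map_poly_pCons ac_poly_linear)
  also have "\<dots> = (\<Sum>i\<in>{?n}. to_ac (Polynomial.coeff f i) * 0 ^ (?n - i))"
    by (rule sum.mono_neutral_right) (auto simp: power_0_left)
  finally show ?thesis using assms by simp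
qed

lemma Q_transform_monic:
  fixes f :: "'a::field poly"
  assumes "lead_coeff f = 1" "Polynomial.degree f > 0"
  shows "Polynomial.degree (Q_transform k f) = 2 * Polynomial.degree f" "lead_coeff (Q_transform k f) = 1"
proof -
  let ?n = "Polynomial.degree f"
  define g where "g = (\<Sum>i<?n. Polynomial.smult (Polynomial.coeff f i) ([:0, 1 / k:] ^ (?n - i) * [:1, 0, 1:] ^ i))"
  define h where "h = ([:1, 0, 1:] :: 'a poly) ^ ?n"
  have Q: "Q_transform k f = h + g"
    using assms(1) by (simp add: Q_transform_def g_def h_def lessThan_Suc_atMost[symmetric])
  have "lead_coeff h = lead_coeff ([:1, 0, 1:] :: 'a poly) ^ ?n" unfolding h_def by (rule lead_coeff_power)
  hence dh: "Polynomial.degree h = 2 * ?n" "lead_coeff h = 1"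
    by (simp_all add: h_def degree_power_eq)
  have "Polynomial.degree g < 2 * ?n"
    unfolding g_def
  proof (rule degree_sum_less)
    fix i assume i: "i \<in> {..<?n}"
    have "Polynomial.degree (Polynomial.smult (Polynomial.coeff f i) ([:0, 1 / k:] ^ (?n - i) * [:1, 0, 1:] ^ i))
        \<le> Polynomial.degree ([:0, 1 / k:] ^ (?n - i)) + Polynomial.degree (([:1, 0, 1:]::'a poly) ^ i)"
      by (rule order.trans[OF degree_smult_le degree_mult_le])
    also have "\<dots> \<le> 1 * (?n - i) + 2 * i"
      by (intro add_mono order.trans[OF degree_power_le] mult_right_mono) auto
    also have "\<dots> < 2 * ?n" using i by auto
    finally show "Polynomial.degree (Polynomial.smult (Polynomial.coeff f i) ([:0, 1 / k:] ^ (?n - i) * [:1, 0, 1:] ^ i)) < 2 * ?n" .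
  qed (use assms in auto)
  hence "Polynomial.degree g < Polynomial.degree h" using dh by simp
  thus "Polynomial.degree (Q_transform k f) = 2 * ?n" "lead_coeff (Q_transform k f) = 1"
    unfolding Q using dh by (simp_all add: degree_add_eq_left coeff_eq_0)
qed

context
  fixes k :: "'p::prime_card mod_ring"
  assumes k: "k \<noteq> 0"
begin

abbreviation (input) \<kappa> where "\<kappa> \<equiv> to_ac k"

lemma Q_root:
  assumes "g \<in> Irr" "poly (ac_poly (Q_transform k g)) w = 0"
  shows "w \<noteq> 0" "poly (ac_poly g) (\<kappa> * (w + inverse w)) = 0"
proof -
  show w: "w \<noteq> 0" using poly_ac_Q_transform_0[of g k] assms by (auto simp: Irr_def)
  thus "poly (ac_poly g) (\<kappa> * (w + inverse w)) = 0"
    using poly_ac_Q_transform[OF k w, of g] assms(2) k by simp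
qed

lemma Q_root_inverse:
  assumes "g \<in> Irr" "poly (ac_poly (Q_transform k g)) w = 0"
  shows "poly (ac_poly (Q_transform k g)) (inverse w) = 0"
proof -
  have w: "w \<noteq> 0" using Q_root[OF assms] by simp
  thus ?thesis using poly_ac_Q_transform[OF k, of "inverse w" g] Q_root(2)[OF assms] by (simp add: add.commute)
qed

lemma theta_map_power_card:
  "(\<kappa> * (w + inverse w)) ^ (CARD('p) ^ N) = \<kappa> * (w ^ (CARD('p) ^ N) + inverse (w ^ (CARD('p) ^ N)))"
  by (simp add: power_mult_distrib power_card_add to_ac_power_card power_inverse)

lemma sum_inverse_eq_iff:
  fixes u w :: "'a::field"
  assumes "u \<noteq> 0" "w \<noteq> 0"
  shows "u + inverse u = w + inverse w \<longleftrightarrow> u = w \<or> u = inverse w"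
proof -
  have "u + inverse u = w + inverse w \<longleftrightarrow> (u - w) * (u * w - 1) = 0"
    using assms by (simp add: field_simps)
  also have "\<dots> \<longleftrightarrow> u = w \<or> u * w = 1" by (simp only: mult_eq_0_iff right_minus_eq)
  also have "u * w = 1 \<longleftrightarrow> u = inverse w" using assms by (auto simp: field_simps)
  finally show ?thesis .
qed

text \<open>The power of Frobenius that fixes the image of \<open>w\<close> fixes
  \<open>w + inverse w\<close>, so it sends \<open>w\<close> to itself or to its inverse; its square
  fixes \<open>w\<close>.\<close>

lemma Q_root_degree:
  assumes g: "g \<in> Irr" "poly (ac_poly (Q_transform k g)) w = 0"
    and h: "h \<in> Irr" "poly (ac_poly h) w = 0"
  shows "Polynomial.degree h = Polynomial.degree g \<or> Polynomial.degree h = 2 * Polynomial.degree g"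
proof -
  let ?d = "Polynomial.degree g"
  note w = Q_root[OF g]
  have "(\<kappa> * (w + inverse w)) ^ (CARD('p) ^ ?d) = \<kappa> * (w + inverse w)"
    using Irr_root(1)[OF g(1) w(2), of ?d] by simp
  hence "w ^ (CARD('p) ^ ?d) + inverse (w ^ (CARD('p) ^ ?d)) = w + inverse w"
    unfolding theta_map_power_card using k by simp
  hence wd: "w ^ (CARD('p) ^ ?d) = w \<or> w ^ (CARD('p) ^ ?d) = inverse w"
    using w(1) by (subst (asm) sum_inverse_eq_iff) auto
  have "w ^ (CARD('p) ^ (2 * ?d)) = (w ^ (CARD('p) ^ ?d)) ^ (CARD('p) ^ ?d)"
    by (simp add: mult_2 power_add power_mult)
  also have "\<dots> = w" using wd w(1) by (auto simp: power_inverse)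
  finally have dv: "Polynomial.degree h dvd 2 * ?d" using Irr_root(1)[OF h] by simp
  have "?d dvd Polynomial.degree h"
  proof -
    have "w ^ (CARD('p) ^ Polynomial.degree h) = w" using Irr_root(1)[OF h] by simp
    hence "(\<kappa> * (w + inverse w)) ^ (CARD('p) ^ Polynomial.degree h) = \<kappa> * (w + inverse w)"
      unfolding theta_map_power_card by simp
    thus ?thesis using Irr_root(1)[OF g(1) w(2)] by simp
  qed
  then obtain c where c: "Polynomial.degree h = ?d * c" by (elim dvdE)
  have "?d > 0" using Irr_degree_pos g(1) by blast
  hence "c dvd 2" using dv unfolding c by (simp add: mult.commute)
  hence "c \<le> 2" "c > 0" using dvd_pos_nat[of 2 c] by (auto dest: dvd_imp_le)
  hence "c = 1 \<or> c = 2" by auto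
  thus ?thesis using c by auto
qed

lemma min_poly_dvd:
  fixes f :: "'p mod_ring poly"
  assumes "f \<noteq> 0" "poly (ac_poly f) w = 0"
  obtains m where "m \<in> Irr" "poly (ac_poly m) w = 0" "m dvd f"
proof -
  obtain m :: "'p mod_ring poly" where m: "m \<in> Irr"
    "\<forall>x. poly (ac_poly m) x = 0 \<longleftrightarrow> (\<exists>i. x = w ^ (CARD('p) ^ i))"
    by (rule min_poly_exists[OF finite_orbit[OF assms]])
  have mw: "poly (ac_poly m) w = 0" using m(2) by (auto intro!: exI[of _ 0])
  have "m dvd f"
  proof (rule ccontr)
    assume n: "\<not> m dvd f"
    have "prime_elem m" using m(1) by (auto simp: Irr_def intro: irreducible_imp_prime_elem)
    hence "coprime m f" using n by (rule prime_elem_imp_coprime)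
    hence "fst (bezout_coefficients m f) * m + snd (bezout_coefficients m f) * f = 1"
      by (simp add: bezout_coefficients_fst_snd)
    from arg_cong[OF this, of "\<lambda>h. poly (ac_poly h) w"] show False
      using assms(2) mw by (simp add: map_to_ac.hom_add map_to_ac.hom_mult)
  qed
  thus ?thesis using that m(1) mw by blast
qed

lemma Q_transform_Irr:
  assumes "g \<in> Irr" "Factorial_Ring.irreducible (Q_transform k g)"
  shows "Q_transform k g \<in> Irr_deg (2 * Polynomial.degree g)"
  using Q_transform_monic[of g k] assms Irr_degree_pos[OF assms(1)] by (auto simp: Irr_deg_def Irr_def)

text \<open>All irreducible factors have degree \<open>d\<close> or \<open>2 * d\<close> with
  \<open>d\<close> the degree of \<open>g\<close>, so a reducible transform, having degree
  \<open>2 * d\<close>, leaves no choice but two factors of degree \<open>d\<close>.\<close>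

lemma Q_transform_split:
  assumes g: "g \<in> Irr" and n: "\<not> Factorial_Ring.irreducible (Q_transform k g)"
  obtains g1 g2 where "g1 \<in> Irr_deg (Polynomial.degree g)" "g2 \<in> Irr_deg (Polynomial.degree g)" "Q_transform k g = g1 * g2"
proof -
  let ?h = "Q_transform k g" and ?d = "Polynomial.degree g"
  have d: "?d > 0" by (rule Irr_degree_pos[OF g])
  have h: "Polynomial.degree ?h = 2 * ?d" "lead_coeff ?h = 1"
    using Q_transform_monic[of g k] g d by (auto simp: Irr_def)
  have h0: "?h \<noteq> 0" using h(2) by auto
  obtain w where w: "poly (ac_poly ?h) w = 0" using ex_root[of ?h] h d by auto
  obtain m where m: "m \<in> Irr" "poly (ac_poly m) w = 0" "m dvd ?h" using min_poly_dvd[OF h0 w] .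
  obtain q where q: "?h = m * q" using m(3) by (elim dvdE)
  have nz: "m \<noteq> 0" "q \<noteq> 0" using q h0 by auto
  have lq: "lead_coeff q = 1" using h(2) m(1) unfolding q lead_coeff_mult by (simp add: Irr_def)
  have dq: "Polynomial.degree m + Polynomial.degree q = 2 * ?d" using h(1) nz unfolding q by (simp add: degree_mult_eq)
  have dm: "Polynomial.degree m = ?d"
  proof (rule ccontr)
    assume "Polynomial.degree m \<noteq> ?d"
    hence "Polynomial.degree m = 2 * ?d" using Q_root_degree[OF g w m(1,2)] by simp
    hence "Polynomial.degree q = 0" using dq by simp
    hence "q = 1" using lq monic_degree_0 by blast
    thus False using n q m(1) by (simp add: Irr_def)
  qed
  have dq: "Polynomial.degree q = ?d" using dq dm by simp
  obtain x where x: "poly (ac_poly q) x = 0" using ex_root[of q] dq d by auto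
  obtain r where r: "r \<in> Irr" "poly (ac_poly r) x = 0" "r dvd q" using min_poly_dvd[OF nz(2) x] .
  have hx: "poly (ac_poly ?h) x = 0" using x unfolding q by (simp add: map_to_ac.hom_mult)
  have "Polynomial.degree r \<le> ?d" using dvd_imp_degree_le[OF r(3) nz(2)] dq by simp
  hence dr: "Polynomial.degree r = ?d" using Q_root_degree[OF g hx r(1,2)] d by auto
  obtain c where c: "q = r * c" using r(3) by (elim dvdE)
  have "r \<noteq> 0" "c \<noteq> 0" using c nz by auto
  hence "Polynomial.degree c = 0" using dq dr unfolding c by (simp add: degree_mult_eq)
  moreover have "lead_coeff c = 1" using lq r(1) unfolding c lead_coeff_mult by (simp add: Irr_def)
  ultimately have "c = 1" using monic_degree_0 by blast
  hence "q \<in> Irr_deg ?d" using c r(1) dr by (simp add: Irr_deg_def)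
  moreover have "m \<in> Irr_deg ?d" using m(1) dm by (simp add: Irr_deg_def)
  ultimately show ?thesis using that q by blast
qed

section \<open>The construction steps and the degrees along the sequence\<close>

lemma next_step_exists:
  assumes g: "g \<in> Irr"
  shows "\<exists>h. next_step k g h"
proof (cases "Factorial_Ring.irreducible (Q_transform k g)")
  case False
  obtain g1 g2 where "g1 \<in> Irr_deg (Polynomial.degree g)" "g2 \<in> Irr_deg (Polynomial.degree g)" "Q_transform k g = g1 * g2"
    by (rule Q_transform_split[OF g False])
  thus ?thesis unfolding next_step_def if_not_P[OF False] Irr_deg_def
    by (intro exI[of _ g1] exI[of _ g2] conjI) auto
qed (simp add: next_step_def)

lemma next_step_props:
  assumes "g \<in> Irr" "next_step k g h"
  shows "h \<in> Irr" "Polynomial.degree h = Polynomial.degree g \<or> Polynomial.degree h = 2 * Polynomial.degree g"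
    "poly (ac_poly h) w = 0 \<Longrightarrow> poly (ac_poly (Q_transform k g)) w = 0"
proof -
  have 1: "h \<in> Irr \<and> (\<exists>q. Q_transform k g = h * q)"
  proof (cases "Factorial_Ring.irreducible (Q_transform k g)")
    case True
    hence "h = Q_transform k g" using assms(2) by (simp add: next_step_def)
    thus ?thesis using Q_transform_Irr[OF assms(1) True] by (auto simp: Irr_deg_def intro!: exI[of _ 1])
  next
    case False
    thus ?thesis using assms(2) by (auto simp: next_step_def)
  qed
  thus h: "h \<in> Irr" by simp
  show Q: "poly (ac_poly (Q_transform k g)) w = 0" if "poly (ac_poly h) w = 0" for w
    using 1 that by (auto simp: map_to_ac.hom_mult)
  obtain w where w: "poly (ac_poly h) w = 0" using ex_root Irr_degree_pos[OF h] by blast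
  show "Polynomial.degree h = Polynomial.degree g \<or> Polynomial.degree h = 2 * Polynomial.degree g"
    by (rule Q_root_degree[OF assms(1) Q[OF w] h w])
qed

lemma first_step_imp_next_step: "first_step k n f g \<Longrightarrow> next_step k f g"
proof (cases "Factorial_Ring.irreducible (Q_transform k f)")
  case False
  assume "first_step k n f g"
  then obtain g2 where "g \<in> Irr_deg n" "g2 \<in> Irr_deg n" "Q_transform k f = g * g2"
    unfolding first_step_def if_not_P[OF False] by blast
  thus ?thesis unfolding next_step_def if_not_P[OF False] Irr_deg_def
    by (intro exI[of _ g] exI[of _ g2] conjI) auto
qed (simp add: first_step_def next_step_def)

text \<open>A periodic \<open>w\<close> is an iterate of its own image \<open>x\<close>, and the
  iterates of \<open>x\<close> stay in the field of \<open>x\<close> because \<open>theta\<close>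
  commutes with Frobenius.\<close>

lemma theta_periodic_power_card:
  assumes "theta_periodic \<kappa> (Fin w)" "\<kappa> * (w + inverse w) = x" "x ^ (CARD('p) ^ N) = x" "w \<noteq> 0"
  shows "w ^ (CARD('p) ^ N) = w"
proof -
  let ?F = "map_proj_line (\<lambda>z. z ^ (CARD('p) ^ N))"
  have step: "?F (theta \<kappa> y) = theta \<kappa> (?F y)" for y
    by (cases y) (auto simp: theta_map_power_card[simplified])
  have steps: "?F ((theta \<kappa> ^^ i) y) = (theta \<kappa> ^^ i) (?F y)" for i y
    by (induction i) (auto simp: step)
  obtain r where r: "r \<ge> 1" "(theta \<kappa> ^^ r) (Fin w) = Fin w" using assms(1) unfolding theta_periodic_def by blast
  have "theta \<kappa> (Fin w) = Fin x" using assms(2,4) by simp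
  moreover have "(theta \<kappa> ^^ r) (Fin w) = (theta \<kappa> ^^ (r - 1)) (theta \<kappa> (Fin w))"
    using r(1) by (cases r) (auto simp: funpow_swap1)
  ultimately have w: "Fin w = (theta \<kappa> ^^ (r - 1)) (Fin x)" using r(2) by simp
  have "?F (Fin w) = Fin w" unfolding w steps using assms(3) by simp
  thus ?thesis by simp
qed

text \<open>Periodic points with the same image are equal, as iterating over a common period
  \<open>r * r'\<close> shows. The roots \<open>w\<close> and \<open>inverse w\<close> have the same
  image, so they can both be periodic only if \<open>w\<close> is 1 or -1, which \<open>np\<close>
  excludes. The two factors may then be ordered so that the first one has the root that is not
  periodic.\<close>

lemma first_step_exists:
  assumes g: "g \<in> Irr_deg n"
    and np: "\<not> theta_periodic \<kappa> (Fin 1)" "\<not> theta_periodic \<kappa> (Fin (- 1))"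
  shows "\<exists>h. first_step k n g h"
proof (cases "Factorial_Ring.irreducible (Q_transform k g)")
  case False
  have gI: "g \<in> Irr" "Polynomial.degree g = n" using g by (auto simp: Irr_deg_def)
  obtain g1 g2 where s: "g1 \<in> Irr_deg n" "g2 \<in> Irr_deg n" "Q_transform k g = g1 * g2"
    by (rule Q_transform_split[OF gI(1) False, unfolded gI(2)])
  have root: "poly (ac_poly (Q_transform k g)) x = 0 \<longleftrightarrow> poly (ac_poly g1) x = 0 \<or> poly (ac_poly g2) x = 0" for x
    unfolding s(3) by (simp add: map_to_ac.hom_mult)
  have "Polynomial.degree g1 > 0" using Irr_degree_pos s(1) by (auto simp: Irr_deg_def)
  then obtain w where w: "poly (ac_poly (Q_transform k g)) w = 0" using ex_root root by blast
  have "\<exists>x. poly (ac_poly (Q_transform k g)) x = 0 \<and> \<not> theta_periodic \<kappa> (Fin x)"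
  proof (rule ccontr)
    assume "\<not> ?thesis"
    hence "theta_periodic \<kappa> (Fin w)" "theta_periodic \<kappa> (Fin (inverse w))"
      using w Q_root_inverse[OF gI(1) w] by auto
    then obtain r r' where r: "r \<ge> 1" "(theta \<kappa> ^^ r) (Fin w) = Fin w"
      "r' \<ge> 1" "(theta \<kappa> ^^ r') (Fin (inverse w)) = Fin (inverse w)" unfolding theta_periodic_def by blast
    have mult: "(theta \<kappa> ^^ (a * b)) y = y" if "(theta \<kappa> ^^ a) y = y" for a b y
      using that by (induction b) (auto simp: funpow_add)
    have w0: "w \<noteq> 0" using Q_root[OF gI(1) w] by simp
    obtain c where c: "r * r' = Suc c" using r(1,3) by (cases "r * r'") auto
    have "Fin w = (theta \<kappa> ^^ c) (theta \<kappa> (Fin w))"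
      using mult[OF r(2), of r'] unfolding c by (simp add: funpow_swap1)
    also have "theta \<kappa> (Fin w) = theta \<kappa> (Fin (inverse w))" using w0 by (simp add: add.commute)
    also have "(theta \<kappa> ^^ c) \<dots> = Fin (inverse w)"
      using mult[OF r(4), of r] c by (simp add: funpow_swap1 mult.commute)
    finally have "w * w = 1" using w0 by (simp add: field_simps)
    hence "w = 1 \<or> w = - 1" by (simp add: square_eq_1_iff)
    thus False using np \<open>theta_periodic \<kappa> (Fin w)\<close> by auto
  qed
  then obtain x where x: "poly (ac_poly (Q_transform k g)) x = 0" "\<not> theta_periodic \<kappa> (Fin x)" by blast
  have GF: "x \<in> GF_ext n" if "poly (ac_poly h) x = 0" "h \<in> Irr_deg n" for h
    using Irr_root(1)[of h x n] that by (simp add: GF_ext_def Irr_deg_def)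
  consider "poly (ac_poly g1) x = 0" | "poly (ac_poly g2) x = 0" using root x by blast
  thus ?thesis
  proof cases
    case 1
    thus ?thesis using s x GF[OF 1 s(1)] unfolding first_step_def if_not_P[OF False] by blast
  next
    case 2
    have "Q_transform k g = g2 * g1" using s(3) by (simp add: mult.commute)
    thus ?thesis using s(1,2) x GF[OF 2 s(2)] 2 unfolding first_step_def if_not_P[OF False] by blast
  qed
qed (simp add: first_step_def)

text \<open>The polynomials are followed along a compatible chain of roots \<open>z i\<close>, whose
  fields determine the degrees. The number \<open>v\<close> of consecutive indices sharing a degree
  is a parameter, so that both kinds of \<open>k\<close> are instances.\<close>

theorem sequence_degrees:
  assumes f0: "f 0 \<in> Irr_deg n" and f1: "first_step k n (f 0) (f 1)"
    and fi: "\<And>i. i \<ge> 2 \<Longrightarrow> next_step k (f (i - 1)) (f i)"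
    and e: "e0 > 0" "e1 > 0"
    and core: "\<And>z. (\<And>i. theta \<kappa> (Fin (z (Suc i))) = Fin (z i)) \<Longrightarrow> z 0 ^ (CARD('p) ^ n) = z 0 \<Longrightarrow>
      \<not> theta_periodic \<kappa> (Fin (z 1)) \<Longrightarrow>
      \<exists>d0. \<forall>i. (z i ^ (CARD('p) ^ n) = z i \<longrightarrow> i + d0 \<le> max e0 e1) \<and>
      (\<forall>j\<ge>1. z i ^ (CARD('p) ^ (2 ^ j * n)) = z i \<longleftrightarrow> i + d0 \<le> e0 + e1 + (j - 1) * v)"
  shows "\<exists>s t. t > 0 \<and> s \<le> max e0 e1 \<and> s + t \<le> e0 + e1 \<and>
    f ` {0..s} \<subseteq> Irr_deg n \<and> f ` {s + 1..s + t} \<subseteq> Irr_deg (2 * n) \<and>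
    (\<forall>j\<ge>1. \<forall>i. (j - 1) * v < i \<and> i \<le> j * v \<longrightarrow> f (s + t + i) \<in> Irr_deg (2 ^ (j + 1) * n))"
proof -
  have step: "next_step k (f i) (f (Suc i))" for i
    using first_step_imp_next_step[OF f1] fi[of "Suc i"] by (cases i) auto
  have I: "f i \<in> Irr" for i
    using f0 next_step_props(1)[OF _ step] by (induction i) (auto simp: Irr_deg_def)
  have n: "Polynomial.degree (f 0) = n" "n > 0" using f0 Irr_degree_pos[OF I[of 0]] by (auto simp: Irr_deg_def)
  have down: "w \<noteq> 0 \<and> poly (ac_poly (f i)) (\<kappa> * (w + inverse w)) = 0" if "poly (ac_poly (f (Suc i))) w = 0" for i w
    using Q_root[OF I next_step_props(3)[OF I step that]] by simp
  \<comment> \<open>Any root \<open>w\<close> of the next polynomial has as image some root of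
    \<open>f i\<close>, a conjugate of \<open>x\<close>; the same power of Frobenius moves
    \<open>w\<close> above \<open>x\<close>.\<close>
  have up: "\<exists>w. poly (ac_poly (f (Suc i))) w = 0 \<and> theta \<kappa> (Fin w) = Fin x" if x: "poly (ac_poly (f i)) x = 0" for i x
  proof -
    obtain w where w: "poly (ac_poly (f (Suc i))) w = 0" using ex_root Irr_degree_pos[OF I] by blast
    have "\<exists>m. x = (\<kappa> * (w + inverse w)) ^ (CARD('p) ^ m)"
      using x unfolding Irr_root(2)[OF I conjunct2[OF down[OF w]]] .
    then obtain m where m: "x = (\<kappa> * (w + inverse w)) ^ (CARD('p) ^ m)" by (elim exE)
    have "poly (ac_poly (f (Suc i))) (w ^ (CARD('p) ^ m)) = 0" using w by (simp add: poly_ac_power_card)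
    thus ?thesis using m down[OF w] theta_map_power_card[of w m] by (intro exI[of _ "w ^ (CARD('p) ^ m)"]) auto
  qed
  \<comment> \<open>In the split case the root is part of the construction. In the irreducible case
    a periodic root would lie in the field of its image, which has degree \<open>n\<close>, whereas
    its own degree is \<open>2 * n\<close>.\<close>
  obtain z1 where z1: "poly (ac_poly (f 1)) z1 = 0" "\<not> theta_periodic \<kappa> (Fin z1)"
  proof (cases "Factorial_Ring.irreducible (Q_transform k (f 0))")
    case True
    hence f1Q: "f 1 = Q_transform k (f 0)" using f1 by (simp add: first_step_def)
    hence d1: "Polynomial.degree (f 1) = 2 * n" using Q_transform_Irr[OF I True] n by (simp add: Irr_deg_def)
    obtain w where w: "poly (ac_poly (f 1)) w = 0" using ex_root Irr_degree_pos[OF I] by blast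
    have dw: "w \<noteq> 0 \<and> poly (ac_poly (f 0)) (\<kappa> * (w + inverse w)) = 0" using down[of 0 w] w by simp
    have "\<not> theta_periodic \<kappa> (Fin w)"
    proof
      assume "theta_periodic \<kappa> (Fin w)"
      from theta_periodic_power_card[OF this refl, of n] dw
      have "w ^ (CARD('p) ^ n) = w" using Irr_root(1)[OF I[of 0], of "\<kappa> * (w + inverse w)" n] n by simp
      hence "2 * n dvd n" using Irr_root(1)[OF I w] d1 by simp
      thus False using n(2) by (auto dest: dvd_imp_le)
    qed
    thus ?thesis using that w by blast
  next
    case False
    thus ?thesis using f1 that unfolding first_step_def if_not_P[OF False] by blast
  qed
  have "\<exists>z. \<forall>i. (poly (ac_poly (f (Suc i))) (z i) = 0 \<and> (i = 0 \<longrightarrow> z i = z1)) \<and> theta \<kappa> (Fin (z (Suc i))) = Fin (z i)"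
    using z1(1) up by (intro dependent_nat_choice) auto
  then obtain y where y: "\<And>i. poly (ac_poly (f (Suc i))) (y i) = 0" "y 0 = z1"
    "\<And>i. theta \<kappa> (Fin (y (Suc i))) = Fin (y i)" by blast
  define z where "z i = (case i of 0 \<Rightarrow> \<kappa> * (z1 + inverse z1) | Suc j \<Rightarrow> y j)" for i
  have zr: "poly (ac_poly (f i)) (z i) = 0" for i
    using y(1) down[of 0 z1] z1(1) by (cases i) (auto simp: z_def)
  have zt: "theta \<kappa> (Fin (z (Suc i))) = Fin (z i)" for i
    using y(2,3) down[of 0 z1] z1(1) by (cases i) (auto simp: z_def)
  have zd: "z i ^ (CARD('p) ^ N) = z i \<longleftrightarrow> Polynomial.degree (f i) dvd N" for i N
    by (rule Irr_root(1)[OF I zr])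
  have "z 1 = z1" using y(2) by (simp add: z_def)
  hence z1': "\<not> theta_periodic \<kappa> (Fin (z 1))" using z1(2) by simp
  have z0: "z 0 ^ (CARD('p) ^ n) = z 0" unfolding zd n(1) by simp
  obtain d0 where "\<forall>i. (Polynomial.degree (f i) dvd n \<longrightarrow> i + d0 \<le> max e0 e1) \<and>
      (\<forall>j\<ge>1. Polynomial.degree (f i) dvd 2 ^ j * n \<longleftrightarrow> i + d0 \<le> e0 + e1 + (j - 1) * v)"
    using core[OF zt z0 z1'] unfolding zd by (elim exE)
  hence d0: "\<And>i. Polynomial.degree (f i) dvd n \<Longrightarrow> i + d0 \<le> max e0 e1"
    "\<And>i j. j \<ge> 1 \<Longrightarrow> Polynomial.degree (f i) dvd 2 ^ j * n \<longleftrightarrow> i + d0 \<le> e0 + e1 + (j - 1) * v"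
    by blast+
    \<comment> \<open>Each step keeps the degree or doubles it. So the degrees are
      \<open>2 ^ m i * n\<close> with \<open>m\<close> nondecreasing, and the indices with a given
      degree are consecutive.\<close>
    have "\<exists>m. \<forall>i. (Polynomial.degree (f i) = 2 ^ m i * n \<and> (i = 0 \<longrightarrow> m i = 0)) \<and> m i \<le> m (Suc i)"
    proof (rule dependent_nat_choice)
      show "\<exists>x. Polynomial.degree (f 0) = 2 ^ x * n \<and> (0 = 0 \<longrightarrow> x = 0)" using n by auto
      fix x i assume x: "Polynomial.degree (f i) = 2 ^ x * n \<and> (i = 0 \<longrightarrow> x = 0)"
      have "Polynomial.degree (f (Suc i)) = 2 ^ x * n \<or> Polynomial.degree (f (Suc i)) = 2 ^ Suc x * n"
        using next_step_props(2)[OF I step, of i] x by (simp add: mult.assoc)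
      thus "\<exists>y. (Polynomial.degree (f (Suc i)) = 2 ^ y * n \<and> (Suc i = 0 \<longrightarrow> y = 0)) \<and> x \<le> y"
        by (elim disjE) (rule exI[of _ x], simp, rule exI[of _ "Suc x"], simp)
    qed
  then obtain m where m': "\<forall>i. (Polynomial.degree (f i) = 2 ^ m i * n \<and> (i = 0 \<longrightarrow> m i = 0)) \<and> m i \<le> m (Suc i)"
    by (elim exE)
  have m: "\<And>i. Polynomial.degree (f i) = 2 ^ m i * n" "\<And>i. m i \<le> m (Suc i)" "m 0 = 0"
    using m' by simp_all
  have mono: "m i \<le> m j" if "i \<le> j" for i j using m(2) that by (rule lift_Suc_mono_le)
  have mdvd: "Polynomial.degree (f i) dvd 2 ^ j * n \<longleftrightarrow> m i \<le> j" for i j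
    unfolding m(1) using n(2) by (simp add: dvd_power_iff_le)
  have A: "i + d0 \<le> max e0 e1" if "m i = 0" for i using d0(1)[of i] mdvd[of i 0] that by simp
  have B: "m i \<le> j \<longleftrightarrow> i + d0 \<le> e0 + e1 + (j - 1) * v" if "j \<ge> 1" for i j
    using d0(2)[OF that, of i] mdvd by simp
  \<comment> \<open>The last index with degree \<open>n\<close>; the set is bounded by
    \<open>A\<close> and contains 0.\<close>
  define s where "s = Max {i. m i = 0}"
  have fin: "finite {i. m i = 0}"
  proof (rule finite_subset)
    show "{i. m i = 0} \<subseteq> {..max e0 e1}" using A by (auto dest: add_leD1)
  qed simp
  have s0: "m s = 0" and smax: "\<And>i. m i = 0 \<Longrightarrow> i \<le> s"
    using Max_in[OF fin] Max_ge[OF fin] m(3) by (auto simp: s_def)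
  have sd: "s + d0 \<le> max e0 e1" by (rule A[OF s0])
  \<comment> \<open>This makes \<open>s + t\<close> the last index with degree at most
    \<open>2 * n\<close>. It is positive because \<open>e0\<close> and \<open>e1\<close> are, so
    that \<open>max e0 e1 < e0 + e1\<close>.\<close>
  define t where "t = e0 + e1 - d0 - s"
  have st: "s + t + d0 = e0 + e1" "t > 0" using sd e by (auto simp: t_def)
  have D: "f i \<in> Irr_deg (2 ^ m i * n)" for i using I m(1) by (simp add: Irr_deg_def)
  show ?thesis
  proof (rule exI[of _ s], rule exI[of _ t], intro conjI allI impI)
    show "t > 0" "s \<le> max e0 e1" "s + t \<le> e0 + e1" using st sd by auto
    show "f ` {0..s} \<subseteq> Irr_deg n"
    proof (rule image_subsetI)
      fix i assume "i \<in> {0..s}"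
      hence "m i = 0" using mono[of i s] s0 by simp
      thus "f i \<in> Irr_deg n" using D[of i] by simp
    qed
    show "f ` {s + 1..s + t} \<subseteq> Irr_deg (2 * n)"
    proof (rule image_subsetI)
      fix i assume i: "i \<in> {s + 1..s + t}"
      have "m i \<le> 1" using B[of 1 i] i st by simp
      moreover have "m i \<noteq> 0" using smax[of i] i by auto
      ultimately have "m i = 1" by simp
      thus "f i \<in> Irr_deg (2 * n)" using D[of i] by simp
    qed
    fix j i :: nat assume j: "1 \<le> j" and i: "(j - 1) * v < i \<and> i \<le> j * v"
    \<comment> \<open>The depth of this root is \<open>e0 + e1 + i\<close>, with \<open>i\<close> in
      the block of length \<open>v\<close> that ends at \<open>j * v\<close>: within the bound
      \<open>B\<close> for \<open>Suc j\<close>, beyond the one for \<open>j\<close>.\<close>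
    have "m (s + t + i) \<le> Suc j" using B[of "Suc j" "s + t + i"] i st by simp
    moreover have "\<not> m (s + t + i) \<le> j" using B[OF j, of "s + t + i"] i st by simp
    ultimately have "m (s + t + i) = j + 1" by simp
    thus "f (s + t + i) \<in> Irr_deg (2 ^ (j + 1) * n)" using D[of "s + t + i"] by simp
  qed
qed

end

section \<open>Valuations\<close>

lemma infinite_UNIV_alg_closed: "infinite (UNIV :: 'a::alg_closed_field set)"
proof
  assume fin: "finite (UNIV :: 'a set)"
  let ?g = "\<Prod>a\<in>(UNIV :: 'a set). [:- a, 1:]"
  have "Polynomial.degree ?g = card (UNIV :: 'a set)" by (simp add: degree_prod_eq_sum_degree)
  moreover have "card (UNIV :: 'a set) > 0" using fin by (simp add: card_gt_0_iff)
  ultimately have "Polynomial.degree (?g + 1) > 0" by (subst degree_add_eq_left) auto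
  then obtain x where "poly (?g + 1) x = 0" using alg_closed_imp_poly_has_root by blast
  moreover have "poly ?g x = 0" using fin by (simp add: poly_prod)
  ultimately show False by simp
qed

lemma two_neq_zero_ac:
  assumes "odd CARD('p::prime_card)"
  shows "(2 :: 'p mod_ring alg_closure) \<noteq> 0"
proof
  assume "(2 :: 'p mod_ring alg_closure) = 0"
  hence "of_nat 2 = (0 :: 'p mod_ring alg_closure)" by simp
  hence "CARD('p) dvd 2" by (simp only: of_nat_eq_0_iff_char_dvd CHAR_alg_closure semiring_char_mod_ring)
  hence "CARD('p) \<le> 2" by (auto dest: dvd_imp_le)
  moreover have "CARD('p) > 1" by (rule nontriv)
  ultimately have "CARD('p) = 2" by linarith
  thus False using assms by simp
qed

lemma two_neq_zero_mod_ring: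
  assumes "odd CARD('p::prime_card)"
  shows "(2 :: 'p mod_ring) \<noteq> 0"
proof
  assume "(2 :: 'p mod_ring) = 0"
  hence "to_ac (2 :: 'p mod_ring) = 0" by simp
  thus False using two_neq_zero_ac[OF assms] by (simp only: to_ac_numeral)
qed

context cm_theta
begin

text \<open>Otherwise a power of Frobenius would fix every abscissa, but only finitely many field
  elements are fixed. The valuations of these differences are therefore finite.\<close>

lemma pi_power_neq:
  assumes "infinite (UNIV :: 'a set)" "N > 0"
  shows "\<pi> ^ N - 1 \<noteq> 0" "\<pi> ^ N + 1 \<noteq> 0"
proof -
  have *: False if "\<pi> ^ N - 1 = 0 \<or> \<pi> ^ N + 1 = 0"
  proof -
    have "z ^ (p ^ N) = z" for z :: 'a
    proof -
      obtain P where P: "P \<in> E" "xm P = Fin z" using xm_surj by blast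
      show ?thesis using fixed_iff[OF P, of N] that P(1) by auto
    qed
    hence "{z::'a. z ^ (p ^ N) = z} = UNIV" by auto
    moreover have "2 \<le> p ^ N" using p_ge_2 assms(2) self_le_power[of p N] by linarith
    ultimately show False using finite_roots_power_eq[of "p ^ N", where 'a = 'a] assms(1) by simp
  qed
  show "\<pi> ^ N - 1 \<noteq> 0" "\<pi> ^ N + 1 \<noteq> 0" using * by blast+
qed

lemma power_rdvd_le:
  assumes "\<rho> ^ j rdvd (\<rho> ^ e * m)" "\<not> \<rho> rdvd m"
  shows "j \<le> e"
proof (rule ccontr)
  assume "\<not> j \<le> e"
  then obtain i where i: "j = e + Suc i" by (metis add_Suc_right less_imp_Suc_add not_le)
  obtain c where c: "c \<in> R" "\<rho> ^ e * m = \<rho> ^ j * c" using assms(1) unfolding rdvd_def by blast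
  have "\<rho> ^ e * m = \<rho> ^ e * (\<rho> * (\<rho> ^ i * c))" using c(2) unfolding i by (simp add: power_add mult_ac)
  hence "m = \<rho> * (\<rho> ^ i * c)" using rho_nz by simp
  thus False using assms(2) c(1) rdvd_self_mult[of "\<rho> ^ i * c" \<rho>] by auto
qed

lemma ring_valuation_eq:
  assumes "a = \<rho> ^ e * m" "m \<in> R" "\<not> \<rho> rdvd m"
  shows "ring_valuation (Z_adjoin w) \<rho> a = e"
  unfolding ring_valuation_def rdvd_iff[symmetric]
proof (rule Greatest_equality)
  show "\<rho> ^ e rdvd a" using assms by (auto simp: rdvd_def)
  show "y \<le> e" if "\<rho> ^ y rdvd a" for y using power_rdvd_le that assms by blast
qed

text \<open>Descent on the norm, which each division by \<open>\<rho>\<close> halves.\<close>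

lemma factor_rho:
  assumes norm: "\<And>a. a \<in> R \<Longrightarrow> \<exists>n::nat. (cmod a)\<^sup>2 = real n" and nr: "(cmod \<rho>)\<^sup>2 = 2"
    and a: "a \<in> R" "a \<noteq> 0"
  obtains e m where "a = \<rho> ^ e * m" "m \<in> R" "\<not> \<rho> rdvd m"
proof -
  have "\<exists>e m. a = \<rho> ^ e * m \<and> m \<in> R \<and> \<not> \<rho> rdvd m" if "(cmod a)\<^sup>2 = real n" for n
    using a that
  proof (induction n arbitrary: a rule: less_induct)
    case (less n)
    show ?case
    proof (cases "\<rho> rdvd a")
      case False
      thus ?thesis using less.prems by (intro exI[of _ 0] exI[of _ a]) simp
    next
      case True
      then obtain b where b: "b \<in> R" "a = \<rho> * b" by (auto simp: rdvd_def)
      obtain n' where n': "(cmod b)\<^sup>2 = real n'" using norm b(1) by blast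
      have "real n = 2 * real n'" using less.prems(3) b(2) nr n' by (simp add: norm_mult power_mult_distrib)
      moreover have "b \<noteq> 0" using b less.prems by auto
      ultimately have "n' < n" using n' less.prems(3) by (cases "n' = 0") auto
      from less.IH[OF this b(1) \<open>b \<noteq> 0\<close> n'] obtain e m where em: "b = \<rho> ^ e * m" "m \<in> R" "\<not> \<rho> rdvd m" by blast
      thus ?thesis using b(2) by (intro exI[of _ "Suc e"] exI[of _ m]) simp
    qed
  qed
  thus ?thesis using norm[OF a(1)] that by blast
qed

text \<open>The last two hypotheses say that \<open>P\<close> has exact order
  \<open>\<rho> ^ Suc j\<close>. If \<open>a\<close> were \<open>\<rho> ^ i * b\<close> with
  \<open>i \<le> j\<close> and \<open>b\<close> prime to \<open>\<rho>\<close>, cancellation would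
  show that \<open>\<rho> ^ i\<close> kills \<open>P\<close> already. With a rational point and
  \<open>a = \<pi> - 1\<close> this bounds a valuation from below.\<close>

lemma rho_power_rdvd_of_ann:
  assumes "P \<in> E" "a \<in> R" "\<Phi> a P = EC_Infinity" "\<Phi> (\<rho> ^ j) P \<noteq> EC_Infinity" "\<Phi> (\<rho> ^ Suc j) P = EC_Infinity"
  shows "\<rho> ^ Suc j rdvd a"
proof -
  have "i \<le> Suc j \<Longrightarrow> \<rho> ^ i rdvd a" for i
  proof (induction i)
    case 0
    thus ?case using assms(2) by (simp add: rdvd_def)
  next
    case (Suc i)
    then obtain b where b: "b \<in> R" "a = \<rho> ^ i * b" by (auto simp: rdvd_def)
    have "\<rho> rdvd b"
    proof (rule ccontr)
      assume n: "\<not> \<rho> rdvd b"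
      let ?Q = "\<Phi> (\<rho> ^ i) P"
      have Q: "?Q \<in> E" using assms(1) by simp
      have 1: "\<Phi> b ?Q = EC_Infinity" using assms(1,3) b by (simp add: Phi_times[symmetric] mult.commute)
      have "\<rho> ^ Suc j = \<rho> ^ (Suc j - i) * \<rho> ^ i" using Suc.prems by (simp flip: power_add)
      hence 2: "\<Phi> (\<rho> ^ (Suc j - i) * 1) ?Q = EC_Infinity" using assms(1,5) by (simp add: Phi_times[symmetric])
      have "?Q = EC_Infinity" using ann_cancel_rho[OF Q b(1) n 1 _ 2] Q by simp
      hence "\<Phi> (\<rho> ^ (j - i)) ?Q = EC_Infinity" by simp
      moreover have "\<rho> ^ j = \<rho> ^ (j - i) * \<rho> ^ i" using Suc.prems by (simp flip: power_add)
      ultimately show False using assms(1,4) by (simp add: Phi_times)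
    qed
    then obtain c where c: "c \<in> R" "b = \<rho> * c" by (auto simp: rdvd_def)
    have "a = \<rho> ^ Suc i * c" unfolding b(2) c(2) by (simp add: mult_ac)
    thus ?case using c(1) unfolding rdvd_def by blast
  qed
  thus ?thesis by blast
qed

lemma rdvd_power_diff_one:
  assumes "a rdvd (\<pi> - 1)"
  shows "a rdvd (\<pi> ^ n - 1)"
proof -
  have "\<exists>c\<in>R. \<pi> ^ n - 1 = (\<pi> - 1) * c"
  proof (induction n)
    case 0
    show ?case by (rule bexI[of _ 0]) simp_all
  next
    case (Suc n)
    then obtain c where c: "c \<in> R" "\<pi> ^ n - 1 = (\<pi> - 1) * c" by blast
    have "\<pi> ^ Suc n - 1 = \<pi> * (\<pi> ^ n - 1) + (\<pi> - 1)" by (simp add: algebra_simps)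
    also have "\<dots> = (\<pi> - 1) * (\<pi> * c + 1)" unfolding c(2) by (simp add: algebra_simps)
    finally show ?case by (rule bexI) (use c(1) in simp)
  qed
  then obtain c where c: "c \<in> R" "\<pi> ^ n - 1 = (\<pi> - 1) * c" by blast
  show ?thesis unfolding c(2) by (rule rdvd_mult[OF assms c(1)])
qed

end

section \<open>The curve \<open>y\<^sup>2 = x\<^sup>3 + x\<close>\<close>

lemma Gauss_norm:
  assumes "a \<in> carrier (Z_adjoin \<i>)"
  shows "(cmod a)\<^sup>2 = real (gauss_norm a)"
proof -
  obtain u v :: int where a: "a = of_int u + of_int v * \<i>" using assms unfolding Z_adjoin_mem_iff by blast
  have "Re a = of_int u" "Im a = of_int v" by (simp_all add: a)
  thus ?thesis by (simp add: cmod_power2 gauss_norm_def)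
qed

fun ec_i :: "'a::field \<Rightarrow> 'a ec_point \<Rightarrow> 'a ec_point" where
  "ec_i \<iota> EC_Infinity = EC_Infinity"
| "ec_i \<iota> (Affine x y) = Affine (- x) (\<iota> * y)"

text \<open>The map is linear in the coordinates and carries lines to lines: the slope is multiplied
  by \<open>- \<iota>\<close>, and its square changes sign, as the abscissae do.\<close>

lemma ec_i_add:
  fixes \<iota> :: "'a::field"
  assumes i: "\<iota> * \<iota> = - 1" and two: "(2::'a) \<noteq> 0"
  shows "ec_i \<iota> (ec_add 1 P Q) = ec_add 1 (ec_i \<iota> P) (ec_i \<iota> Q)"
proof (cases "P = EC_Infinity \<or> Q = EC_Infinity")
  case False
  then obtain x1 y1 x2 y2 where PQ: "P = Affine x1 y1" "Q = Affine x2 y2" by (metis ec_point.exhaust)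
  have nz: "\<iota> \<noteq> 0" using i by auto
  have l: "\<iota> * (\<iota> * a) = - a" for a using i by (simp flip: mult.assoc)
  define l where "l = (if x1 = x2 then (3 * x1\<^sup>2 + 1) / (2 * y1) else (y2 - y1) / (x2 - x1))"
  define l' where "l' = (if - x1 = - x2 then (3 * (- x1)\<^sup>2 + 1) / (2 * (\<iota> * y1)) else (\<iota> * y2 - \<iota> * y1) / (- x2 - - x1))"
  have ll: "l' = - \<iota> * l"
  proof (cases "x1 = x2")
    case True
    have "1 / \<iota> = - \<iota>" using nz i by (simp add: field_simps)
    moreover have "l' = (1 / \<iota>) * l" using True by (simp add: l'_def l_def)
    ultimately show ?thesis by simp
  next
    case False
    hence "l' = (\<iota> * (y2 - y1)) / (- (x2 - x1))" by (simp add: l'_def right_diff_distrib)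
    thus ?thesis using False by (simp only: l_def if_False divide_minus_right mult_minus_left times_divide_eq_right minus_divide_left)
  qed
  have l2: "l'\<^sup>2 = - (l\<^sup>2)" unfolding ll power2_eq_square using i by (simp add: mult_ac l)
  have inv: "- x1 = - x2 \<and> \<iota> * y1 = - (\<iota> * y2) \<longleftrightarrow> x1 = x2 \<and> y1 = - y2"
    using nz by (auto simp flip: mult_minus_right)
  show ?thesis
  proof (cases "x1 = x2 \<and> y1 = - y2")
    case True
    thus ?thesis using PQ by simp
  next
    case False
    have "ec_add 1 P Q = Affine (l\<^sup>2 - x1 - x2) (l * (x1 - (l\<^sup>2 - x1 - x2)) - y1)"
      unfolding PQ ec_add.simps if_not_P[OF False] l_def Let_def ..
    moreover have "ec_add 1 (ec_i \<iota> P) (ec_i \<iota> Q) =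
        Affine (l'\<^sup>2 - - x1 - - x2) (l' * (- x1 - (l'\<^sup>2 - - x1 - - x2)) - \<iota> * y1)"
      unfolding PQ ec_i.simps ec_add.simps inv if_not_P[OF False] l'_def Let_def ..
    ultimately show ?thesis unfolding l2 by (simp add: ll algebra_simps)
  qed
qed auto

lemma ec_i_closed: "\<iota> * \<iota> = - 1 \<Longrightarrow> P \<in> ec_points 1 0 \<Longrightarrow> ec_i \<iota> P \<in> ec_points (1::'a::field) 0"
  by (cases P) (auto simp: power_mult_distrib power2_eq_square[of \<iota>] power3_eq_cube)

lemma ec_i_endomorphism:
  fixes \<iota> :: "'a::field"
  assumes i: "\<iota> * \<iota> = - 1" and two: "(2::'a) \<noteq> 0"
  shows "restrict (ec_i \<iota>) (ec_points 1 0) \<in> ec_endomorphisms 1 0"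
proof -
  let ?E = "ec_points (1::'a) 0" and ?f = "restrict (ec_i \<iota>) (ec_points 1 0)"
  have "ec_rational_map 1 0 ?f"
    unfolding ec_rational_map_def
    by (rule exI[of _ "[:[:0, -1:]:]"], rule exI[of _ 1], rule exI[of _ "[:0, [:\<iota>:]:]"], rule exI[of _ 1])
      (simp add: poly_xy_def mult.commute)
  moreover have "?f (ec_add 1 P Q) = ec_add 1 (?f P) (?f Q)" if "P \<in> ?E" "Q \<in> ?E" for P Q
    using that ec_add_closed[OF two that] ec_i_add[OF i two] by simp
  ultimately show ?thesis unfolding ec_endomorphisms_def using ec_i_closed[OF i] by auto
qed

fun ec_x :: "'a ec_point \<Rightarrow> 'a proj_line" where
  "ec_x EC_Infinity = Infty"
| "ec_x (Affine x y) = Fin x"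

lemma ec_x_eq_iff:
  assumes "P \<in> ec_points A B" "Q \<in> ec_points A B"
  shows "ec_x P = ec_x Q \<longleftrightarrow> Q = P \<or> Q = ec_neg P"
proof -
  have sq: "a\<^sup>2 = c \<Longrightarrow> b\<^sup>2 = c \<Longrightarrow> b \<noteq> - a \<Longrightarrow> b = a" for a b c :: 'a by (metis power2_eq_iff)
  show ?thesis using assms by (cases P; cases Q) (auto intro: sq)
qed

lemma ec_x_surj:
  fixes A :: "'a::alg_closed_field"
  shows "\<exists>P\<in>ec_points A B. ec_x P = Fin z"
proof -
  obtain y where "y\<^sup>2 = z ^ 3 + A * z + B" using nth_root_exists[of 2 "z ^ 3 + A * z + B"] by auto
  thus ?thesis by (intro bexI[of _ "Affine z y"]) auto
qed

text \<open>The abscissae x and -x cancel in the addition formula, so the new abscissa is the square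
  of the slope of the chord, which is -(\<iota> / 2) (x + 1 / x) by the curve equation. Hence k =
  -\<iota> / 2.\<close>

lemma ec_x_add_ec_i:
  fixes \<iota> :: "'a::field"
  assumes i: "\<iota> * \<iota> = - 1" and two: "(2::'a) \<noteq> 0" and P: "P \<in> ec_points 1 0" and k: "\<iota> = - 2 * k"
  shows "ec_x (ec_add 1 P (ec_i \<iota> P)) = theta k (ec_x P)"
proof (cases P)
  case (Affine x y)
  have y: "y\<^sup>2 = x ^ 3 + x" using P Affine by simp
  show ?thesis
  proof (cases "x = 0")
    case True
    hence "y = 0" using y by simp
    thus ?thesis using True Affine by simp
  next
    case False
    have xx: "x \<noteq> - x" using False two by (metis add.right_inverse mult_2 mult_eq_0_iff)
    have "ec_x (ec_add 1 P (ec_i \<iota> P)) = Fin (((\<iota> * y - y) / (- x - x))\<^sup>2)"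
      using Affine xx by (simp add: Let_def)
    also have "((\<iota> * y - y) / (- x - x))\<^sup>2 = ((\<iota> - 1)\<^sup>2 * y\<^sup>2) / (2 * x)\<^sup>2"
    proof -
      have e1: "\<iota> * y - y = (\<iota> - 1) * y" and e2: "- x - x = - (2 * x)" by (simp_all add: algebra_simps)
      show ?thesis unfolding e1 e2 by (simp add: power_divide power_mult_distrib)
    qed
    also have "(\<iota> - 1)\<^sup>2 = - 2 * \<iota>" using i by (simp add: power2_eq_square algebra_simps)
    also have "- 2 * \<iota> * y\<^sup>2 / (2 * x)\<^sup>2 = k * (x + inverse x)"
    proof -
      have "(4::'a) = 2 * 2" by simp
      hence "(4::'a) \<noteq> 0" using two by (simp only: mult_eq_0_iff) simp
      thus ?thesis using False unfolding y k by (simp add: field_simps power2_eq_square power3_eq_cube)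
    qed
    finally show ?thesis using Affine False by simp
  qed
qed simp

theorem C2_case:
  fixes k :: "'p::prime_card mod_ring"
  assumes odd: "odd CARD('p)" and n: "n > 0" and k: "k\<^sup>2 + 1 / 4 = 0"
    and rep: "represents_frobenius (Z_adjoin \<i>) (1 :: 'p mod_ring) 0 \<pi>"
    and e0: "e0 = multiplicity 2 (gauss_norm (\<pi> ^ n - 1))"
    and e1: "e1 = multiplicity 2 (gauss_norm (\<pi> ^ n + 1))"
  shows "e0 > 0" "e1 > 0"
    and "(\<And>i. theta (to_ac k) (Fin (z (Suc i))) = Fin (z i)) \<Longrightarrow> z 0 ^ (CARD('p) ^ n) = z 0 \<Longrightarrow>
      \<not> theta_periodic (to_ac k) (Fin (z 1)) \<Longrightarrow>
      \<exists>d0. \<forall>i. (z i ^ (CARD('p) ^ n) = z i \<longrightarrow> i + d0 \<le> max e0 e1) \<and>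
      (\<forall>j\<ge>1. z i ^ (CARD('p) ^ (2 ^ j * n)) = z i \<longleftrightarrow> i + d0 \<le> e0 + e1 + (j - 1) * 2)"
proof -
  have two: "(2 :: 'p mod_ring alg_closure) \<noteq> 0" by (rule two_neq_zero_ac[OF odd])
  have four: "(4 :: 'p mod_ring) \<noteq> 0"
  proof
    assume "(4 :: 'p mod_ring) = 0"
    hence "to_ac (2 * 2 :: 'p mod_ring) = 0" by simp
    thus False using two by (simp only: to_ac_mult to_ac_numeral mult_eq_0_iff) simp
  qed
  define \<iota> where "\<iota> = to_ac (- 2 * k)"
  have "(- 2 * k) * (- 2 * k) = 4 * k\<^sup>2" by (simp add: power2_eq_square)
  also have "k\<^sup>2 = - (1 / 4)" using k by (simp only: eq_neg_iff_add_eq_0)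
  also have "4 * - (1 / 4 :: 'p mod_ring) = - 1" using four by simp
  finally have i: "\<iota> * \<iota> = - 1" unfolding \<iota>_def by (simp flip: to_ac_mult)
  obtain \<Phi> where pi: "\<pi> \<in> carrier (Z_adjoin \<i>)" and iso: "\<Phi> \<in> ring_iso (Z_adjoin \<i>) (ec_End 1 0)"
    and frob: "\<Phi> \<pi> = restrict (frobenius CARD('p)) (ec_points (1 :: 'p mod_ring alg_closure) 0)"
    using rep unfolding represents_frobenius_def by auto
  interpret cm_action \<i> 0 "-1" "1 :: 'p mod_ring alg_closure" 0 \<Phi>
    by unfold_locales (use two iso in auto)
  obtain c where c: "c \<in> R" "\<Phi> c = restrict (ec_i \<iota>) E" using Phi_surj[OF ec_i_endomorphism[OF i two]] by blast
  have "c * c = - 1"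
  proof (rule Phi_ext)
    fix P assume P: "P \<in> E"
    have 1: "\<Phi> (c * c) P = ec_i \<iota> (ec_i \<iota> P)" unfolding Phi_times[OF c(1) c(1) P] using P c(2) ec_i_closed[OF i P] by simp
    have "\<iota> * (\<iota> * y) = - y" for y by (simp only: mult.assoc[symmetric] i mult_minus1)
    hence "ec_i \<iota> (ec_i \<iota> P) = ec_neg P" by (cases P) simp_all
    thus "\<Phi> (c * c) P = \<Phi> (- 1) P" using 1 Phi_uminus[of 1 P] P by simp
  qed (use c in auto)
  hence cc: "c * c = - 1" .
  have cc2: "c * (c * x) = - x" for x by (simp only: mult.assoc[symmetric] cc mult_minus1)
  \<comment> \<open>Nothing decides between the two, and nothing has to: \<open>c\<close> enters
    only through norms and divisibility by \<open>1 + c\<close>, and \<open>1 + \<i>\<close> and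
    \<open>1 - \<i>\<close> are associates.\<close>
  have ci: "c = \<i> \<or> c = - \<i>"
  proof -
    have "(c - \<i>) * (c + \<i>) = 0" using cc by (simp add: algebra_simps)
    thus ?thesis by (simp add: eq_neg_iff_add_eq_0)
  qed
  define \<rho> where "\<rho> = 1 + c"
  have rho: "\<rho> \<in> R" using c by (simp add: \<rho>_def)
  have norm: "\<exists>n::nat. (cmod a)\<^sup>2 = real n" if "a \<in> R" for a using Gauss_norm[OF that] by blast
  have nr: "(cmod \<rho>)\<^sup>2 = 2" using ci by (auto simp: \<rho>_def cmod_power2)
  have repr: "\<exists>u v :: int. a = of_int u + of_int v * c" if a: "a \<in> R" for a
  proof -
    obtain u v :: int where "a = of_int u + of_int v * \<i>" using a unfolding Z_adjoin_mem_iff by blast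
    hence "a = of_int u + of_int v * c \<or> a = of_int u + of_int (- v) * c" using ci by auto
    thus ?thesis by blast
  qed
  \<comment> \<open>The multiples of \<open>1 + c\<close> are the \<open>u + v * c\<close> with
    \<open>u + v\<close> even; evenness is all that is used, both for the two residue classes and
    for the parity of the norm.\<close>
  have even_dvd: "rdvd \<rho> (of_int u + of_int v * c)" if ev: "even (u + v)" for u v :: int
  proof -
    obtain s where s: "u + v = 2 * s" using ev by (elim evenE)
    hence v: "v = 2 * s - u" by simp
    have "of_int u + of_int v * c = \<rho> * (of_int s + of_int (s - u) * c)"
      unfolding v \<rho>_def by (simp add: algebra_simps cc2)
    thus ?thesis using c unfolding rdvd_def by blast
  qed
  have mod: "rdvd \<rho> a \<or> rdvd \<rho> (a - 1)" if a: "a \<in> R" for a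
  proof -
    obtain u v :: int where uv: "a = of_int u + of_int v * c" using repr[OF a] by blast
    show ?thesis
    proof (cases "even (u + v)")
      case True
      thus ?thesis using even_dvd uv by blast
    next
      case False
      hence "even ((u - 1) + v)" by simp
      from even_dvd[OF this] show ?thesis using uv by (simp add: algebra_simps)
    qed
  qed
  have nonunit: "\<not> rdvd \<rho> 1"
  proof
    assume "rdvd \<rho> 1"
    then obtain b where b: "b \<in> R" "1 = \<rho> * b" unfolding rdvd_def by blast
    obtain n' :: nat where n': "(cmod b)\<^sup>2 = real n'" using norm[OF b(1)] by blast
    have "1 = (cmod \<rho>)\<^sup>2 * (cmod b)\<^sup>2" by (metis b(2) norm_mult norm_one one_power2 power_mult_distrib)
    hence "1 = 2 * real n'" using nr n' by simp
    hence "real 1 = real (2 * n')" by simp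
    hence "1 = 2 * n'" by (simp only: of_nat_eq_iff)
    thus False by presburger
  qed
  have kk: "\<iota> = - 2 * to_ac k" by (simp add: \<iota>_def)
  interpret cm_theta \<i> 0 "-1" "1 :: 'p mod_ring alg_closure" 0 \<Phi> \<rho> \<pi> "to_ac k" ec_x "CARD('p)"
  proof
    show "CARD('p) \<ge> 2" using nontriv[where 'a = 'p] by simp
    show "ec_x (\<Phi> \<rho> P) = theta (to_ac k) (ec_x P)" if "P \<in> E" for P
      using that c ec_x_add_ec_i[OF i two that kk] by (simp add: \<rho>_def Phi_plus)
    show "ec_x (\<Phi> \<pi> P) = map_proj_line (\<lambda>z. z ^ CARD('p)) (ec_x P)" if "P \<in> E" for P
      using that by (cases P) (simp_all add: frob)
    show "\<exists>P\<in>E. ec_x P = Fin z" for z by (rule ec_x_surj)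
    show "ec_x P = ec_x Q \<longleftrightarrow> Q = P \<or> Q = ec_neg P" if "P \<in> E" "Q \<in> E" for P Q
      by (rule ec_x_eq_iff[OF that])
  qed (use rho pi mod nonunit in auto)
  have inf: "infinite (UNIV :: 'p mod_ring alg_closure set)" by (rule infinite_UNIV_alg_closed)
  \<comment> \<open>The square of \<open>1 + c\<close> is \<open>2 * c\<close> and \<open>c\<close>
    is a unit, so here \<open>v = 2\<close>.\<close>
  have two_fac: "2 = \<rho> ^ 2 * (- c)" "- c \<in> R" "\<not> rdvd \<rho> (- c)"
  proof -
    show "2 = \<rho> ^ 2 * (- c)" unfolding \<rho>_def power2_eq_square by (simp add: algebra_simps cc cc2)
    show "- c \<in> R" using c by simp
    show "\<not> rdvd \<rho> (- c)" using rdvd_mult[of \<rho> "- c" c] c cc nonunit by auto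
  qed
  \<comment> \<open>A point of order exactly \<open>\<rho> ^ 2\<close>, since \<open>theta\<close>
    leads from \<iota> to 0 and from there to infinity. Frobenius fixes it because \<iota> comes
    from the prime field, so both \<open>e0\<close> and \<open>e1\<close> are at least 2.\<close>
  define S where "S = Affine \<iota> (0 :: 'p mod_ring alg_closure)"
  have S: "S \<in> E" using i by (simp add: S_def power3_eq_cube)
  have "rdvd (\<rho> ^ 2) (\<pi> - 1)"
  proof -
    have "\<Phi> \<pi> S = S" unfolding frob using S to_ac_power_card[of "- 2 * k" 1] by (simp add: S_def \<iota>_def)
    hence 1: "\<Phi> (\<pi> - 1) S = EC_Infinity" using S by (simp add: Phi_diff_eq_infinity)
    have nz: "\<iota> \<noteq> 0" using i by auto
    have "\<iota> + inverse \<iota> = 0" using nz i by (simp add: field_simps)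
    hence th: "theta (to_ac k) (ec_x S) = Fin 0" using nz by (simp add: S_def)
    have "ec_x (\<Phi> (\<rho> ^ 1) S) = Fin 0" "ec_x (\<Phi> (\<rho> ^ Suc 1) S) = Infty"
      unfolding xm_rho_power[OF S] using th by simp_all
    hence 2: "\<Phi> (\<rho> ^ 1) S \<noteq> EC_Infinity" "\<Phi> (\<rho> ^ Suc 1) S = EC_Infinity"
      by (auto elim: ec_x.elims)
    show ?thesis using rho_power_rdvd_of_ann[OF S _ 1 2] by (simp add: numeral_2_eq_2)
  qed
  hence d0: "rdvd (\<rho> ^ 2) (\<pi> ^ n - 1)" by (rule rdvd_power_diff_one)
  have d1: "rdvd (\<rho> ^ 2) (\<pi> ^ n + 1)"
  proof -
    have "rdvd (\<rho> ^ 2) 2" using two_fac unfolding rdvd_def by blast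
    from rdvd_add[OF d0 this] show ?thesis by (simp add: add.commute)
  qed
  obtain E0 m0 where g0: "\<pi> ^ n - 1 = \<rho> ^ E0 * m0" "m0 \<in> R" "\<not> rdvd \<rho> m0"
    by (rule factor_rho[OF norm nr _ pi_power_neq(1)[OF inf n]]) auto
  obtain E1 m1 where g1: "\<pi> ^ n + 1 = \<rho> ^ E1 * m1" "m1 \<in> R" "\<not> rdvd \<rho> m1"
    by (rule factor_rho[OF norm nr _ pi_power_neq(2)[OF inf n]]) auto
  \<comment> \<open>The norm of \<open>\<rho>\<close> is 2, and the cofactor \<open>m\<close> has
    odd norm because its coordinates have an odd sum; so the exponent of 2 in the norm is the
    \<open>\<rho>\<close>-adic valuation.\<close>
  have mult: "multiplicity 2 (gauss_norm (\<rho> ^ e * m)) = e" if m: "m \<in> R" "\<not> rdvd \<rho> m" for e m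
  proof -
    have "real (gauss_norm (\<rho> ^ e * m)) = (cmod (\<rho> ^ e * m))\<^sup>2" using m by (simp add: Gauss_norm)
    also have "\<dots> = ((cmod \<rho>)\<^sup>2) ^ e * (cmod m)\<^sup>2"
      by (simp add: norm_mult norm_power power_mult_distrib flip: power_mult) (simp add: mult.commute)
    also have "\<dots> = real (2 ^ e * gauss_norm m)" using nr m by (simp add: Gauss_norm)
    finally have eq: "gauss_norm (\<rho> ^ e * m) = 2 ^ e * gauss_norm m" by (simp only: of_nat_eq_iff)
    have "odd (gauss_norm m)"
    proof -
      obtain u v :: int where uv: "m = of_int u + of_int v * c" using repr[OF m(1)] by blast
      hence "odd (u + v)" using even_dvd m(2) by blast
      hence "odd (u\<^sup>2 + v\<^sup>2)" by simp
      moreover have "gauss_norm m = nat (u\<^sup>2 + v\<^sup>2)"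
        using ci unfolding uv gauss_norm_def by (elim disjE) simp_all
      ultimately show ?thesis by (simp add: even_nat_iff)
    qed
    thus ?thesis unfolding eq by (intro multiplicity_eqI) auto
  qed
  have E: "e0 = E0" "e1 = E1" using e0 e1 mult g0 g1 by auto
  have ge: "2 \<le> e0" "2 \<le> e1" using power_rdvd_le[OF d0[unfolded g0(1)] g0(3)]
      power_rdvd_le[OF d1[unfolded g1(1)] g1(3)] E by auto
  thus "e0 > 0" "e1 > 0" by auto
  show "\<exists>d0. \<forall>i. (z i ^ (CARD('p) ^ n) = z i \<longrightarrow> i + d0 \<le> max e0 e1) \<and>
      (\<forall>j\<ge>1. z i ^ (CARD('p) ^ (2 ^ j * n)) = z i \<longleftrightarrow> i + d0 \<le> e0 + e1 + (j - 1) * 2)"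
    if "\<And>i. theta (to_ac k) (Fin (z (Suc i))) = Fin (z i)" "z 0 ^ (CARD('p) ^ n) = z 0"
      "\<not> theta_periodic (to_ac k) (Fin (z 1))"
    by (rule theta_preimages_in_field_iff[OF two_fac g0[folded E] g1[folded E] _ n that]) (use ge in auto)
qed

section \<open>Derivatives of rational functions\<close>

lemma eventually_poly_nonzero:
  fixes D :: "'a::field poly"
  assumes "D \<noteq> 0"
  shows "\<forall>\<^sub>F x in cofinite. poly D x \<noteq> 0"
  using poly_roots_finite[OF assms] by (simp add: eventually_cofinite)

lemma poly_eq_0_if_eventually:
  fixes D :: "'a::field poly"
  assumes "infinite (UNIV :: 'a set)" "\<forall>\<^sub>F x in cofinite. poly D x = 0"
  shows "D = 0"
proof (rule ccontr)
  assume "D \<noteq> 0"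
  from eventually_conj[OF eventually_poly_nonzero[OF this] assms(2)]
  have "\<forall>\<^sub>F x :: 'a in cofinite. False" by (rule eventually_mono) simp
  thus False using assms(1) by (simp add: eventually_cofinite)
qed

text \<open>A relation between functions rather than an operation on fractions, since endomorphisms
  are known through their values. Values at finitely many points are ignored; over an infinite field
  the derivative is still determined up to finitely many points, by
  \<open>rat_deriv_unique\<close>.\<close>

definition rat_deriv :: "('a::field \<Rightarrow> 'a) \<Rightarrow> ('a \<Rightarrow> 'a) \<Rightarrow> bool" where
  "rat_deriv g g' \<longleftrightarrow> (\<exists>N D. D \<noteq> 0 \<and> (\<forall>\<^sub>F x in cofinite. g x = poly N x / poly D x \<and>
     g' x = (poly (pderiv N) x * poly D x - poly N x * poly (pderiv D) x) / (poly D x)\<^sup>2))"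

lemma rat_derivI:
  assumes "D \<noteq> 0" "\<forall>\<^sub>F x in cofinite. poly D x \<noteq> 0 \<longrightarrow> g x = poly N x / poly D x \<and>
     g' x = (poly (pderiv N) x * poly D x - poly N x * poly (pderiv D) x) / (poly D x)\<^sup>2"
  shows "rat_deriv g g'"
  unfolding rat_deriv_def
proof (rule exI[of _ N], rule exI[of _ D], rule conjI[OF assms(1)])
  show "\<forall>\<^sub>F x in cofinite. g x = poly N x / poly D x \<and>
     g' x = (poly (pderiv N) x * poly D x - poly N x * poly (pderiv D) x) / (poly D x)\<^sup>2"
    using assms(2) eventually_poly_nonzero[OF assms(1)] by eventually_elim simp
qed

lemma rat_derivE:
  assumes "rat_deriv g g'"
  obtains N D where "D \<noteq> 0" "\<forall>\<^sub>F x in cofinite. poly D x \<noteq> 0 \<and> g x = poly N x / poly D x \<and>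
     g' x = (poly (pderiv N) x * poly D x - poly N x * poly (pderiv D) x) / (poly D x)\<^sup>2"
proof -
  obtain N D where D: "D \<noteq> 0" and ev: "\<forall>\<^sub>F x in cofinite. g x = poly N x / poly D x \<and>
     g' x = (poly (pderiv N) x * poly D x - poly N x * poly (pderiv D) x) / (poly D x)\<^sup>2"
    using assms unfolding rat_deriv_def by blast
  have "\<forall>\<^sub>F x in cofinite. poly D x \<noteq> 0 \<and> g x = poly N x / poly D x \<and>
     g' x = (poly (pderiv N) x * poly D x - poly N x * poly (pderiv D) x) / (poly D x)\<^sup>2"
    using ev eventually_poly_nonzero[OF D] by eventually_elim simp
  thus ?thesis by (rule that[OF D])
qed

lemma rat_deriv_poly: "rat_deriv (poly q) (poly (pderiv q))"
  by (rule rat_derivI[where N = q and D = 1]) (auto simp: pderiv_1)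

lemma rat_deriv_cong:
  assumes "rat_deriv g g'" "\<forall>\<^sub>F x in cofinite. h x = g x \<and> h' x = g' x"
  shows "rat_deriv h h'"
proof -
  obtain N D where D: "D \<noteq> 0" and ev: "\<forall>\<^sub>F x in cofinite. poly D x \<noteq> 0 \<and> g x = poly N x / poly D x \<and>
     g' x = (poly (pderiv N) x * poly D x - poly N x * poly (pderiv D) x) / (poly D x)\<^sup>2"
    by (rule rat_derivE[OF assms(1)])
  show ?thesis
    by (rule rat_derivI[OF D, of _ N]) (use ev assms(2) in \<open>eventually_elim, simp\<close>)
qed

lemma rat_deriv_add:
  assumes "rat_deriv g g'" "rat_deriv h h'"
  shows "rat_deriv (\<lambda>x. g x + h x) (\<lambda>x. g' x + h' x)"
proof -
  obtain N D where D: "D \<noteq> 0" and e1: "\<forall>\<^sub>F x in cofinite. poly D x \<noteq> 0 \<and> g x = poly N x / poly D x \<and>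
     g' x = (poly (pderiv N) x * poly D x - poly N x * poly (pderiv D) x) / (poly D x)\<^sup>2"
    by (rule rat_derivE[OF assms(1)])
  obtain M C where C: "C \<noteq> 0" and e2: "\<forall>\<^sub>F x in cofinite. poly C x \<noteq> 0 \<and> h x = poly M x / poly C x \<and>
     h' x = (poly (pderiv M) x * poly C x - poly M x * poly (pderiv C) x) / (poly C x)\<^sup>2"
    by (rule rat_derivE[OF assms(2)])
  show ?thesis
  proof (rule rat_derivI[where N = "N * C + M * D" and D = "D * C"])
    show "D * C \<noteq> 0" using D C by simp
    show "\<forall>\<^sub>F x in cofinite. poly (D * C) x \<noteq> 0 \<longrightarrow> g x + h x = poly (N * C + M * D) x / poly (D * C) x \<and>
       g' x + h' x = (poly (pderiv (N * C + M * D)) x * poly (D * C) x -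
         poly (N * C + M * D) x * poly (pderiv (D * C)) x) / (poly (D * C) x)\<^sup>2"
      using e1 e2
    proof eventually_elim
      case (elim x)
      from elim have nz: "poly D x \<noteq> 0" "poly C x \<noteq> 0"
        and eqs: "g x = poly N x / poly D x" "h x = poly M x / poly C x"
          "g' x = (poly (pderiv N) x * poly D x - poly N x * poly (pderiv D) x) / (poly D x)\<^sup>2"
          "h' x = (poly (pderiv M) x * poly C x - poly M x * poly (pderiv C) x) / (poly C x)\<^sup>2" by auto
      show ?case unfolding eqs using nz by (simp add: pderiv_add pderiv_mult field_simps power2_eq_square)
    qed
  qed
qed

lemma rat_deriv_mult:
  assumes "rat_deriv g g'" "rat_deriv h h'"
  shows "rat_deriv (\<lambda>x. g x * h x) (\<lambda>x. g' x * h x + g x * h' x)"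
proof -
  obtain N D where D: "D \<noteq> 0" and e1: "\<forall>\<^sub>F x in cofinite. poly D x \<noteq> 0 \<and> g x = poly N x / poly D x \<and>
     g' x = (poly (pderiv N) x * poly D x - poly N x * poly (pderiv D) x) / (poly D x)\<^sup>2"
    by (rule rat_derivE[OF assms(1)])
  obtain M C where C: "C \<noteq> 0" and e2: "\<forall>\<^sub>F x in cofinite. poly C x \<noteq> 0 \<and> h x = poly M x / poly C x \<and>
     h' x = (poly (pderiv M) x * poly C x - poly M x * poly (pderiv C) x) / (poly C x)\<^sup>2"
    by (rule rat_derivE[OF assms(2)])
  show ?thesis
  proof (rule rat_derivI[where N = "N * M" and D = "D * C"])
    show "D * C \<noteq> 0" using D C by simp
    show "\<forall>\<^sub>F x in cofinite. poly (D * C) x \<noteq> 0 \<longrightarrow> g x * h x = poly (N * M) x / poly (D * C) x \<and>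
       g' x * h x + g x * h' x = (poly (pderiv (N * M)) x * poly (D * C) x -
         poly (N * M) x * poly (pderiv (D * C)) x) / (poly (D * C) x)\<^sup>2"
      using e1 e2
    proof eventually_elim
      case (elim x)
      from elim have nz: "poly D x \<noteq> 0" "poly C x \<noteq> 0"
        and eqs: "g x = poly N x / poly D x" "h x = poly M x / poly C x"
          "g' x = (poly (pderiv N) x * poly D x - poly N x * poly (pderiv D) x) / (poly D x)\<^sup>2"
          "h' x = (poly (pderiv M) x * poly C x - poly M x * poly (pderiv C) x) / (poly C x)\<^sup>2" by auto
      show ?case unfolding eqs using nz by (simp add: pderiv_mult field_simps power2_eq_square)
    qed
  qed
qed

lemma rat_deriv_const: "rat_deriv (\<lambda>_. c) (\<lambda>_. 0)"
  by (rule rat_deriv_cong[OF rat_deriv_poly[of "[:c:]"]]) (simp add: pderiv_pCons)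

lemma rat_deriv_ident: "rat_deriv (\<lambda>x. x) (\<lambda>_. 1)"
  by (rule rat_deriv_cong[OF rat_deriv_poly[of "[:0, 1:]"]]) (simp add: pderiv_pCons)

lemma rat_deriv_minus: "rat_deriv g g' \<Longrightarrow> rat_deriv (\<lambda>x. - g x) (\<lambda>x. - g' x)"
  using rat_deriv_mult[OF rat_deriv_const[of "-1"], of g g'] by simp

lemma rat_deriv_diff:
  "rat_deriv g g' \<Longrightarrow> rat_deriv h h' \<Longrightarrow> rat_deriv (\<lambda>x. g x - h x) (\<lambda>x. g' x - h' x)"
  using rat_deriv_add[of g g' "\<lambda>x. - h x" "\<lambda>x. - h' x"] rat_deriv_minus[of h h'] by simp

lemma rat_deriv_zero_or_nonzero:
  assumes "rat_deriv g g'"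
  shows "(\<forall>\<^sub>F x in cofinite. g x = 0) \<or> (\<forall>\<^sub>F x in cofinite. g x \<noteq> 0)"
proof -
  obtain N D where D: "D \<noteq> 0" and ev: "\<forall>\<^sub>F x in cofinite. poly D x \<noteq> 0 \<and> g x = poly N x / poly D x \<and>
     g' x = (poly (pderiv N) x * poly D x - poly N x * poly (pderiv D) x) / (poly D x)\<^sup>2"
    by (rule rat_derivE[OF assms(1)])
  show ?thesis
  proof (cases "N = 0")
    case True
    have "\<forall>\<^sub>F x in cofinite. g x = 0" using ev by eventually_elim (simp add: True)
    thus ?thesis ..
  next
    case False
    have "\<forall>\<^sub>F x in cofinite. g x \<noteq> 0" using ev eventually_poly_nonzero[OF False] by eventually_elim simp
    thus ?thesis ..
  qed
qed

lemma rat_deriv_zero: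
  fixes g :: "'a::field \<Rightarrow> 'a"
  assumes "infinite (UNIV :: 'a set)" "rat_deriv g g'" "\<forall>\<^sub>F x in cofinite. g x = 0"
  shows "\<forall>\<^sub>F x in cofinite. g' x = 0"
proof -
  obtain N D where D: "D \<noteq> 0" and ev: "\<forall>\<^sub>F x in cofinite. poly D x \<noteq> 0 \<and> g x = poly N x / poly D x \<and>
     g' x = (poly (pderiv N) x * poly D x - poly N x * poly (pderiv D) x) / (poly D x)\<^sup>2"
    by (rule rat_derivE[OF assms(2)])
  have "\<forall>\<^sub>F x in cofinite. poly N x = 0" using ev assms(3) by eventually_elim auto
  hence "N = 0" using poly_eq_0_if_eventually[OF assms(1)] by blast
  thus ?thesis using ev by (auto elim: eventually_mono)
qed

lemma rat_deriv_unique: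
  fixes g :: "'a::field \<Rightarrow> 'a"
  assumes "infinite (UNIV :: 'a set)" "rat_deriv g g'" "rat_deriv h h'" "\<forall>\<^sub>F x in cofinite. g x = h x"
  shows "\<forall>\<^sub>F x in cofinite. g' x = h' x"
proof -
  have "\<forall>\<^sub>F x in cofinite. g x - h x = 0" using assms(4) by eventually_elim simp
  from rat_deriv_zero[OF assms(1) rat_deriv_diff[OF assms(2,3)] this] show ?thesis
    by eventually_elim simp
qed

lemma rat_deriv_inverse:
  assumes "rat_deriv g g'" "\<forall>\<^sub>F x in cofinite. g x \<noteq> 0" "infinite (UNIV :: 'a::field set)"
  shows "rat_deriv (\<lambda>x::'a. 1 / g x) (\<lambda>x. - g' x / (g x)\<^sup>2)"
proof -
  obtain N D where D: "D \<noteq> 0" and ev: "\<forall>\<^sub>F x in cofinite. poly D x \<noteq> 0 \<and> g x = poly N x / poly D x \<and>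
     g' x = (poly (pderiv N) x * poly D x - poly N x * poly (pderiv D) x) / (poly D x)\<^sup>2"
    by (rule rat_derivE[OF assms(1)])
  have "N \<noteq> 0"
  proof
    assume N: "N = 0"
    have "\<forall>\<^sub>F x :: 'a in cofinite. False" using ev assms(2) by eventually_elim (simp add: N)
    thus False using assms(3) by (simp add: eventually_cofinite)
  qed
  thus ?thesis
  proof (rule rat_derivI)
    show "\<forall>\<^sub>F x in cofinite. poly N x \<noteq> 0 \<longrightarrow> 1 / g x = poly D x / poly N x \<and>
       - g' x / (g x)\<^sup>2 = (poly (pderiv D) x * poly N x - poly D x * poly (pderiv N) x) / (poly N x)\<^sup>2"
      using ev
    proof eventually_elim
      case (elim x)
      show ?case
      proof
        assume n: "poly N x \<noteq> 0"
        from elim have d: "poly D x \<noteq> 0" and g: "g x = poly N x / poly D x"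
          and g': "g' x = (poly (pderiv N) x * poly D x - poly N x * poly (pderiv D) x) / (poly D x)\<^sup>2" by auto
        show "1 / g x = poly D x / poly N x \<and>
           - g' x / (g x)\<^sup>2 = (poly (pderiv D) x * poly N x - poly D x * poly (pderiv N) x) / (poly N x)\<^sup>2"
          unfolding g g' using n d by (simp add: power_divide mult.commute)
      qed
    qed
  qed
qed

lemma rat_deriv_divide:
  assumes "rat_deriv g g'" "rat_deriv h h'" "\<forall>\<^sub>F x in cofinite. h x \<noteq> 0" "infinite (UNIV :: 'a::field set)"
  shows "rat_deriv (\<lambda>x::'a. g x / h x) (\<lambda>x. (g' x * h x - g x * h' x) / (h x)\<^sup>2)"
proof (rule rat_deriv_cong[OF rat_deriv_mult[OF assms(1) rat_deriv_inverse[OF assms(2,3,4)]]])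
  show "\<forall>\<^sub>F x in cofinite. g x / h x = g x * (1 / h x) \<and>
     (g' x * h x - g x * h' x) / (h x)\<^sup>2 = g' x * (1 / h x) + g x * (- h' x / (h x)\<^sup>2)"
    using assms(3) by eventually_elim (simp add: field_simps power2_eq_square)
qed

text \<open>Only exponents divisible by the characteristic occur, and the coefficients have roots of
  that order in the algebraically closed field, so \<open>N\<close> is the power of a
  polynomial.\<close>

lemma poly_pderiv_0_power:
  fixes N :: "'p::prime_card mod_ring alg_closure poly"
  assumes "pderiv N = 0"
  obtains W where "\<And>x. poly N x = poly W x ^ CARD('p)"
proof -
  let ?p = "CARD('p)"
  have p: "?p > 0" by simp
  have CH: "CHAR('p mod_ring alg_closure) = ?p" by simp
  have z: "Polynomial.coeff N i = 0" if "\<not> ?p dvd i" for i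
  proof (cases i)
    case (Suc j)
    have "Polynomial.coeff (pderiv N) j = 0" using assms by simp
    hence "of_nat (Suc j) * Polynomial.coeff N (Suc j) = 0" by (simp only: coeff_pderiv)
    moreover have "(of_nat (Suc j) :: 'p mod_ring alg_closure) \<noteq> 0"
      using that unfolding Suc of_nat_eq_0_iff_char_dvd CH .
    ultimately show ?thesis unfolding Suc by (simp only: mult_eq_0_iff) blast
  qed (use that in simp)
  have "\<forall>j. \<exists>r. r ^ ?p = Polynomial.coeff N (?p * j)" using nth_root_exists[OF p] by blast
  then obtain r where r: "\<And>j. r j ^ ?p = Polynomial.coeff N (?p * j)" by metis
  define d where "d = Polynomial.degree N"
  define W where "W = (\<Sum>j\<le>d. Polynomial.monom (r j) j)"
  have "poly N x = poly W x ^ ?p" for x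
  proof -
    have "poly W x ^ ?p = (\<Sum>j\<le>d. (r j * x ^ j)) ^ ?p" by (simp add: W_def poly_sum poly_monom)
    also have "\<dots> = (\<Sum>j\<le>d. (r j * x ^ j) ^ ?p)"
      by (rule freshmans_dream_sum) (simp_all add: prime_card)
    also have "\<dots> = (\<Sum>j\<le>d. Polynomial.coeff N (?p * j) * x ^ (?p * j))"
      by (intro sum.cong refl) (simp add: power_mult_distrib r power_mult[symmetric] mult.commute)
    also have "\<dots> = (\<Sum>i\<in>(\<lambda>j. ?p * j) ` {..d}. Polynomial.coeff N i * x ^ i)"
      by (subst sum.reindex) (auto intro!: inj_onI)
    also have "\<dots> = (\<Sum>i\<le>?p * d. Polynomial.coeff N i * x ^ i)"
    proof (rule sum.mono_neutral_left)
      show "\<forall>i\<in>{..?p * d} - (\<lambda>j. ?p * j) ` {..d}. Polynomial.coeff N i * x ^ i = 0"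
      proof
        fix i assume i: "i \<in> {..?p * d} - (\<lambda>j. ?p * j) ` {..d}"
        have "\<not> ?p dvd i"
        proof
          assume "?p dvd i"
          then obtain j where "i = ?p * j" by (elim dvdE)
          thus False using i p by auto
        qed
        thus "Polynomial.coeff N i * x ^ i = 0" using z by simp
      qed
    qed auto
    also have "\<dots> = (\<Sum>i\<le>d. Polynomial.coeff N i * x ^ i)"
    proof (rule sum.mono_neutral_right)
      show "{..d} \<subseteq> {..?p * d}" using p by (auto intro: order.trans)
    qed (auto simp: d_def coeff_eq_0)
    also have "\<dots> = poly N x" by (simp add: poly_altdef d_def)
    finally show ?thesis by simp
  qed
  thus ?thesis by (rule that)
qed

text \<open>With p the characteristic, N / D is rewritten as N D^(p-1) / D^p. As p - 1 = -1 in the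
  field, the derivative of the new numerator is D^(p-2) (N' D - N D') = 0, and
  \<open>poly_pderiv_0_power\<close> applies to it.\<close>

lemma rat_deriv_0_power:
  fixes g :: "'p::prime_card mod_ring alg_closure \<Rightarrow> 'p mod_ring alg_closure"
  assumes "rat_deriv g g'" "\<forall>\<^sub>F x in cofinite. g' x = 0" "odd CARD('p)"
  obtains W D where "D \<noteq> 0" "\<forall>\<^sub>F x in cofinite. g x = (poly W x / poly D x) ^ CARD('p)"
proof -
  let ?p = "CARD('p)"
  obtain N D where D: "D \<noteq> 0" and ev: "\<forall>\<^sub>F x in cofinite. poly D x \<noteq> 0 \<and> g x = poly N x / poly D x \<and>
     g' x = (poly (pderiv N) x * poly D x - poly N x * poly (pderiv D) x) / (poly D x)\<^sup>2"
    by (rule rat_derivE[OF assms(1)])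
  have "\<forall>\<^sub>F x in cofinite. poly (pderiv N * D - N * pderiv D) x = 0"
    using ev assms(2) by eventually_elim auto
  hence ND: "pderiv N * D = N * pderiv D"
    using poly_eq_0_if_eventually[OF infinite_UNIV_alg_closed] by (metis right_minus_eq)
  have "?p > 1" by (rule nontriv)
  hence p2: "?p - 1 = Suc (?p - 2)" using assms(3) by (cases "?p = 2") auto
  have "of_nat (?p - 1) = (- 1 :: 'p mod_ring alg_closure)"
  proof -
    have "of_nat (?p - 1) + (1 :: 'p mod_ring alg_closure) = of_nat (Suc (?p - 1))" by simp
    also have "Suc (?p - 1) = ?p" using \<open>?p > 1\<close> by simp
    also have "of_nat ?p = (0 :: 'p mod_ring alg_closure)"
      by (simp only: of_nat_eq_0_iff_char_dvd CHAR_alg_closure semiring_char_mod_ring dvd_refl)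
    finally show ?thesis by (simp add: eq_neg_iff_add_eq_0)
  qed
  hence m1: "of_nat (Suc (?p - 2)) = (- 1 :: 'p mod_ring alg_closure)" using p2 by simp
  define M where "M = N * D ^ (?p - 1)"
  have "pderiv M = D ^ (?p - 2) * (pderiv N * D - N * pderiv D)"
    unfolding M_def p2 pderiv_mult pderiv_power_Suc m1 by (simp add: algebra_simps)
  hence "pderiv M = 0" using ND by simp
  then obtain W where W: "\<And>x. poly M x = poly W x ^ ?p" using poly_pderiv_0_power by blast
  have "\<forall>\<^sub>F x in cofinite. g x = (poly W x / poly D x) ^ ?p"
    using ev
  proof eventually_elim
    case (elim x)
    have "poly D x ^ ?p = poly D x * poly D x ^ (?p - 1)" using p2 by (metis Suc_diff_1 power_Suc zero_less_card_finite)
    hence "(poly W x / poly D x) ^ ?p = poly N x * poly D x ^ (?p - 1) / (poly D x * poly D x ^ (?p - 1))"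
      by (simp add: power_divide W[symmetric] M_def)
    thus ?case using elim by simp
  qed
  thus ?thesis using that D by blast
qed

section \<open>The action of endomorphisms on the differential\<close>

text \<open>
  For points \<open>(u\<^sub>i, y v\<^sub>i)\<close> depending on the point \<open>(x, y)\<close> with \<open>y\<^sup>2 = F(x)\<close>, \<open>G = F'\<close> and
  \<open>u\<^sub>i' = m\<^sub>i v\<^sub>i\<close>, the left-hand side is the derivative of the abscissa of their sum:
  the multipliers of the differential add up.
\<close>

lemma slope_derivative:
  fixes F G A B :: "'a::field"
  assumes c1: "v1\<^sup>2 * F = u1 ^ 3 + A * u1 + B" and c2: "v2\<^sup>2 * F = u2 ^ 3 + A * u2 + B"
    and d1: "2 * F * v1' = m1 * (3 * u1\<^sup>2 + A) - v1 * G" and d2: "2 * F * v2' = m2 * (3 * u2\<^sup>2 + A) - v2 * G"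
    and ne: "u1 \<noteq> u2" and L: "L = (v2 - v1) / (u2 - u1)"
    and L': "L' = ((v2' - v1') * (u2 - u1) - (v2 - v1) * (m2 * v2 - m1 * v1)) / (u2 - u1)\<^sup>2"
    and u3: "u3 = L\<^sup>2 * F - u1 - u2"
  shows "2 * L * L' * F + L\<^sup>2 * G - m1 * v1 - m2 * v2 = (m1 + m2) * (L * (u1 - u3) - v1)"
proof -
  define \<Delta> where "\<Delta> = u2 - u1"
  have dz: "\<Delta> \<noteq> 0" using ne by (simp add: \<Delta>_def)
  have Ld: "L * \<Delta> = v2 - v1" using dz by (simp add: L \<Delta>_def)
  \<comment> \<open>The difference of the two curve equations divided by
    \<open>u2 - u1\<close>.\<close>
  have chord: "L * F * (v1 + v2) = u1\<^sup>2 + u1 * u2 + u2\<^sup>2 + A"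
  proof -
    have "\<Delta> * (L * F * (v1 + v2)) = (v2 - v1) * (v1 + v2) * F" by (simp add: Ld[symmetric] mult_ac)
    also have "\<dots> = v2\<^sup>2 * F - v1\<^sup>2 * F" by (simp add: algebra_simps power2_eq_square)
    also have "\<dots> = \<Delta> * (u1\<^sup>2 + u1 * u2 + u2\<^sup>2 + A)"
      unfolding c1 c2 \<Delta>_def by (simp add: algebra_simps power2_eq_square power3_eq_cube)
    finally show ?thesis using dz by simp
  qed
  have "L' * \<Delta>\<^sup>2 = (v2' - v1') * \<Delta> - (v2 - v1) * (m2 * v2 - m1 * v1)"
    using dz by (simp add: L' \<Delta>_def)
  hence "\<Delta> * (L' * \<Delta>) = \<Delta> * ((v2' - v1') - L * (m2 * v2 - m1 * v1))"
    unfolding Ld[symmetric] by (simp add: algebra_simps power2_eq_square)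
  hence Ld': "L' * \<Delta> = (v2' - v1') - L * (m2 * v2 - m1 * v1)" using dz by simp
  have "2 * F * L' * \<Delta> = (2 * F * v2' - 2 * F * v1') - 2 * F * L * (m2 * v2 - m1 * v1)"
    using arg_cong[OF Ld', of "\<lambda>t. 2 * F * t"] by (simp add: algebra_simps)
  hence FL: "2 * F * L' * \<Delta> = m2 * (3 * u2\<^sup>2 + A - 2 * F * L * v2) - m1 * (3 * u1\<^sup>2 + A - 2 * F * L * v1) - L * \<Delta> * G"
    unfolding d1 d2 Ld by (simp add: algebra_simps)
  have k2: "3 * u2\<^sup>2 + A - 2 * F * L * v2 = \<Delta> * (u1 + 2 * u2 - L\<^sup>2 * F)"
  proof -
    have "2 * F * L * v2 = L * F * (v1 + v2) + L * F * (L * \<Delta>)" unfolding Ld by (simp add: algebra_simps)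
    thus ?thesis unfolding chord \<Delta>_def by (simp add: algebra_simps power2_eq_square)
  qed
  have k1: "3 * u1\<^sup>2 + A - 2 * F * L * v1 = - (\<Delta> * (2 * u1 + u2 - L\<^sup>2 * F))"
  proof -
    have "2 * F * L * v1 = L * F * (v1 + v2) - L * F * (L * \<Delta>)" unfolding Ld by (simp add: algebra_simps)
    thus ?thesis unfolding chord \<Delta>_def by (simp add: algebra_simps power2_eq_square)
  qed
  have "\<Delta> * (2 * F * L') = \<Delta> * (m2 * (u1 + 2 * u2 - L\<^sup>2 * F) + m1 * (2 * u1 + u2 - L\<^sup>2 * F) - L * G)"
    using FL unfolding k1 k2 by (simp add: algebra_simps)
  hence "2 * F * L' = m2 * (u1 + 2 * u2 - L\<^sup>2 * F) + m1 * (2 * u1 + u2 - L\<^sup>2 * F) - L * G" using dz by simp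
  hence "2 * L * L' * F = L * (m2 * (u1 + 2 * u2 - L\<^sup>2 * F) + m1 * (2 * u1 + u2 - L\<^sup>2 * F) - L * G)"
    by (metis mult.assoc mult.commute)
  moreover have "v2 = v1 + L * (u2 - u1)" using Ld by (simp add: \<Delta>_def)
  ultimately have "2 * L * L' * F + L\<^sup>2 * G - m1 * v1 - m2 * v2 =
      L * (m2 * (u1 + 2 * u2 - L\<^sup>2 * F) + m1 * (2 * u1 + u2 - L\<^sup>2 * F) - L * G) + L\<^sup>2 * G
      - m1 * v1 - m2 * (v1 + L * (u2 - u1))" by (simp only:)
  also have "\<dots> = (m1 + m2) * (L * (u1 - u3) - v1)"
    unfolding u3 by (simp add: algebra_simps power2_eq_square)
  finally show ?thesis .
qed

locale cm_frobenius = cm_action w t d "to_ac A0" "to_ac B0" \<Phi>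
  for w t d and A0 B0 :: "'p::prime_card mod_ring"
    and \<Phi> :: "complex \<Rightarrow> 'p mod_ring alg_closure ec_point \<Rightarrow> 'p mod_ring alg_closure ec_point" +
  fixes \<pi> :: complex
  assumes odd_p: "odd CARD('p)"
    and pi_R [simp]: "\<pi> \<in> R"
    and Phi_pi: "\<Phi> \<pi> = restrict (frobenius CARD('p)) (ec_points (to_ac A0) (to_ac B0))"
begin

abbreviation "A \<equiv> to_ac A0"
abbreviation "B \<equiv> to_ac B0"

definition cubic :: "'p mod_ring alg_closure poly" where "cubic = [:B, A, 0, 1:]"

lemma poly_cubic: "poly cubic x = x ^ 3 + A * x + B"
  by (simp add: cubic_def power3_eq_cube algebra_simps)

lemma cubic_nz: "cubic \<noteq> 0" by (simp add: cubic_def)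

lemma infK: "infinite (UNIV :: 'p mod_ring alg_closure set)" by (rule infinite_UNIV_alg_closed)

lemma cofinite_ex: "\<forall>\<^sub>F x :: 'p mod_ring alg_closure in cofinite. Q x \<Longrightarrow> \<exists>x. Q x"
proof (rule ccontr)
  assume Q: "\<forall>\<^sub>F x :: 'p mod_ring alg_closure in cofinite. Q x" and "\<nexists>x. Q x"
  hence "{x. \<not> Q x} = UNIV" by auto
  thus False using Q infK by (simp add: eventually_cofinite)
qed

text \<open>By definition a nonzero endomorphism has affine values off the zeros of two
  denominators, and these lie over finitely many abscissae. This takes the place of the finiteness
  of kernels.\<close>

lemma nonzero_endo:
  assumes "b \<in> R" "b \<noteq> 0"
  shows "\<forall>\<^sub>F x in cofinite. \<forall>y. y\<^sup>2 = poly cubic x \<longrightarrow> \<Phi> b (Affine x y) \<noteq> EC_Infinity"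
proof -
  have "\<not> (\<forall>P\<in>E. \<Phi> b P = EC_Infinity)" using eq_0_if_kills assms by blast
  hence "ec_rational_map A B (\<Phi> b)" using Phi_endo[OF assms(1)] unfolding ec_endomorphisms_def by blast
  then obtain F1 G1 F2 G2 where fin: "finite {(x, y). Affine x y \<in> E \<and> (poly_xy G1 x y = 0 \<or> poly_xy G2 x y = 0)}"
    and eq: "\<forall>x y. Affine x y \<in> E \<and> poly_xy G1 x y \<noteq> 0 \<and> poly_xy G2 x y \<noteq> 0 \<longrightarrow>
           \<Phi> b (Affine x y) = Affine (poly_xy F1 x y / poly_xy G1 x y) (poly_xy F2 x y / poly_xy G2 x y)"
    unfolding ec_rational_map_def by blast
  have "finite (fst ` {(x, y). Affine x y \<in> E \<and> (poly_xy G1 x y = 0 \<or> poly_xy G2 x y = 0)})" using fin by simp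
  moreover have "{x. \<not> (\<forall>y. y\<^sup>2 = poly cubic x \<longrightarrow> \<Phi> b (Affine x y) \<noteq> EC_Infinity)} \<subseteq>
      fst ` {(x, y). Affine x y \<in> E \<and> (poly_xy G1 x y = 0 \<or> poly_xy G2 x y = 0)}"
  proof
    fix x assume "x \<in> {x. \<not> (\<forall>y. y\<^sup>2 = poly cubic x \<longrightarrow> \<Phi> b (Affine x y) \<noteq> EC_Infinity)}"
    then obtain y where y: "y\<^sup>2 = poly cubic x" "\<Phi> b (Affine x y) = EC_Infinity" by blast
    hence "Affine x y \<in> E" by (simp add: poly_cubic)
    moreover from this have "poly_xy G1 x y = 0 \<or> poly_xy G2 x y = 0" using eq y(2) by force
    ultimately have "(x, y) \<in> {(x, y). Affine x y \<in> E \<and> (poly_xy G1 x y = 0 \<or> poly_xy G2 x y = 0)}" by blast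
    thus "x \<in> fst ` {(x, y). Affine x y \<in> E \<and> (poly_xy G1 x y = 0 \<or> poly_xy G2 x y = 0)}"
      by (metis (no_types, lifting) fst_conv image_eqI)
  qed
  ultimately show ?thesis unfolding eventually_cofinite by (rule rev_finite_subset)
qed

lemma eq_0_if_kills_cofinite:
  assumes "b \<in> R" "\<forall>\<^sub>F x in cofinite. \<forall>y. y\<^sup>2 = poly cubic x \<longrightarrow> \<Phi> b (Affine x y) = EC_Infinity"
  shows "b = 0"
proof (rule ccontr)
  assume "b \<noteq> 0"
  from eventually_conj[OF nonzero_endo[OF assms(1) this] assms(2)]
  obtain x where x: "\<forall>y. y\<^sup>2 = poly cubic x \<longrightarrow> \<Phi> b (Affine x y) \<noteq> EC_Infinity"
    "\<forall>y. y\<^sup>2 = poly cubic x \<longrightarrow> \<Phi> b (Affine x y) = EC_Infinity" using cofinite_ex by blast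
  obtain y where "y\<^sup>2 = poly cubic x" using nth_root_exists[of 2 "poly cubic x"] by auto
  thus False using x by blast
qed

text \<open>
  Since \<open>y V\<close> is the second coordinate of \<open>\<Phi> a (x, y)\<close> and \<open>U' = \<mu> V\<close>, the endomorphism \<open>\<Phi> a\<close> multiplies
  the invariant differential \<open>dx / y\<close> by \<open>\<mu>\<close>.
\<close>

definition scales_differential :: "complex \<Rightarrow> 'p mod_ring alg_closure \<Rightarrow> bool" where
  "scales_differential a \<mu> \<longleftrightarrow> (\<exists>U V U' V'. rat_deriv U U' \<and> rat_deriv V V' \<and>
     (\<forall>\<^sub>F x in cofinite. \<forall>y. y\<^sup>2 = poly cubic x \<longrightarrow> \<Phi> a (Affine x y) = Affine (U x) (y * V x)) \<and>
     (\<forall>\<^sub>F x in cofinite. U' x = \<mu> * V x))"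

text \<open>The equation for \<open>V'\<close> is the derivative of the curve equation satisfied by
  the image, divided by \<open>V x\<close>. If \<open>V\<close> vanished almost everywhere, the
  images would have order 2 and \<open>a + a\<close> would kill almost all points.\<close>

lemma scales_differentialE:
  assumes a: "a \<in> R" "a \<noteq> 0" and rep: "scales_differential a \<mu>"
  obtains U V V' where "rat_deriv U (\<lambda>x. \<mu> * V x)" "rat_deriv V V'"
    "\<forall>\<^sub>F x in cofinite. (\<forall>y. y\<^sup>2 = poly cubic x \<longrightarrow> \<Phi> a (Affine x y) = Affine (U x) (y * V x)) \<and>
      (V x)\<^sup>2 * poly cubic x = U x ^ 3 + A * U x + B \<and> V x \<noteq> 0 \<and> poly cubic x \<noteq> 0 \<and>
      2 * poly cubic x * V' x = \<mu> * (3 * (U x)\<^sup>2 + A) - V x * poly (pderiv cubic) x"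
proof -
  obtain U V U' V' where U0: "rat_deriv U U'" and V: "rat_deriv V V'"
    and pt: "\<forall>\<^sub>F x in cofinite. \<forall>y. y\<^sup>2 = poly cubic x \<longrightarrow> \<Phi> a (Affine x y) = Affine (U x) (y * V x)"
    and U': "\<forall>\<^sub>F x in cofinite. U' x = \<mu> * V x" using rep unfolding scales_differential_def by blast
  have U: "rat_deriv U (\<lambda>x. \<mu> * V x)"
    by (rule rat_deriv_cong[OF U0]) (use U' in \<open>eventually_elim, simp\<close>)
  have curve: "\<forall>\<^sub>F x in cofinite. (V x)\<^sup>2 * poly cubic x = U x ^ 3 + A * U x + B"
    using pt
  proof eventually_elim
    case (elim x)
    obtain y where y: "y\<^sup>2 = poly cubic x" using nth_root_exists[of 2 "poly cubic x"] by auto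
    hence "Affine x y \<in> E" by (simp add: poly_cubic)
    hence "\<Phi> a (Affine x y) \<in> E" using a by simp
    hence "Affine (U x) (y * V x) \<in> E" using elim y by simp
    thus ?case using y by (simp add: power_mult_distrib mult.commute)
  qed
  have Vnz: "\<forall>\<^sub>F x in cofinite. V x \<noteq> 0"
  proof (rule ccontr)
    assume "\<not> ?thesis"
    hence V0: "\<forall>\<^sub>F x in cofinite. V x = 0" using rat_deriv_zero_or_nonzero[OF V] by blast
    have "\<forall>\<^sub>F x in cofinite. \<forall>y. y\<^sup>2 = poly cubic x \<longrightarrow> \<Phi> (a + a) (Affine x y) = EC_Infinity"
      using pt V0
    proof eventually_elim
      case (elim x)
      show ?case
      proof (intro allI impI)
        fix y assume y: "y\<^sup>2 = poly cubic x"
        hence P: "Affine x y \<in> E" by (simp add: poly_cubic)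
        show "\<Phi> (a + a) (Affine x y) = EC_Infinity" unfolding Phi_plus[OF a(1) a(1) P] using elim y by simp
      qed
    qed
    hence "a + a = 0" using eq_0_if_kills_cofinite[of "a + a"] a(1) by blast
    thus False using a(2) by simp
  qed
  note cnz = eventually_poly_nonzero[OF cubic_nz]
  have "rat_deriv (\<lambda>x. (V x * V x) * poly cubic x)
     (\<lambda>x. (V' x * V x + V x * V' x) * poly cubic x + (V x * V x) * poly (pderiv cubic) x)"
    by (intro rat_deriv_mult V rat_deriv_poly)
  moreover have "rat_deriv (\<lambda>x. U x * U x * U x + A * U x + B)
      (\<lambda>x. (\<mu> * V x * U x + U x * (\<mu> * V x)) * U x + U x * U x * (\<mu> * V x) + (0 * U x + A * (\<mu> * V x)) + 0)"
    by (intro rat_deriv_add rat_deriv_mult U rat_deriv_const)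
  moreover have "\<forall>\<^sub>F x in cofinite. (V x * V x) * poly cubic x = U x * U x * U x + A * U x + B"
    using curve by eventually_elim (simp add: power2_eq_square power3_eq_cube)
  ultimately have der: "\<forall>\<^sub>F x in cofinite.
     (V' x * V x + V x * V' x) * poly cubic x + (V x * V x) * poly (pderiv cubic) x =
     (\<mu> * V x * U x + U x * (\<mu> * V x)) * U x + U x * U x * (\<mu> * V x) + (0 * U x + A * (\<mu> * V x)) + 0"
    by (rule rat_deriv_unique[OF infK])
  have "\<forall>\<^sub>F x in cofinite. (\<forall>y. y\<^sup>2 = poly cubic x \<longrightarrow> \<Phi> a (Affine x y) = Affine (U x) (y * V x)) \<and>
      (V x)\<^sup>2 * poly cubic x = U x ^ 3 + A * U x + B \<and> V x \<noteq> 0 \<and> poly cubic x \<noteq> 0 \<and>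
      2 * poly cubic x * V' x = \<mu> * (3 * (U x)\<^sup>2 + A) - V x * poly (pderiv cubic) x"
    using pt curve Vnz cnz der
  proof eventually_elim
    case (elim x)
    have "V x * (2 * poly cubic x * V' x) = V x * (\<mu> * (3 * (U x)\<^sup>2 + A) - V x * poly (pderiv cubic) x)"
      using elim(5) by (simp add: algebra_simps power2_eq_square)
    thus ?case using elim by simp
  qed
  thus ?thesis using that U V by blast
qed

lemma scales_differential_uminus:
  assumes "a \<in> R" "scales_differential a \<mu>"
  shows "scales_differential (- a) (- \<mu>)"
proof -
  obtain U V U' V' where U: "rat_deriv U U'" and V: "rat_deriv V V'"
    and pt: "\<forall>\<^sub>F x in cofinite. \<forall>y. y\<^sup>2 = poly cubic x \<longrightarrow> \<Phi> a (Affine x y) = Affine (U x) (y * V x)"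
    and U': "\<forall>\<^sub>F x in cofinite. U' x = \<mu> * V x" using assms(2) unfolding scales_differential_def by blast
  have "\<forall>\<^sub>F x in cofinite. \<forall>y. y\<^sup>2 = poly cubic x \<longrightarrow> \<Phi> (- a) (Affine x y) = Affine (U x) (y * (- V x))"
    using pt
  proof eventually_elim
    case (elim x)
    show ?case
    proof (intro allI impI)
      fix y assume y: "y\<^sup>2 = poly cubic x"
      hence "Affine x y \<in> E" by (simp add: poly_cubic)
      thus "\<Phi> (- a) (Affine x y) = Affine (U x) (y * (- V x))" using elim y assms(1) by (simp add: Phi_uminus)
    qed
  qed
  moreover have "\<forall>\<^sub>F x in cofinite. U' x = - \<mu> * (- V x)" using U' by eventually_elim simp
  ultimately show ?thesis unfolding scales_differential_def using U rat_deriv_minus[OF V] by blast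
qed

lemma scales_differential_one: "scales_differential 1 1"
proof -
  have "\<forall>\<^sub>F x in cofinite. \<forall>y. y\<^sup>2 = poly cubic x \<longrightarrow> \<Phi> 1 (Affine x y) = Affine x (y * 1)"
    by (rule always_eventually) (simp add: poly_cubic)
  thus ?thesis unfolding scales_differential_def using rat_deriv_ident rat_deriv_const[of 1] by force
qed

text \<open>If the abscissae of the two images agreed almost everywhere,
  \<open>(a + b) * (a - b)\<close> would be 0. With \<open>ab\<close> excluding this, the sum is
  given by the chord for almost all x, and \<open>slope_derivative\<close> computes its multiplier;
  the tangent formula never enters.\<close>

lemma scales_differential_add:
  assumes a: "a \<in> R" "a \<noteq> 0" and b: "b \<in> R" "b \<noteq> 0" and ab: "a \<noteq> b" "a \<noteq> - b"
    and ra: "scales_differential a \<mu>" and rb: "scales_differential b \<nu>"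
  shows "scales_differential (a + b) (\<mu> + \<nu>)"
proof -
  obtain U1 V1 V1' where U1: "rat_deriv U1 (\<lambda>x. \<mu> * V1 x)" and V1: "rat_deriv V1 V1'"
    and e1: "\<forall>\<^sub>F x in cofinite. (\<forall>y. y\<^sup>2 = poly cubic x \<longrightarrow> \<Phi> a (Affine x y) = Affine (U1 x) (y * V1 x)) \<and>
      (V1 x)\<^sup>2 * poly cubic x = U1 x ^ 3 + A * U1 x + B \<and> V1 x \<noteq> 0 \<and> poly cubic x \<noteq> 0 \<and>
      2 * poly cubic x * V1' x = \<mu> * (3 * (U1 x)\<^sup>2 + A) - V1 x * poly (pderiv cubic) x"
    by (rule scales_differentialE[OF a ra])
  obtain U2 V2 V2' where U2: "rat_deriv U2 (\<lambda>x. \<nu> * V2 x)" and V2: "rat_deriv V2 V2'"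
    and e2: "\<forall>\<^sub>F x in cofinite. (\<forall>y. y\<^sup>2 = poly cubic x \<longrightarrow> \<Phi> b (Affine x y) = Affine (U2 x) (y * V2 x)) \<and>
      (V2 x)\<^sup>2 * poly cubic x = U2 x ^ 3 + A * U2 x + B \<and> V2 x \<noteq> 0 \<and> poly cubic x \<noteq> 0 \<and>
      2 * poly cubic x * V2' x = \<nu> * (3 * (U2 x)\<^sup>2 + A) - V2 x * poly (pderiv cubic) x"
    by (rule scales_differentialE[OF b rb])
  note dU = rat_deriv_diff[OF U2 U1]
  have ne: "\<forall>\<^sub>F x in cofinite. U2 x - U1 x \<noteq> 0"
  proof (rule ccontr)
    assume "\<not> ?thesis"
    hence eq: "\<forall>\<^sub>F x in cofinite. U2 x - U1 x = 0" using rat_deriv_zero_or_nonzero[OF dU] by blast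
    have "\<forall>\<^sub>F x in cofinite. \<forall>y. y\<^sup>2 = poly cubic x \<longrightarrow> \<Phi> ((a + b) * (a - b)) (Affine x y) = EC_Infinity"
      using e1 e2 eq
    proof eventually_elim
      case (elim x)
      show ?case
      proof (intro allI impI)
        fix y assume y: "y\<^sup>2 = poly cubic x"
        define P where "P = Affine x y"
        have P: "P \<in> E" using y by (simp add: poly_cubic P_def)
        have pa: "\<Phi> a P = Affine (U1 x) (y * V1 x)" and pb: "\<Phi> b P = Affine (U1 x) (y * V2 x)"
          using elim y by (auto simp: P_def)
        have "(V1 x)\<^sup>2 * poly cubic x = (V2 x)\<^sup>2 * poly cubic x" "poly cubic x \<noteq> 0" using elim by auto
        hence "(V1 x)\<^sup>2 = (V2 x)\<^sup>2" by simp
        hence "V1 x = V2 x \<or> V1 x = - V2 x" by (simp add: power2_eq_iff)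
        hence "\<Phi> a P = \<Phi> b P \<or> \<Phi> a P = ec_neg (\<Phi> b P)" using pa pb by auto
        hence "\<Phi> (a - b) P = EC_Infinity \<or> \<Phi> (a + b) P = EC_Infinity"
          using a b P by (simp add: Phi_diff_eq_infinity Phi_sum_eq_infinity)
        thus "\<Phi> ((a + b) * (a - b)) (Affine x y) = EC_Infinity"
          using ann_mult[of "a + b" "a - b" P] ann_mult[of "a - b" "a + b" P] a b P
          unfolding P_def[symmetric] by (auto simp: mult.commute)
      qed
    qed
    hence "(a + b) * (a - b) = 0" using eq_0_if_kills_cofinite[of "(a + b) * (a - b)"] a b by blast
    thus False using ab by (simp add: eq_neg_iff_add_eq_0)
  qed
  define L where "L x = (V2 x - V1 x) / (U2 x - U1 x)" for x
  define L' where "L' x = ((V2' x - V1' x) * (U2 x - U1 x) - (V2 x - V1 x) * (\<nu> * V2 x - \<mu> * V1 x)) / (U2 x - U1 x)\<^sup>2" for x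
  have dL: "rat_deriv L L'"
    using rat_deriv_divide[OF rat_deriv_diff[OF V2 V1] dU ne infK] unfolding L_def[abs_def] L'_def[abs_def] .
  define U3 where "U3 x = L x * L x * poly cubic x - U1 x - U2 x" for x
  define V3 where "V3 x = L x * (U1 x - U3 x) - V1 x" for x
  define U3' where "U3' x = (L' x * L x + L x * L' x) * poly cubic x + L x * L x * poly (pderiv cubic) x - \<mu> * V1 x - \<nu> * V2 x" for x
  have dU3: "rat_deriv U3 U3'" unfolding U3_def[abs_def] U3'_def[abs_def]
    by (intro rat_deriv_diff rat_deriv_mult dL U1 U2 rat_deriv_poly)
  have dV3: "\<exists>V3'. rat_deriv V3 V3'" unfolding V3_def[abs_def]
    using rat_deriv_diff[OF rat_deriv_mult[OF dL rat_deriv_diff[OF U1 dU3]] V1] by blast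
  have "\<forall>\<^sub>F x in cofinite. \<forall>y. y\<^sup>2 = poly cubic x \<longrightarrow> \<Phi> (a + b) (Affine x y) = Affine (U3 x) (y * V3 x)"
    using e1 e2 ne
  proof eventually_elim
    case (elim x)
    show ?case
    proof (intro allI impI)
      fix y assume y: "y\<^sup>2 = poly cubic x"
      have P: "Affine x y \<in> E" using y by (simp add: poly_cubic)
      have n12: "U1 x \<noteq> U2 x" using elim(3) by auto
      have l: "(y * V2 x - y * V1 x) / (U2 x - U1 x) = y * L x" by (simp add: L_def right_diff_distrib)
      have sq: "(y * L x)\<^sup>2 - U1 x - U2 x = U3 x" using y by (simp add: U3_def power_mult_distrib power2_eq_square mult_ac)
      have "\<Phi> (a + b) (Affine x y) = ec_add A (Affine (U1 x) (y * V1 x)) (Affine (U2 x) (y * V2 x))"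
        using Phi_plus[OF a(1) b(1) P] elim y by simp
      also have "\<dots> = Affine (U3 x) (y * L x * (U1 x - U3 x) - y * V1 x)"
      proof -
        have c: "\<not> (U1 x = U2 x \<and> y * V1 x = - (y * V2 x))" using n12 by simp
        show ?thesis unfolding ec_add.simps if_not_P[OF c] if_not_P[OF n12] Let_def l sq ..
      qed
      also have "\<dots> = Affine (U3 x) (y * V3 x)" by (simp add: V3_def algebra_simps)
      finally show "\<Phi> (a + b) (Affine x y) = Affine (U3 x) (y * V3 x)" .
    qed
  qed
  moreover have "\<forall>\<^sub>F x in cofinite. U3' x = (\<mu> + \<nu>) * V3 x"
    using e1 e2 ne
  proof eventually_elim
    case (elim x)
    have ne: "U1 x \<noteq> U2 x" using elim(3) by auto
    have "2 * L x * L' x * poly cubic x + (L x)\<^sup>2 * poly (pderiv cubic) x - \<mu> * V1 x - \<nu> * V2 x =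
        (\<mu> + \<nu>) * (L x * (U1 x - U3 x) - V1 x)"
      by (rule slope_derivative[OF _ _ _ _ ne L_def L'_def]) (use elim in \<open>auto simp: U3_def power2_eq_square\<close>)
    thus ?case by (simp add: U3'_def V3_def algebra_simps power2_eq_square)
  qed
  ultimately show ?thesis unfolding scales_differential_def using dU3 dV3 by blast
qed

section \<open>Division of an endomorphism by Frobenius\<close>

lemma frobenius_inj:
  assumes "frobenius CARD('p) P = frobenius CARD('p) (Q :: 'p mod_ring alg_closure ec_point)"
  shows "P = Q"
  using assms power_card_inj[where n = 1 and 'p = 'p] by (cases P; cases Q) auto

lemma frobenius_closed_iff:
  "frobenius CARD('p) P \<in> E \<longleftrightarrow> P \<in> E"
proof (cases P)
  case (Affine x y)
  have "(x ^ CARD('p)) ^ 3 + A * x ^ CARD('p) + B = (x ^ 3 + A * x + B) ^ CARD('p)"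
    using power_card_add[where n = 1 and 'p = 'p] to_ac_power_card[where n = 1 and 'p = 'p]
    by (simp add: power_mult_distrib power_mult[symmetric] mult.commute)
  moreover have "(y ^ CARD('p))\<^sup>2 = (y\<^sup>2) ^ CARD('p)" by (simp add: power_mult[symmetric] mult.commute)
  ultimately show ?thesis using power_card_inj[of "y\<^sup>2" 1 "x ^ 3 + A * x + B"] Affine by simp
qed simp

lemma frobenius_surj: "\<exists>P. frobenius CARD('p) P = (Q :: 'p mod_ring alg_closure ec_point)"
proof (cases Q)
  case (Affine x y)
  have p: "CARD('p) > 0" by simp
  obtain x' where "x' ^ CARD('p) = x" using nth_root_exists[OF p, of x] by blast
  moreover obtain y' where "y' ^ CARD('p) = y" using nth_root_exists[OF p, of y] by blast
  ultimately show ?thesis using Affine by (intro exI[of _ "Affine x' y'"]) simp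
qed (auto intro: exI[of _ EC_Infinity])

text \<open>
  If \<open>U' = 0\<close> then \<open>U\<close> is a \<open>p\<close>-th power, and so is \<open>V / F\<^sup>h\<close> with \<open>p = 2 h + 1\<close>; as
  \<open>y V = y\<^sup>p (V / F\<^sup>h)\<close> on the curve, both coordinates of \<open>\<Phi> a\<close> are \<open>p\<close>-th powers.
\<close>

theorem pi_rdvd_if_scales_differential_0:
  assumes a: "a \<in> R" "a \<noteq> 0" and rep: "scales_differential a 0"
  shows "\<pi> rdvd a"
proof -
  let ?p = "CARD('p)"
  obtain U V V' where U: "rat_deriv U (\<lambda>x. 0 * V x)" and V: "rat_deriv V V'"
    and ev: "\<forall>\<^sub>F x in cofinite. (\<forall>y. y\<^sup>2 = poly cubic x \<longrightarrow> \<Phi> a (Affine x y) = Affine (U x) (y * V x)) \<and>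
      (V x)\<^sup>2 * poly cubic x = U x ^ 3 + A * U x + B \<and> V x \<noteq> 0 \<and> poly cubic x \<noteq> 0 \<and>
      2 * poly cubic x * V' x = 0 * (3 * (U x)\<^sup>2 + A) - V x * poly (pderiv cubic) x"
    by (rule scales_differentialE[OF a rep])
  obtain W1 D1 where D1: "D1 \<noteq> 0" and w1: "\<forall>\<^sub>F x in cofinite. U x = (poly W1 x / poly D1 x) ^ ?p"
    by (rule rat_deriv_0_power[OF U _ odd_p]) (simp_all add: always_eventually)
  obtain h where h: "?p = Suc (2 * h)" using odd_p by (auto elim: oddE)
  have h2: "2 * of_nat h = (- 1 :: 'p mod_ring alg_closure)"
  proof -
    have "of_nat ?p = (0 :: 'p mod_ring alg_closure)"
      by (simp only: of_nat_eq_0_iff_char_dvd CHAR_alg_closure semiring_char_mod_ring dvd_refl)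
    moreover have "of_nat ?p = 2 * of_nat h + (1 :: 'p mod_ring alg_closure)"
      unfolding h by (simp add: add.commute)
    ultimately show ?thesis by (simp add: eq_neg_iff_add_eq_0)
  qed
  have "h > 0" using h nontriv[where 'a = 'p] by (cases h) auto
  then obtain h' where h': "h = Suc h'" by (cases h) auto
  have fh: "\<forall>\<^sub>F x in cofinite. poly (cubic ^ h) x \<noteq> 0" using cubic_nz by (intro eventually_poly_nonzero) simp
  define G where "G x = V x / poly (cubic ^ h) x" for x
  define G' where "G' x = (V' x * poly (cubic ^ h) x - V x * poly (pderiv (cubic ^ h)) x) / (poly (cubic ^ h) x)\<^sup>2" for x
  have dG: "rat_deriv G G'" unfolding G_def[abs_def] G'_def[abs_def]
    by (rule rat_deriv_divide[OF V rat_deriv_poly fh infK])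
  have "\<forall>\<^sub>F x in cofinite. G' x = 0"
    using ev
  proof eventually_elim
    case (elim x)
    let ?f = "poly cubic x" and ?g = "poly (pderiv cubic) x"
    \<comment> \<open>For multiplier 0 the derivative relation reads 2 F V' = -V F'. As 2 h = -1 in
      the field, this is F V' = h V F', which makes the numerator of (V / F^h)' vanish.\<close>
    have "2 * (V' x * ?f ^ h - V x * (of_nat h * ?f ^ h' * ?g)) = ?f ^ h' * (2 * ?f * V' x - 2 * of_nat h * V x * ?g)"
      unfolding h' by (simp add: algebra_simps)
    also have "\<dots> = 0" using elim unfolding h2 by simp
    finally have "V' x * ?f ^ h - V x * (of_nat h * ?f ^ h' * ?g) = 0" using two by (simp only: mult_eq_0_iff) simp
    moreover have "poly (pderiv (cubic ^ h)) x = of_nat h * ?f ^ h' * ?g"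
      unfolding h' pderiv_power_Suc by (simp only: poly_smult poly_mult poly_power mult.assoc)
    ultimately show ?case unfolding G'_def by (simp only: poly_power div_0)
  qed
  then obtain W2 D2 where D2: "D2 \<noteq> 0" and w2: "\<forall>\<^sub>F x in cofinite. G x = (poly W2 x / poly D2 x) ^ ?p"
    using rat_deriv_0_power[OF dG _ odd_p] by blast
  have good: "\<forall>\<^sub>F x in cofinite. \<forall>y. y\<^sup>2 = poly cubic x \<longrightarrow>
      \<Phi> a (Affine x y) = frobenius ?p (Affine (poly W1 x / poly D1 x) (y * (poly W2 x / poly D2 x)))"
    using ev w1 w2
  proof eventually_elim
    case (elim x)
    show ?case
    proof (intro allI impI)
      fix y assume y: "y\<^sup>2 = poly cubic x"
      define q where "q = poly W2 x / poly D2 x"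
      have G: "G x = q ^ ?p" using elim(3) by (simp add: q_def)
      have V: "V x = poly cubic x ^ h * G x" using elim(1) by (simp add: G_def)
      have yp: "y ^ ?p = y * y ^ (2 * h)" unfolding h by simp
      have "poly cubic x ^ h = y ^ (2 * h)" by (simp add: y[symmetric] power_mult)
      hence "y * V x = y ^ ?p * q ^ ?p" by (simp only: V G yp mult.assoc)
      hence yV: "y * V x = (y * q) ^ ?p" by (simp only: power_mult_distrib)
      have "\<Phi> a (Affine x y) = Affine (U x) (y * V x)" using elim(1) y by blast
      thus "\<Phi> a (Affine x y) = frobenius ?p (Affine (poly W1 x / poly D1 x) (y * (poly W2 x / poly D2 x)))"
        unfolding frobenius.simps yV elim(2) q_def .
    qed
  qed
  \<comment> \<open>The quotient of \<open>\<Phi> a\<close> by Frobenius as a map on points, which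
    exists because Frobenius is a bijection; that it is a rational map is the content of
    \<open>good\<close>.\<close>
  define \<gamma> where "\<gamma> = (\<lambda>P\<in>E. SOME Q. frobenius ?p Q = \<Phi> a P)"
  have g: "frobenius ?p (\<gamma> P) = \<Phi> a P" if "P \<in> E" for P
    using someI_ex[OF frobenius_surj[of "\<Phi> a P"]] that by (simp add: \<gamma>_def)
  have gE: "\<gamma> P \<in> E" if "P \<in> E" for P
    using frobenius_closed_iff[of "\<gamma> P"] g[OF that] that a(1) by simp
  have frob_add: "frobenius ?p (ec_add A P Q) = ec_add A (frobenius ?p P) (frobenius ?p Q)" if "P \<in> E" "Q \<in> E" for P Q
  proof -
    have "\<Phi> \<pi> (ec_add A P Q) = ec_add A (\<Phi> \<pi> P) (\<Phi> \<pi> Q)"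
      using Phi_endo[OF pi_R] that unfolding ec_endomorphisms_def by blast
    thus ?thesis using that ec_add_closed[OF two that] by (simp add: Phi_pi)
  qed
  have "\<gamma> (ec_add A P Q) = ec_add A (\<gamma> P) (\<gamma> Q)" if "P \<in> E" "Q \<in> E" for P Q
  proof (rule frobenius_inj)
    have "\<Phi> a (ec_add A P Q) = ec_add A (\<Phi> a P) (\<Phi> a Q)"
      using Phi_endo[OF a(1)] that unfolding ec_endomorphisms_def by blast
    thus "frobenius ?p (\<gamma> (ec_add A P Q)) = frobenius ?p (ec_add A (\<gamma> P) (\<gamma> Q))"
      using frob_add[OF gE[OF that(1)] gE[OF that(2)]] g[OF that(1)] g[OF that(2)]
        g[OF ec_add_closed[OF two that]] by simp
  qed
  moreover have "ec_rational_map A B \<gamma>"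
  proof -
    define bad where "bad = {x. \<not> (\<forall>y. y\<^sup>2 = poly cubic x \<longrightarrow>
      \<Phi> a (Affine x y) = frobenius ?p (Affine (poly W1 x / poly D1 x) (y * (poly W2 x / poly D2 x))))}"
    have fin: "finite bad" using good unfolding bad_def eventually_cofinite .
    \<comment> \<open>Multiplying a numerator and its denominator by \<open>M\<close> moves the
      exceptional abscissae into the zeros of the denominators, where nothing is demanded.\<close>
    define M where "M = (\<Prod>c\<in>bad. [:- c, 1:])"
    have M: "poly M x = 0 \<longleftrightarrow> x \<in> bad" for x using fin by (auto simp: M_def poly_prod)
    have M0: "M \<noteq> 0" using fin by (simp add: M_def)
    have xy: "poly_xy [:q:] x y = poly q x" "poly_xy [:0, q:] x y = y * poly q x" for q x and y :: "'p mod_ring alg_closure"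
      by (simp_all add: poly_xy_def)
    show ?thesis unfolding ec_rational_map_def
    proof (rule exI[of _ "[:W1:]"], rule exI[of _ "[:D1:]"], rule exI[of _ "[:0, W2 * M:]"], rule exI[of _ "[:D2 * M:]"],
        intro conjI allI impI)
      let ?S = "{x. poly (D1 * D2 * M) x = 0}"
      have fS: "finite ?S" using D1 D2 M0 by (intro poly_roots_finite) simp
      have "finite (\<Union>x\<in>?S. Pair x ` {y. poly [:- poly cubic x, 0, 1:] y = 0})"
        by (intro finite_UN_I fS finite_imageI poly_roots_finite) simp
      moreover have "{(x, y). Affine x y \<in> E \<and> (poly_xy [:D1:] x y = 0 \<or> poly_xy [:D2 * M:] x y = 0)} \<subseteq>
        (\<Union>x\<in>?S. Pair x ` {y. poly [:- poly cubic x, 0, 1:] y = 0})"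
      proof -
        have "(x, y) \<in> (\<Union>x\<in>?S. Pair x ` {y. poly [:- poly cubic x, 0, 1:] y = 0})"
          if "Affine x y \<in> E" "poly D1 x = 0 \<or> poly (D2 * M) x = 0" for x y
        proof -
          have "x \<in> ?S" using that(2) by auto
          moreover have "poly [:- poly cubic x, 0, 1:] y = 0" using that(1) by (simp add: poly_cubic power2_eq_square)
          ultimately show ?thesis by blast
        qed
        thus ?thesis unfolding xy by blast
      qed
      ultimately show "finite {(x, y). Affine x y \<in> E \<and> (poly_xy [:D1:] x y = 0 \<or> poly_xy [:D2 * M:] x y = 0)}"
        by (rule rev_finite_subset)
      fix x y assume h: "Affine x y \<in> E \<and> poly_xy [:D1:] x y \<noteq> 0 \<and> poly_xy [:D2 * M:] x y \<noteq> 0"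
      hence "x \<notin> bad" "poly M x \<noteq> 0" using M by (auto simp: xy)
      moreover have "y\<^sup>2 = poly cubic x" using h by (simp add: poly_cubic)
      ultimately have "\<Phi> a (Affine x y) = frobenius ?p (Affine (poly W1 x / poly D1 x) (y * (poly W2 x / poly D2 x)))"
        unfolding bad_def by blast
      moreover have "frobenius ?p (\<gamma> (Affine x y)) = \<Phi> a (Affine x y)" by (rule g[OF conjunct1[OF h]])
      ultimately have "frobenius ?p (\<gamma> (Affine x y)) =
          frobenius ?p (Affine (poly W1 x / poly D1 x) (y * (poly W2 x / poly D2 x)))" by (rule trans[rotated])
      hence \<gamma>xy: "\<gamma> (Affine x y) = Affine (poly W1 x / poly D1 x) (y * (poly W2 x / poly D2 x))"
        by (rule frobenius_inj)
      have "y * poly (W2 * M) x / poly (D2 * M) x = y * (poly W2 x / poly D2 x)"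
        using \<open>poly M x \<noteq> 0\<close> by simp
      thus "\<gamma> (Affine x y) = Affine (poly_xy [:W1:] x y / poly_xy [:D1:] x y)
          (poly_xy [:0, W2 * M:] x y / poly_xy [:D2 * M:] x y)"
        unfolding xy \<gamma>xy by (rule arg_cong[OF sym])
    qed
  qed
  moreover have "\<gamma> \<in> E \<rightarrow>\<^sub>E E"
  proof (rule PiE_I)
    show "\<gamma> P \<in> E" if "P \<in> E" for P by (rule gE[OF that])
    show "\<gamma> P = undefined" if "P \<notin> E" for P using that by (simp add: \<gamma>_def)
  qed
  ultimately have "\<gamma> \<in> ec_endomorphisms A B" by (simp add: ec_endomorphisms_def)
  from Phi_surj[OF this] obtain b where b: "b \<in> R" "\<Phi> b = \<gamma>" by (elim bexE)
  have "a = \<pi> * b"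
  proof (rule Phi_ext)
    fix P assume P: "P \<in> E"
    show "\<Phi> a P = \<Phi> (\<pi> * b) P" unfolding Phi_times[OF pi_R b(1) P] b(2) Phi_pi
      using g[OF P] gE[OF P] by simp
  qed (use a b in auto)
  thus ?thesis using b(1) unfolding rdvd_def by blast
qed

end

section \<open>The curve \<open>y\<^sup>2 = x\<^sup>3 - 35 x + 98\<close>\<close>

lemma (in velu_curve) velu_endomorphism: "restrict (velu e b w) (ec_points A B) \<in> ec_endomorphisms A B"
proof -
  let ?E = "ec_points A B" and ?f = "restrict (velu e b w) (ec_points A B)"
  have xy: "poly_xy [:q:] x y = poly q x" "poly_xy [:0, q:] x y = y * poly q x" for q x and y :: 'a
    by (simp_all add: poly_xy_def)
  have px1: "poly [:- e, 1:] x = x - e" for x by simp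
  have px: "poly [:- e, 1:] x = x - e" "poly ([:- e, 1:]\<^sup>2) x = (x - e)\<^sup>2" for x
    by (simp_all only: poly_power px1)
  define q1 q2 where "q1 = [:w\<^sup>2 * b, - (w\<^sup>2 * e), w\<^sup>2:]" "q2 = Polynomial.smult (w ^ 3) ([:- e, 1:]\<^sup>2 - [:b:])"
  have rat: "ec_rational_map A B ?f"
    unfolding ec_rational_map_def
  proof (rule exI[of _ "[:q1:]"], rule exI[of _ "[:[:- e, 1:]:]"], rule exI[of _ "[:0, q2:]"],
      rule exI[of _ "[:[:- e, 1:]\<^sup>2:]"], intro conjI allI impI)
    have "{(x, y). Affine x y \<in> ?E \<and> (poly_xy [:[:- e, 1:]:] x y = 0 \<or> poly_xy [:[:- e, 1:]\<^sup>2:] x y = 0)} \<subseteq> {(e, 0)}"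
      unfolding xy px using root by auto
    thus "finite {(x, y). Affine x y \<in> ?E \<and> (poly_xy [:[:- e, 1:]:] x y = 0 \<or> poly_xy [:[:- e, 1:]\<^sup>2:] x y = 0)}"
      by (rule finite_subset) simp
    fix x y assume h: "Affine x y \<in> ?E \<and> poly_xy [:[:- e, 1:]:] x y \<noteq> 0 \<and> poly_xy [:[:- e, 1:]\<^sup>2:] x y \<noteq> 0"
    hence x: "x - e \<noteq> 0" unfolding xy by auto
    have q1: "poly q1 x = w\<^sup>2 * (x * (x - e) + b)" by (simp add: q1_q2_def algebra_simps power2_eq_square)
    have q2: "poly q2 x = w ^ 3 * ((x - e)\<^sup>2 - b)" by (simp add: q1_q2_def)
    have "?f (Affine x y) = Affine (w\<^sup>2 * (x + b / (x - e))) (w ^ 3 * y * (1 - b / (x - e)\<^sup>2))"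
      using h x by auto
    also have "w\<^sup>2 * (x + b / (x - e)) = poly q1 x / poly [:- e, 1:] x"
      unfolding q1 using x by (simp add: add_divide_distrib distrib_left)
    also have "w ^ 3 * y * (1 - b / (x - e)\<^sup>2) = y * poly q2 x / poly ([:- e, 1:]\<^sup>2) x"
      unfolding q2 using x by (simp add: diff_divide_distrib right_diff_distrib mult_ac)
    finally show "?f (Affine x y) = Affine (poly_xy [:q1:] x y / poly_xy [:[:- e, 1:]:] x y)
       (poly_xy [:0, q2:] x y / poly_xy [:[:- e, 1:]\<^sup>2:] x y)" unfolding xy .
  qed
  have "?f (ec_add A P Q) = ec_add A (?f P) (?f Q)" if "P \<in> ?E" "Q \<in> ?E" for P Q
    using that ec_add_closed[OF two that] velu_add[OF that] by simp
  moreover have "?f \<in> ?E \<rightarrow>\<^sub>E ?E" using velu_closed by auto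
  ultimately show ?thesis using rat by (simp add: ec_endomorphisms_def)
qed

text \<open>
  The Moebius map that conjugates the action of the isogeny on \<open>x\<close>-coordinates to \<open>\<theta>\<^sub>k\<close> with \<open>k = - a / 2\<close>.
  It sends the fixed point \<open>2 a - 1\<close> of that action to \<open>\<infinity>\<close>.
\<close>

fun mob :: "'a::field \<Rightarrow> 'a proj_line \<Rightarrow> 'a proj_line" where
  "mob a Infty = Fin (1 / a)"
| "mob a (Fin x) = (if x = 2 * a - 1 then Infty else Fin ((x - (9 - 4 * a)) / (a * (x - (2 * a - 1)))))"

text \<open>\<open>a\<close> is a root of X^2 - X + 2, the minimal polynomial of
  \<open>alpha\<close>, which has discriminant -7. The discriminant of the curve is -2^12 * 7^3, so
  these characteristics are the ones to avoid.\<close>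

locale alpha_mod =
  fixes a :: "'a::field"
  assumes aa: "a * a = a - 2" and two: "(2::'a) \<noteq> 0" and seven: "(7::'a) \<noteq> 0"
begin

lemma conj: "alpha_mod (1 - a)"
proof
  show "(1 - a) * (1 - a) = 1 - a - 2" using aa by Groebner_Basis.algebra
qed (rule two, rule seven)

lemma a_conj: "a * (1 - a) = 2" using aa by Groebner_Basis.algebra

lemma a_nz: "a \<noteq> 0" "1 - a \<noteq> 0" using a_conj two by auto

text \<open>The points of order 2 lie over \<open>a + 3\<close>, \<open>4 - a\<close> and
  \<open>-7\<close>; the first carries the kernel, and replacing \<open>a\<close> by
  \<open>1 - a\<close> moves the kernel to the second. \<open>wA\<close> and \<open>wB\<close>
  cannot see the sign of \<open>w\<close>, which is chosen so that the differential is multiplied by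
  \<open>1 - a\<close>.\<close>

definition "e = a + 3"
definition "b = 7 * (3 * a - 2)"
definition "w = 1 / (1 - a)"

lemma w_conj: "w * (1 - a) = 1" using a_nz by (simp add: w_def)

lemma w2: "w\<^sup>2 * (- 1 - a) = 1"
proof -
  have "- 1 - a = (1 - a)\<^sup>2" using aa by Groebner_Basis.algebra
  hence "w\<^sup>2 * (- 1 - a) = (w * (1 - a))\<^sup>2" by (simp add: power_mult_distrib)
  thus ?thesis by (simp add: w_conj)
qed

text \<open>The two sides are the pole and the zero of \<open>mob\<close>. They differ by 2 (5 - 3
  a), and (5 - 3 a) (2 + 3 a) = 28.\<close>

lemma s_neq_t: "2 * a - 1 \<noteq> 9 - 4 * a"
proof
  assume h: "2 * a - 1 = 9 - 4 * a"
  have "2 * (3 * a - 5) = 0" using h by Groebner_Basis.algebra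
  hence h3: "3 * a = 5" using two by (simp only: mult_eq_0_iff) simp
  have "(3 * a) * (3 * a) = 3 * (3 * a) - 18" using aa by Groebner_Basis.algebra
  hence "2 * 2 * (7::'a) = 0" unfolding h3 by simp
  thus False using two seven by (simp only: mult_eq_0_iff) simp
qed

lemma e_neq_s: "e \<noteq> 2 * a - 1"
proof
  assume "e = 2 * a - 1"
  hence h: "a = 4" unfolding e_def by Groebner_Basis.algebra
  have "2 * (7::'a) = a * a - (a - 2)" unfolding h by simp
  hence "2 * (7::'a) = 0" using aa by simp
  thus False using two seven by (simp only: mult_eq_0_iff) simp
qed

sublocale velu_curve "-35" 98 e b w
proof
  have w4: "w ^ 4 * (1 - a) ^ 4 = 1" and w6: "w ^ 6 * (1 - a) ^ 6 = 1"
    using w_conj by (simp_all flip: power_mult_distrib)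
  have "-35 - 5 * b = -35 * (1 - a) ^ 4" unfolding b_def using aa by Groebner_Basis.algebra
  hence "w ^ 4 * (-35 - 5 * b) = -35 * (w ^ 4 * (1 - a) ^ 4)" by simp
  thus "w ^ 4 * (-35 - 5 * b) = -35" unfolding w4 by simp
  have "98 - 7 * e * b = 98 * (1 - a) ^ 6" unfolding b_def e_def using aa by Groebner_Basis.algebra
  hence "w ^ 6 * (98 - 7 * e * b) = 98 * (w ^ 6 * (1 - a) ^ 6)" by simp
  thus "w ^ 6 * (98 - 7 * e * b) = 98" unfolding w6 by simp
  show "b = 3 * e\<^sup>2 + -35" unfolding b_def e_def using aa by Groebner_Basis.algebra
  show "e ^ 3 + -35 * e + 98 = 0" unfolding e_def using aa by Groebner_Basis.algebra
  show "\<not> (x ^ 3 + -35 * x + 98 = 0 \<and> 3 * x\<^sup>2 + -35 = 0)" for x :: 'a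
  proof
    assume "x ^ 3 + -35 * x + 98 = 0 \<and> 3 * x\<^sup>2 + -35 = 0"
    hence h: "x ^ 3 + -35 * x + 98 = 0" "3 * x\<^sup>2 + -35 = 0" by blast+
    \<comment> \<open>Euclidean elimination: a common root satisfies 5 x = 21, and then 25 times the
      derivative is 448 = 2^6 * 7.\<close>
    have "2 * 7 * (21 - 5 * x) = 3 * (x ^ 3 + -35 * x + 98) - x * (3 * x\<^sup>2 + -35)" by Groebner_Basis.algebra
    hence "2 * 7 * (21 - 5 * x) = 0" by (simp only: h mult_zero_right diff_zero)
    hence x: "5 * x = 21" using two seven by (simp only: mult_eq_0_iff) simp
    have "25 * (3 * x\<^sup>2 + -35) = 3 * (5 * x) * (5 * x) - 875" by (simp add: algebra_simps power2_eq_square)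
    hence "25 * 0 = 3 * 21 * 21 - (875::'a)" by (simp only: h(2) x)
    moreover have "2 * 2 * 2 * 2 * 2 * 2 * (7::'a) = 3 * 21 * 21 - 875" by simp
    ultimately have "2 * 2 * 2 * 2 * 2 * 2 * (7::'a) = 0" by (simp only: mult_zero_right)
    thus False using two seven by (simp only: mult_eq_0_iff) simp
  qed
  show "(2::'a) \<noteq> 0" by (rule two)
qed

lemma velu_x_diff:
  assumes "x \<noteq> e"
  shows "w\<^sup>2 * (x + b / (x - e)) - c = w\<^sup>2 * (1 / (x - e)) * (x * (x - e) + b + (1 + a) * c * (x - e))"
proof -
  have x: "x - e \<noteq> 0" using assms by simp
  have "w\<^sup>2 * (1 / (x - e)) * (x * (x - e) + b + (1 + a) * c * (x - e)) = w\<^sup>2 * (x + b / (x - e)) - c * (w\<^sup>2 * (- 1 - a))"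
    using x by (simp add: field_simps)
  thus ?thesis unfolding w2 by simp
qed

text \<open>Put s = 2 a - 1, t = 9 - 4 a, d = x - s and n = x - t. The image abscissa V satisfies V
  - s = q d n and V - t = -q (a / 2) (n^2 + a^2 d^2), so the coordinate n / (a d) undergoes exactly
  \<theta> with k = -a / 2. Thus t is the second preimage of the fixed abscissa s, as 0 is the
  second preimage of infinity. The point at infinity and the kernel abscissa go to 1 / a and a, both
  of which \<theta> sends to 1 / a.\<close>

lemma mob_velu:
  "mob a (ec_x (velu e b w P)) = theta (- a / 2) (mob a (ec_x P))"
proof -
  have k1: "- a / 2 * (1 / a + a) = 1 / a"
  proof -
    have "- a * (1 + a * a) = 2" using aa by Groebner_Basis.algebra
    moreover have "- a / 2 * (1 / a + a) = (- a * (1 + a * a)) / (2 * a)"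
      using a_nz two by (simp add: field_simps)
    ultimately show ?thesis using two by simp
  qed
  have thO: "theta (- a / 2) (Fin (1 / a)) = Fin (1 / a)" "theta (- a / 2) (Fin a) = Fin (1 / a)"
    using a_nz k1 by (simp_all add: inverse_eq_divide add.commute)
  show ?thesis
  proof (cases P)
    case EC_Infinity
    thus ?thesis using thO by simp
  next
    case (Affine x y)
    show ?thesis
    proof (cases "x = e")
      case True
      have "5 * a - 6 = a * (a * (4 - a))" using aa by Groebner_Basis.algebra
      moreover have "4 - a \<noteq> 0" using e_neq_s by (auto simp: e_def algebra_simps)
      ultimately have "(5 * a - 6) / (a * (4 - a)) = a" using a_nz by simp
      moreover have "e - (9 - 4 * a) = 5 * a - 6" "e - (2 * a - 1) = 4 - a" by (simp_all add: e_def)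
      ultimately have "mob a (Fin e) = Fin a" using e_neq_s by simp
      thus ?thesis using Affine True thO by simp
    next
      case False
      define V where "V = w\<^sup>2 * (x + b / (x - e))"
      define d n where "d = x - (2 * a - 1)" "n = x - (9 - 4 * a)"
      define q where "q = w\<^sup>2 * (1 / (x - e))"
      have q: "q \<noteq> 0" using False w_conj by (auto simp: q_def)
      have "x * (x - e) + b + (1 + a) * (2 * a - 1) * (x - e) = d * n"
        unfolding e_def b_def d_n_def using aa by Groebner_Basis.algebra
      hence Vs: "V - (2 * a - 1) = q * (d * n)" using velu_x_diff[OF False] by (simp add: V_def q_def)
      have "2 * (x * (x - e) + b + (1 + a) * (9 - 4 * a) * (x - e)) = - a * (n\<^sup>2 + a\<^sup>2 * d\<^sup>2)"
        unfolding e_def b_def d_n_def using aa by Groebner_Basis.algebra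
      hence "x * (x - e) + b + (1 + a) * (9 - 4 * a) * (x - e) = - a / 2 * (n\<^sup>2 + a\<^sup>2 * d\<^sup>2)"
        using two by (simp add: field_simps)
      hence Vt: "V - (9 - 4 * a) = q * (- a / 2 * (n\<^sup>2 + a\<^sup>2 * d\<^sup>2))"
        using velu_x_diff[OF False] by (simp add: V_def q_def)
      have vP: "ec_x (velu e b w P) = Fin V" using Affine False by (simp add: V_def)
      consider "d = 0" | "d \<noteq> 0" "n = 0" | "d \<noteq> 0" "n \<noteq> 0" by blast
      thus ?thesis
      proof cases
        case 1
        hence "x = 2 * a - 1" "V = 2 * a - 1" using Vs by (auto simp: d_n_def)
        thus ?thesis using vP Affine by simp
      next
        case 2
        hence "V = 2 * a - 1" using Vs by simp
        hence "mob a (Fin V) = Infty" by simp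
        moreover have "mob a (Fin x) = Fin 0" using 2 by (simp add: d_n_def)
        ultimately show ?thesis using vP Affine by simp
      next
        case 3
        hence Vne: "V \<noteq> 2 * a - 1" using Vs q by auto
        have z: "mob a (Fin x) = Fin (n / (a * d))" using 3 by (simp add: d_n_def)
        have "mob a (Fin V) = Fin ((q * (- a / 2 * (n\<^sup>2 + a\<^sup>2 * d\<^sup>2))) / (a * (q * (d * n))))"
          using Vne Vs Vt by simp
        also have "(q * (- a / 2 * (n\<^sup>2 + a\<^sup>2 * d\<^sup>2))) / (a * (q * (d * n))) = - a / 2 * (n / (a * d) + inverse (n / (a * d)))"
          using 3 q a_nz two by (simp add: field_simps power2_eq_square)
        finally show ?thesis using vP Affine z 3 a_nz by simp
      qed
    qed
  qed
qed

lemma mob_inj: "mob a x = mob a y \<Longrightarrow> x = y"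
proof -
  have 1: False if "1 / a = (x - (9 - 4 * a)) / (a * (x - (2 * a - 1)))" "x \<noteq> 2 * a - 1" for x
  proof -
    have "x - (2 * a - 1) \<noteq> 0" using that(2) by simp
    hence "x - (2 * a - 1) = x - (9 - 4 * a)" using that(1) a_nz by (simp add: divide_eq_eq eq_divide_eq)
    hence "2 * a - 1 = 9 - 4 * a" by (rule diff_left_imp_eq)
    thus False using s_neq_t by simp
  qed
  have n1: False if "(x - (9 - 4 * a)) / (a * (x - (2 * a - 1))) = 1 / a" "x \<noteq> 2 * a - 1" for x
    using 1[OF that(1)[symmetric] that(2)] .
  have 2: "x = y" if "(x - (9 - 4 * a)) / (a * (x - (2 * a - 1))) = (y - (9 - 4 * a)) / (a * (y - (2 * a - 1)))"
    "x \<noteq> 2 * a - 1" "y \<noteq> 2 * a - 1" for x y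
  proof -
    have nz: "x - (2 * a - 1) \<noteq> 0" "y - (2 * a - 1) \<noteq> 0" using that(2,3) by auto
    hence "(x - (9 - 4 * a)) * (y - (2 * a - 1)) = (y - (9 - 4 * a)) * (x - (2 * a - 1))"
      using that(1) a_nz by (simp add: divide_eq_eq eq_divide_eq mult_ac)
    hence "(x - y) * ((9 - 4 * a) - (2 * a - 1)) = 0" by Groebner_Basis.algebra
    moreover have "(9 - 4 * a) - (2 * a - 1) \<noteq> 0" using s_neq_t by (metis right_minus_eq)
    ultimately show ?thesis by (simp only: mult_eq_0_iff) simp
  qed
  assume "mob a x = mob a y"
  thus ?thesis by (cases x; cases y) (auto split: if_splits intro: 2 dest: 1 n1)
qed

lemma mob_surj: "\<exists>x. mob a x = Fin z"
proof (cases "a * z = 1")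
  case True
  hence "z = 1 / a" using a_nz by (simp add: field_simps)
  thus ?thesis by (intro exI[of _ Infty]) simp
next
  case False
  define x where "x = ((9 - 4 * a) - a * z * (2 * a - 1)) / (1 - a * z)"
  have nz: "1 - a * z \<noteq> 0" using False by simp
  have x: "x * (1 - a * z) = (9 - 4 * a) - a * z * (2 * a - 1)" using nz by (simp add: x_def)
  have xs: "x \<noteq> 2 * a - 1"
  proof
    assume "x = 2 * a - 1"
    hence "(2 * a - 1) * (1 - a * z) = (9 - 4 * a) - a * z * (2 * a - 1)" using x by simp
    hence "2 * a - 1 = 9 - 4 * a" by Groebner_Basis.algebra
    thus False using s_neq_t by simp
  qed
  have "x - (9 - 4 * a) = z * (a * (x - (2 * a - 1)))" using x by (simp add: algebra_simps)
  hence "(x - (9 - 4 * a)) / (a * (x - (2 * a - 1))) = z" using a_nz xs by simp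
  thus ?thesis using xs by (intro exI[of _ "Fin x"]) simp
qed

lemma curve_factor: "x ^ 3 + -35 * x + 98 = (x - e) * (x - (4 - a)) * (x + 7)"
  unfolding e_def using aa by Groebner_Basis.algebra

text \<open>The isogeny sends the points over \<open>4 - a\<close> and \<open>-7\<close> to the
  kernel point of the conjugate isogeny, so the composite kills every point of order 2, as doubling
  does. The two are compared on abscissae only, hence up to sign.\<close>

lemma velu_conj_velu:
  assumes P: "P \<in> ec_points (-35) 98"
  shows "ec_x (velu (alpha_mod.e (1 - a)) (alpha_mod.b (1 - a)) (alpha_mod.w (1 - a)) (velu e b w P))
     = ec_x (ec_add (-35) P P)"
proof -
  interpret c: alpha_mod "1 - a" by (rule conj)
  have ce: "c.e = 4 - a" by (simp add: c.e_def)
  show ?thesis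
  proof (cases P)
    case EC_Infinity
    thus ?thesis by simp
  next
    case (Affine x y)
    have y: "y\<^sup>2 = (x - e) * (x - (4 - a)) * (x + 7)" using P Affine by (simp flip: curve_factor)
    show ?thesis
    proof (cases "x = e")
      case True
      hence "y = 0" using y by simp
      thus ?thesis using True Affine by simp
    next
      case False
      define V where "V = w\<^sup>2 * (x + b / (x - e))"
      define q where "q = w\<^sup>2 * (1 / (x - e))"
      have q: "q \<noteq> 0" using False w_conj by (auto simp: q_def)
      have "x * (x - e) + b + (1 + a) * (4 - a) * (x - e) = (x - (4 - a)) * (x + 7)"
        unfolding e_def b_def using aa by Groebner_Basis.algebra
      hence Ve: "V - c.e = q * ((x - (4 - a)) * (x + 7))" using velu_x_diff[OF False] by (simp add: V_def q_def ce)
      have vP: "velu e b w P = Affine V (w ^ 3 * y * (1 - b / (x - e)\<^sup>2))" using Affine False by (simp add: V_def)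
      show ?thesis
      proof (cases "y = 0")
        case True
        hence "(x - (4 - a)) * (x + 7) = 0" using y False by auto
        hence "V - c.e = 0" unfolding Ve by (simp only: mult_zero_right)
        hence "V = c.e" by simp
        thus ?thesis using vP True Affine by simp
      next
        case y0: False
        have nz: "x - e \<noteq> 0" "x - (4 - a) \<noteq> 0" "x + 7 \<noteq> 0" using y y0 by auto
        hence Vne: "V \<noteq> c.e" using Ve q by auto
        have yy: "y \<noteq> - y" using y0 two by (metis add.right_inverse mult_2 mult_eq_0_iff)
        have "ec_x (ec_add (-35) P P) = Fin (((3 * x\<^sup>2 + -35) / (2 * y))\<^sup>2 - x - x)"
          using Affine yy by (simp add: Let_def)
        also have "((3 * x\<^sup>2 + -35) / (2 * y))\<^sup>2 - x - x = ((3 * x\<^sup>2 - 35)\<^sup>2 - 8 * x * y\<^sup>2) / (4 * y\<^sup>2)"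
        proof -
          have "(4::'a) = 2 * 2" by simp
          hence "(4::'a) \<noteq> 0" using two by (simp only: mult_eq_0_iff) simp
          hence "8 * x * y\<^sup>2 / (4 * y\<^sup>2) = x + x" using y0 by (simp add: field_simps)
          moreover have "((3 * x\<^sup>2 + -35) / (2 * y))\<^sup>2 = (3 * x\<^sup>2 - 35)\<^sup>2 / (4 * y\<^sup>2)"
            by (simp only: power_divide power_mult_distrib) simp
          ultimately show ?thesis by (simp only: diff_divide_distrib diff_diff_eq)
        qed
        finally have R: "ec_x (ec_add (-35) P P) = Fin (((3 * x\<^sup>2 - 35)\<^sup>2 - 8 * x * y\<^sup>2) / (4 * y\<^sup>2))" .
        have cw2: "c.w\<^sup>2 * a\<^sup>2 = 1" using c.w_conj by (simp flip: power_mult_distrib)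
        have W: "w\<^sup>2 = a\<^sup>2 / 4" "c.w\<^sup>2 = (- 1 - a) / 4"
        proof -
          have f: "(4::'a) = 2 * 2" by simp
          hence f0: "(4::'a) \<noteq> 0" using two by (simp only: mult_eq_0_iff) simp
          have 4: "a\<^sup>2 * (- 1 - a) = 4" using aa by Groebner_Basis.algebra
          have "w\<^sup>2 * 4 = a\<^sup>2 * (w\<^sup>2 * (- 1 - a))" unfolding 4[symmetric] by (simp only: mult_ac)
          thus "w\<^sup>2 = a\<^sup>2 / 4" unfolding w2 using f0 by (simp add: eq_divide_eq)
          have "c.w\<^sup>2 * 4 = (c.w\<^sup>2 * a\<^sup>2) * (- 1 - a)" unfolding 4[symmetric] by (simp only: mult_ac)
          thus "c.w\<^sup>2 = (- 1 - a) / 4" unfolding cw2 using f0 by (simp add: eq_divide_eq)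
        qed
        have "ec_x (velu c.e c.b c.w (velu e b w P)) = Fin (c.w\<^sup>2 * (V + c.b / (V - c.e)))"
          using vP Vne by simp
        also have "c.w\<^sup>2 * (V + c.b / (V - c.e)) = ((3 * x\<^sup>2 - 35)\<^sup>2 - 8 * x * y\<^sup>2) / (4 * y\<^sup>2)"
        proof -
          have f: "(4::'a) = 2 * 2" by simp
          hence f0: "(4::'a) \<noteq> 0" using two by (simp only: mult_eq_0_iff) simp
          have qe: "q * (x - e) = w\<^sup>2" using nz by (simp add: q_def)
          have Vq: "V = q * (x * (x - e) + b)" using nz by (simp add: V_def q_def field_simps)
          have qi: "c.b / (V - c.e) = c.b * (- 1 - a) * (x - e) / ((x - (4 - a)) * (x + 7))"
          proof -
            have "q * ((- 1 - a) * (x - e)) = w\<^sup>2 * (- 1 - a)" unfolding qe[symmetric] by (simp only: mult_ac)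
            hence "1 / q = (- 1 - a) * (x - e)" unfolding w2 using q by (simp add: divide_eq_eq mult.commute)
            moreover have "c.b / (V - c.e) = c.b * (1 / q) / ((x - (4 - a)) * (x + 7))" unfolding Ve by simp
            ultimately show ?thesis by (simp add: mult.assoc)
          qed
          \<comment> \<open>Over the common denominator 4 y^2 this equates the numerator of the
            composite with that of the duplication formula.\<close>
          have main: "(x * (x - e) + b) * ((x - (4 - a)) * (x + 7)) + c.b * (3 * a - 1) * (x - e)\<^sup>2
             = (3 * x\<^sup>2 - 35)\<^sup>2 - 8 * x * ((x - e) * (x - (4 - a)) * (x + 7))"
            unfolding e_def b_def c.b_def using aa by Groebner_Basis.algebra
          have q4: "c.w\<^sup>2 * q = 1 / (4 * (x - e))"
          proof -
            have "c.w\<^sup>2 * q = (c.w\<^sup>2 * w\<^sup>2) / (x - e)" by (simp add: q_def)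
            also have "c.w\<^sup>2 * w\<^sup>2 = 1 / 4" unfolding W(1) using cw2 by simp
            finally show ?thesis by simp
          qed
          have cw3: "c.w\<^sup>2 * (- 1 - a) = (3 * a - 1) / 4"
          proof -
            have "(- 1 - a) * (- 1 - a) = 3 * a - 1" using aa by Groebner_Basis.algebra
            thus ?thesis unfolding W(2) by simp
          qed
          have "c.w\<^sup>2 * (V + c.b / (V - c.e)) = (c.w\<^sup>2 * q) * (x * (x - e) + b)
              + (c.w\<^sup>2 * (- 1 - a)) * (c.b * (x - e) / ((x - (4 - a)) * (x + 7)))"
            unfolding qi unfolding Vq by (simp add: distrib_left mult_ac)
          also have "\<dots> = ((x * (x - e) + b) * ((x - (4 - a)) * (x + 7)) + c.b * (3 * a - 1) * (x - e)\<^sup>2)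
              / (4 * ((x - e) * (x - (4 - a)) * (x + 7)))"
          proof -
            have "1 / (4 * D) * N + m / 4 * (c.b * D / (D2 * D3)) = (N * (D2 * D3) + c.b * m * D\<^sup>2) / (4 * (D * D2 * D3))"
              if "D \<noteq> 0" "D2 \<noteq> 0" "D3 \<noteq> 0" for D D2 D3 N m :: 'a
              using that f0 by (simp add: field_simps power2_eq_square)
            thus ?thesis unfolding q4 cw3 using nz by blast
          qed
          finally show ?thesis unfolding main y .
        qed
        finally show ?thesis using R by simp
      qed
    qed
  qed
qed

text \<open>Over the fixed abscissa \<open>2 * a - 1\<close> the isogeny acts as plus or minus the
  identity; the sign is minus. So \<open>c + 1\<close> kills this point for the ring element
  \<open>c\<close> of the isogeny. The signs to be excluded for \<open>c\<close> are those for which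
  \<open>c + 1\<close> divides 2, and they would give the point order 2, whereas its ordinate is not
  0.\<close>

lemma velu_P4:
  assumes "y\<^sup>2 = (2 * a - 1) ^ 3 + -35 * (2 * a - 1) + 98"
  shows "velu e b w (Affine (2 * a - 1) y) = Affine (2 * a - 1) (- y)" "y \<noteq> 0"
proof -
  let ?s = "2 * a - 1"
  have ne: "?s \<noteq> e" using e_neq_s by simp
  have se: "?s - e = a - 4" by (simp add: e_def)
  have nz: "a - 4 \<noteq> 0" using ne unfolding se[symmetric] by simp
  have 1: "w\<^sup>2 * (?s + b / (?s - e)) = ?s"
  proof -
    have "?s * (?s - e) + b + (1 + a) * ?s * (?s - e) = 0" unfolding e_def b_def using aa by Groebner_Basis.algebra
    hence "w\<^sup>2 * (?s + b / (?s - e)) - ?s = 0" using velu_x_diff[OF ne, of ?s] by simp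
    thus ?thesis by simp
  qed
  have 2: "w ^ 3 * (1 - b / (?s - e)\<^sup>2) = - 1"
  proof -
    have "(a - 4)\<^sup>2 - b = - ((1 - a) ^ 3 * (a - 4)\<^sup>2)" unfolding b_def e_def using aa by Groebner_Basis.algebra
    hence "1 - b / (a - 4)\<^sup>2 = - ((1 - a) ^ 3)" using nz by (simp add: field_simps)
    hence "w ^ 3 * (1 - b / (?s - e)\<^sup>2) = - ((w * (1 - a)) ^ 3)" unfolding se by (simp add: power_mult_distrib)
    thus ?thesis by (simp add: w_conj)
  qed
  have "w ^ 3 * y * (1 - b / (?s - e)\<^sup>2) = (w ^ 3 * (1 - b / (?s - e)\<^sup>2)) * y" by simp
  hence "w ^ 3 * y * (1 - b / (?s - e)\<^sup>2) = - y" unfolding 2 by simp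
  thus "velu e b w (Affine ?s y) = Affine ?s (- y)" using ne 1 by simp
  show "y \<noteq> 0"
  proof
    assume "y = 0"
    hence h: "?s ^ 3 + -35 * ?s + 98 = 0" using assms by simp
    have "(?s ^ 3 + -35 * ?s + 98) = 2 * 2 * 7 * (5 - 3 * a)" using aa by Groebner_Basis.algebra
    hence "2 * 2 * 7 * (5 - 3 * a) = 0" using h by (rule trans[OF sym])
    hence "3 * a = 5" using two seven by (simp only: mult_eq_0_iff) simp
    hence "2 * (3 * a) = 2 * 5" by simp
    hence "2 * a - 1 = 9 - 4 * a" by Groebner_Basis.algebra
    thus False using s_neq_t by simp
  qed
qed

end

section \<open>The norm form u^2 + u v + 2 v^2 and its small values\<close>

lemma alpha_square: "alpha * alpha = alpha - 2"
  by (simp add: alpha_def complex_eq_iff algebra_simps)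

lemma cnj_alpha: "cnj alpha = 1 - alpha"
  by (simp add: alpha_def complex_eq_iff)

lemma Im_alpha: "Im alpha > 0"
  by (simp add: alpha_def)

lemma alpha_norm: "(cmod (of_int u + of_int v * alpha))\<^sup>2 = of_int (u\<^sup>2 + u * v + 2 * v\<^sup>2)"
proof -
  have "Re (of_int u + of_int v * alpha) = of_int u + of_int v / 2"
    "Im (of_int u + of_int v * alpha) = of_int v * sqrt 7 / 2" by (simp_all add: alpha_def)
  hence "(cmod (of_int u + of_int v * alpha))\<^sup>2 = (of_int u + of_int v / 2)\<^sup>2 + (of_int v * sqrt 7 / 2)\<^sup>2"
    by (simp only: cmod_power2)
  also have "(of_int v * sqrt 7 / 2)\<^sup>2 = 7 * (of_int v)\<^sup>2 / 4"
    by (simp add: power_divide power_mult_distrib)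
  also have "(x + y / 2)\<^sup>2 + 7 * y\<^sup>2 / 4 = x\<^sup>2 + x * y + 2 * y\<^sup>2" for x y :: real
    by (simp add: power2_eq_square algebra_simps)
  finally show ?thesis by simp
qed

lemma alpha_norm_nonneg: "u\<^sup>2 + u * v + 2 * v\<^sup>2 \<ge> (0::int)"
proof -
  have "4 * (u\<^sup>2 + u * v + 2 * v\<^sup>2) = (2 * u + v)\<^sup>2 + 7 * v\<^sup>2" by (simp add: power2_eq_square algebra_simps)
  hence "0 \<le> 4 * (u\<^sup>2 + u * v + 2 * v\<^sup>2)" by (simp only:) simp
  thus ?thesis by (simp only: zero_le_mult_iff) simp
qed

lemma alpha_norm_small:
  assumes "u\<^sup>2 + u * v + 2 * v\<^sup>2 = (m::int)" "m \<le> 2"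
  shows "v = 0 \<or> v = 1 \<or> v = - 1"
proof (rule ccontr)
  assume "\<not> ?thesis"
  hence "\<bar>v\<bar> \<ge> 2" by auto
  hence "2\<^sup>2 \<le> \<bar>v\<bar>\<^sup>2" by (intro power_mono) auto
  hence "4 \<le> v\<^sup>2" by simp
  moreover have "4 * m = (2 * u + v)\<^sup>2 + 7 * v\<^sup>2" unfolding assms(1)[symmetric] by (simp add: power2_eq_square algebra_simps)
  moreover have "(2 * u + v)\<^sup>2 \<ge> 0" by simp
  ultimately show False using assms(2) by linarith
qed

lemma alpha_norm_1:
  assumes "u\<^sup>2 + u * v + 2 * v\<^sup>2 = (1::int)"
  shows "v = 0 \<and> (u = 1 \<or> u = - 1)"
proof -
  have *: "4 * 1 = (2 * u + v)\<^sup>2 + 7 * v\<^sup>2" unfolding assms[symmetric] by (simp add: power2_eq_square algebra_simps)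
  have "v = 0"
  proof (rule ccontr)
    assume "v \<noteq> 0"
    hence "v\<^sup>2 = 1" using alpha_norm_small[OF assms] by auto
    moreover have "(2 * u + v)\<^sup>2 \<ge> 0" by simp
    ultimately show False using * by linarith
  qed
  thus ?thesis using assms by (simp add: power2_eq_1_iff)
qed

lemma alpha_norm_2:
  assumes "u\<^sup>2 + u * v + 2 * v\<^sup>2 = (2::int)"
  shows "(v = 1 \<and> (u = 0 \<or> u = - 1)) \<or> (v = - 1 \<and> (u = 0 \<or> u = 1))"
proof -
  have "v \<noteq> 0"
  proof
    assume "v = 0"
    hence u: "u\<^sup>2 = 2" using assms by simp
    have "\<bar>u\<bar> \<noteq> 0" "\<bar>u\<bar> \<noteq> 1" using u by (auto simp: abs_if split: if_splits)
    hence "\<bar>u\<bar> \<ge> 2" by linarith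
    hence "2\<^sup>2 \<le> \<bar>u\<bar>\<^sup>2" by (intro power_mono) auto
    thus False using u by simp
  qed
  then consider "v = 1" | "v = - 1" using alpha_norm_small[OF assms] by auto
  thus ?thesis
  proof cases
    case 1
    hence "u * (u + 1) = 0" using assms by (simp add: power2_eq_square algebra_simps)
    thus ?thesis using 1 by auto
  next
    case 2
    hence "u * (u - 1) = 0" using assms by (simp add: power2_eq_square algebra_simps)
    thus ?thesis using 2 by auto
  qed
qed

text \<open>\<open>f\<close> stands for Frobenius: the coefficients of \<open>mob\<close> are fixed
  by it, so the change of coordinate respects the fields of definition.\<close>

lemma (in alpha_mod) mob_power_card:
  fixes f :: "'a \<Rightarrow> 'a"
  assumes f: "\<And>x y. f (x - y) = f x - f y" "\<And>x y. f (x * y) = f x * f y" "\<And>x y. f (x / y) = f x / f y"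
    "\<And>x y. f x = f y \<Longrightarrow> x = y" "f a = a" "f 1 = 1" "f (2 * a - 1) = 2 * a - 1" "f (9 - 4 * a) = 9 - 4 * a"
  shows "mob a (map_proj_line f x) = map_proj_line f (mob a x)"
proof (cases x)
  case (Fin z)
  have "f z = 2 * a - 1 \<longleftrightarrow> z = 2 * a - 1" using f(4)[of z "2 * a - 1"] f(7) by auto
  moreover have "f ((z - (9 - 4 * a)) / (a * (z - (2 * a - 1)))) = (f z - (9 - 4 * a)) / (a * (f z - (2 * a - 1)))"
    by (simp only: f(3) f(2)[of a] f(1)[of z] f(5,7,8))
  ultimately show ?thesis using Fin by simp
next
  case Infty
  have "f (1 / a) = 1 / a" by (simp only: f(3,5,6))
  thus ?thesis using Infty by simp
qed

theorem C3_case: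
  fixes k :: "'p::prime_card mod_ring"
  assumes odd: "odd CARD('p)" and n: "n > 0" and k: "k\<^sup>2 + 1 / 2 * k + 1 / 2 = 0"
    and p7: "CARD('p) mod 7 \<in> {1, 2, 4}"
    and rep: "represents_frobenius (Z_adjoin alpha) (- 35 :: 'p mod_ring) 98 \<pi>"
    and \<sigma>: "of_int \<sigma> = 2 * k + 1"
    and e0: "e0 = ring_valuation (Z_adjoin alpha) (rho0 \<pi> \<sigma>) (\<pi> ^ n - 1)"
    and e1: "e1 = ring_valuation (Z_adjoin alpha) (rho0 \<pi> \<sigma>) (\<pi> ^ n + 1)"
  shows "e0 > 0" "e1 > 0"
    and "(\<And>i. theta (to_ac k) (Fin (z (Suc i))) = Fin (z i)) \<Longrightarrow> z 0 ^ (CARD('p) ^ n) = z 0 \<Longrightarrow>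
      \<not> theta_periodic (to_ac k) (Fin (z 1)) \<Longrightarrow>
      \<exists>d0. \<forall>i. (z i ^ (CARD('p) ^ n) = z i \<longrightarrow> i + d0 \<le> max e0 e1) \<and>
      (\<forall>j\<ge>1. z i ^ (CARD('p) ^ (2 ^ j * n)) = z i \<longleftrightarrow> i + d0 \<le> e0 + e1 + (j - 1) * 1)"
proof -
  have two: "(2 :: 'p mod_ring alg_closure) \<noteq> 0" by (rule two_neq_zero_ac[OF odd])
  have two': "(2 :: 'p mod_ring) \<noteq> 0" by (rule two_neq_zero_mod_ring[OF odd])
  have seven: "(7 :: 'p mod_ring alg_closure) \<noteq> 0"
  proof
    assume "(7 :: 'p mod_ring alg_closure) = 0"
    hence "of_nat 7 = (0 :: 'p mod_ring alg_closure)" by simp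
    hence d: "CARD('p) dvd 7" by (simp only: of_nat_eq_0_iff_char_dvd CHAR_alg_closure semiring_char_mod_ring)
    have "prime (7::nat)" by simp
    hence "CARD('p) = 1 \<or> CARD('p) = 7" using d by (simp add: prime_nat_iff)
    thus False using p7 nontriv[where 'a = 'p] by auto
  qed
  \<comment> \<open>The choice that makes k = -a / 2, the parameter in \<open>mob_velu\<close>. The
    equation for \<open>k\<close> becomes a^2 = a - 2, and 1 - a = 2 k + 1 is the residue of
    \<sigma>.\<close>
  define a0 where "a0 = - 2 * k"
  define a where "a = to_ac a0"
  have k2: "2 * k\<^sup>2 + k + 1 = 0"
  proof -
    have "2 * k\<^sup>2 + k + 1 = 2 * (k\<^sup>2 + 1 / 2 * k + 1 / 2)" using two' by (simp add: distrib_left)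
    thus ?thesis unfolding k by (simp only: mult_zero_right)
  qed
  have "a0 * a0 = a0 - 2 + 2 * (2 * k\<^sup>2 + k + 1)" by (simp add: a0_def power2_eq_square algebra_simps)
  hence a00: "a0 * a0 = a0 - 2" unfolding k2 by (simp only: mult_zero_right add_0_right)
  have "a * a = to_ac (a0 * a0)" by (simp only: a_def to_ac_mult)
  also have "\<dots> = a - 2" by (simp only: a00 a_def to_ac_diff to_ac_numeral)
  finally have aa: "a * a = a - 2" .
  interpret q: alpha_mod a by (rule alpha_mod.intro[OF aa two seven])
  interpret q': alpha_mod "1 - a" by (rule q.conj)
  have ka: "to_ac k = - a / 2" using two by (simp add: a_def a0_def)
  have pi: "\<pi> \<in> carrier (Z_adjoin alpha)"
    using rep unfolding represents_frobenius_def by (rule conjunct1)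
  define A1 B1 where AB1: "A1 = (- 35 :: 'p mod_ring)" "B1 = (98 :: 'p mod_ring)"
  obtain \<Phi> where iso: "\<Phi> \<in> ring_iso (Z_adjoin alpha) (ec_End (to_ac A1) (to_ac B1))"
    and frob: "\<Phi> \<pi> = restrict (frobenius CARD('p)) (ec_points (to_ac A1) (to_ac B1))"
    using conjunct2[OF rep[unfolded represents_frobenius_def]] unfolding AB1 by (elim bexE)
  interpret cm_frobenius alpha 1 "-2" A1 B1 \<Phi> \<pi>
  proof unfold_locales
    show "alpha * alpha = of_int 1 * alpha + of_int (- 2)" using alpha_square by simp
  qed (rule two iso odd pi frob)+
  have AB: "A = - 35" "B = 98" by (simp_all add: AB1)
  have repr: "\<exists>u v :: int. x = of_int u + of_int v * alpha" if "x \<in> R" for x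
    using that unfolding Z_adjoin_mem_iff .
  have norm: "\<exists>m::nat. (cmod x)\<^sup>2 = real m" if x: "x \<in> R" for x
  proof -
    obtain u v :: int where "x = of_int u + of_int v * alpha" using repr[OF x] by blast
    hence "(cmod x)\<^sup>2 = real (nat (u\<^sup>2 + u * v + 2 * v\<^sup>2))" using alpha_norm_nonneg[of u v] by (simp only: alpha_norm of_nat_nat)
    thus ?thesis by blast
  qed
  have norm1: "x = 1 \<or> x = - 1" if x: "x \<in> R" "(cmod x)\<^sup>2 = 1" for x
  proof -
    obtain u v :: int where uv: "x = of_int u + of_int v * alpha" using repr[OF x(1)] by blast
    have "of_int (u\<^sup>2 + u * v + 2 * v\<^sup>2) = (of_int 1 :: real)" using x(2) unfolding uv alpha_norm by simp
    hence "u\<^sup>2 + u * v + 2 * v\<^sup>2 = 1" by (simp only: of_int_eq_iff)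
    from alpha_norm_1[OF this] show ?thesis using uv by auto
  qed
  have norm2: "x \<in> {alpha, alpha - 1, - alpha, 1 - alpha}" if x: "x \<in> R" "(cmod x)\<^sup>2 = 2" for x
  proof -
    obtain u v :: int where uv: "x = of_int u + of_int v * alpha" using repr[OF x(1)] by blast
    have "of_int (u\<^sup>2 + u * v + 2 * v\<^sup>2) = (of_int 2 :: real)" using x(2) unfolding uv alpha_norm by simp
    hence "u\<^sup>2 + u * v + 2 * v\<^sup>2 = 2" by (simp only: of_int_eq_iff)
    from alpha_norm_2[OF this] show ?thesis using uv by auto
  qed
  \<comment> \<open>\<open>c\<close> and \<open>c'\<close> are nonunits, as they have nontrivial kernel, and \<open>c' c = \<plusminus> 2\<close>: both have norm 2.
    The sign of \<open>c\<close> is then fixed by a point that \<open>c + 1\<close> kills but 2 does not.\<close>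
  have "restrict (velu q.e q.b q.w) E \<in> ec_endomorphisms A B" unfolding AB by (rule q.velu_endomorphism)
  from Phi_surj[OF this] obtain c where c: "c \<in> R" "\<Phi> c = restrict (velu q.e q.b q.w) E" by (elim bexE)
  have "restrict (velu q'.e q'.b q'.w) E \<in> ec_endomorphisms A B" unfolding AB by (rule q'.velu_endomorphism)
  from Phi_surj[OF this] obtain c' where c': "c' \<in> R" "\<Phi> c' = restrict (velu q'.e q'.b q'.w) E" by (elim bexE)
  have cP: "\<Phi> c P = velu q.e q.b q.w P" "\<Phi> c' P = velu q'.e q'.b q'.w P" if "P \<in> E" for P
    using that c c' by simp_all
  define T where "T = Affine q.e (0 :: 'p mod_ring alg_closure)"
  define T' where "T' = Affine q'.e (0 :: 'p mod_ring alg_closure)"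
  have T: "T \<in> E" "T' \<in> E" using q.root q'.root unfolding AB T_def T'_def by auto
  have cT: "\<Phi> c T = EC_Infinity" "\<Phi> c' T' = EC_Infinity" using cP T by (simp_all add: T_def T'_def)
  have cc: "(c' * c) * (c' * c) = 4"
  proof -
    have "\<Phi> ((c' * c - 2) * (c' * c + 2)) P = EC_Infinity" if P: "P \<in> E" for P
    proof -
      have "\<Phi> (c' * c) P = \<Phi> c' (\<Phi> c P)" by (rule Phi_times[OF c'(1) c(1) P])
      also have "\<dots> = velu q'.e q'.b q'.w (\<Phi> c P)" by (rule cP(2)[OF Phi_closed[OF c(1) P]])
      also have "\<Phi> c P = velu q.e q.b q.w P" by (rule cP(1)[OF P])
      finally have "\<Phi> (c' * c) P = velu q'.e q'.b q'.w (velu q.e q.b q.w P)" .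
      moreover have "ec_x (velu q'.e q'.b q'.w (velu q.e q.b q.w P)) = ec_x (ec_add A P P)"
        using P unfolding AB by (rule q.velu_conj_velu)
      ultimately have "ec_x (\<Phi> (c' * c) P) = ec_x (ec_add A P P)" by simp
      also have "ec_add A P P = \<Phi> 2 P" using Phi_plus[of 1 1 P] P by simp
      finally have "\<Phi> 2 P = \<Phi> (c' * c) P \<or> \<Phi> 2 P = ec_neg (\<Phi> (c' * c) P)"
        using ec_x_eq_iff[of "\<Phi> (c' * c) P" A B "\<Phi> 2 P"] P c c' by simp
      hence "\<Phi> (c' * c) P = \<Phi> 2 P \<or> \<Phi> (c' * c) P = ec_neg (\<Phi> 2 P)" by auto
      hence "\<Phi> (c' * c - 2) P = EC_Infinity \<or> \<Phi> (c' * c + 2) P = EC_Infinity"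
        using P c c' by (simp add: Phi_diff_eq_infinity Phi_sum_eq_infinity)
      thus ?thesis
      proof
        assume "\<Phi> (c' * c - 2) P = EC_Infinity"
        from ann_mult[OF _ _ P this, of "c' * c + 2"] show ?thesis using c c' by (simp only: mult.commute) simp
      next
        assume "\<Phi> (c' * c + 2) P = EC_Infinity"
        from ann_mult[OF _ _ P this, of "c' * c - 2"] show ?thesis using c c' by simp
      qed
    qed
    hence "(c' * c - 2) * (c' * c + 2) = 0" using eq_0_if_kills[of "(c' * c - 2) * (c' * c + 2)"] c c' by simp
    thus ?thesis by (simp add: algebra_simps)
  qed
  have pm_not: "x \<noteq> 1 \<and> x \<noteq> - 1" if "x \<in> R" "\<Phi> x P = EC_Infinity" "P \<in> E" "P \<noteq> EC_Infinity" for x P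
    using that Phi_uminus[of 1 P] by (cases P) auto
  have nc: "(cmod c)\<^sup>2 = 2"
  proof -
    obtain m m' :: nat where m: "(cmod c)\<^sup>2 = real m" "(cmod c')\<^sup>2 = real m'" using norm c(1) c'(1) by metis
    have "cmod ((c' * c) * (c' * c)) = 4" unfolding cc by simp
    hence "(cmod c)\<^sup>2 * (cmod c')\<^sup>2 = 4" by (simp add: norm_mult power2_eq_square mult_ac)
    hence "real (m * m') = real 4" unfolding m by simp
    hence mm: "m * m' = 4" by (simp only: of_nat_eq_iff)
    have "m \<noteq> 1" using norm1[OF c(1)] m(1) pm_not[OF c(1) cT(1) T(1)] by (auto simp: T_def)
    moreover have "m' \<noteq> 1" using norm1[OF c'(1)] m(2) pm_not[OF c'(1) cT(2) T(2)] by (auto simp: T'_def)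
    moreover have "m dvd 4" using mm by (metis dvd_triv_left)
    hence "m \<le> 4" "m > 0" using mm by (auto dest: dvd_imp_le intro!: Nat.gr0I)
    ultimately have "m = 2" using mm by (cases "m = 3"; cases "m = 4") auto
    thus ?thesis using m by simp
  qed
  have ca: "c = alpha \<or> c = 1 - alpha"
  proof (rule ccontr)
    assume "\<not> ?thesis"
    hence "c = - alpha \<or> c = alpha - 1" using norm2[OF c(1) nc] by auto
    have fac: "\<exists>x\<in>R. x * (c + 1) = 2"
      using \<open>c = - alpha \<or> c = alpha - 1\<close>
    proof
      assume "c = - alpha"
      thus ?thesis using alpha_square by (intro bexI[of _ alpha]) (auto simp: algebra_simps)
    next
      assume "c = alpha - 1"
      thus ?thesis using alpha_square by (intro bexI[of _ "1 - alpha"]) (auto simp: algebra_simps)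
    qed
    obtain y where y: "y\<^sup>2 = (2 * a - 1) ^ 3 + -35 * (2 * a - 1) + 98"
      using nth_root_exists[of 2 "(2 * a - 1) ^ 3 + -35 * (2 * a - 1) + 98"] by auto
    define P where "P = Affine (2 * a - 1) y"
    have P: "P \<in> E" using y unfolding AB P_def by simp
    have "\<Phi> c P = ec_neg (\<Phi> 1 P)" using cP(1)[OF P] q.velu_P4(1)[OF y] P by (simp add: P_def)
    hence c1: "\<Phi> (c + 1) P = EC_Infinity" using P c by (simp add: Phi_sum_eq_infinity)
    obtain x where x: "x \<in> R" "x * (c + 1) = 2" using fac by blast
    have "\<Phi> 2 P = EC_Infinity" using ann_mult[OF x(1) _ P c1] c x(2) by simp
    moreover have "\<Phi> (1 + 1) P = ec_add A P P" using P Phi_plus[of 1 1 P] by simp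
    ultimately have "P = ec_neg P" using ec_add_eq_infinity_iff[of A P P] by simp
    hence "y = - y" by (simp add: P_def)
    hence "2 * y = 0" by (metis add.right_inverse mult_2)
    thus False using two q.velu_P4(2)[OF y] by simp
  qed
  have "alpha * (1 - alpha) = 2" using alpha_square by (simp add: algebra_simps)
  hence c2: "c * (1 - c) = 2" using ca by (auto simp: mult.commute)
  have Imc: "Im c \<noteq> 0" using ca Im_alpha by auto
  have repr_c: "\<exists>u v :: int. x = of_int u + of_int v * c" if x: "x \<in> R" for x
  proof -
    obtain u v :: int where uv: "x = of_int u + of_int v * alpha" using repr[OF x] by blast
    from ca show ?thesis
    proof
      assume "c = alpha"
      thus ?thesis using uv by blast
    next
      assume c1: "c = 1 - alpha"
      have "x = of_int (u + v) + of_int (- v) * c" unfolding uv c1 by (simp add: algebra_simps)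
      thus ?thesis by blast
    qed
  qed
  have even_dvd: "rdvd c (of_int u + of_int v * c)" if ev: "even u" for u v :: int
  proof -
    obtain s where s: "u = 2 * s" using ev by (elim evenE)
    have "of_int u = c * ((1 - c) * of_int s)" unfolding s mult.assoc[symmetric] c2 by simp
    hence "of_int u + of_int v * c = c * ((1 - c) * of_int s + of_int v)" by (simp add: algebra_simps)
    thus ?thesis using c unfolding rdvd_def by auto
  qed
  have mod: "rdvd c x \<or> rdvd c (x - 1)" if x: "x \<in> R" for x
  proof -
    obtain u v :: int where uv: "x = of_int u + of_int v * c" using repr_c[OF x] by blast
    show ?thesis
    proof (cases "even u")
      case True
      thus ?thesis using even_dvd uv by blast
    next
      case False
      hence "even (u - 1)" by simp
      from even_dvd[OF this] show ?thesis using uv by (simp add: algebra_simps)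
    qed
  qed
  have nonunit: "\<not> rdvd c 1"
  proof
    assume "rdvd c 1"
    then obtain x where x: "x \<in> R" "1 = c * x" unfolding rdvd_def by blast
    obtain m :: nat where m: "(cmod x)\<^sup>2 = real m" using norm[OF x(1)] by blast
    have "1 = (cmod c)\<^sup>2 * (cmod x)\<^sup>2" by (metis x(2) norm_mult norm_one one_power2 power_mult_distrib)
    hence "real 1 = real (2 * m)" using nc m by simp
    hence "1 = 2 * m" by (simp only: of_nat_eq_iff)
    thus False by presburger
  qed
  have apw: "a ^ CARD('p) = a" using to_ac_power_card[of a0 1] by (simp add: a_def)
  have spw: "(2 * a - 1) ^ CARD('p) = 2 * a - 1" "(9 - 4 * a) ^ CARD('p) = 9 - 4 * a"
    using to_ac_power_card[of "2 * a0 - 1" 1] to_ac_power_card[of "9 - 4 * a0" 1] by (simp_all add: a_def)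
  interpret cm_theta alpha 1 "-2" A B \<Phi> c \<pi> "to_ac k" "\<lambda>P. mob a (ec_x P)" "CARD('p)"
  proof
    show "CARD('p) \<ge> 2" using nontriv[where 'a = 'p] by linarith
    show "mob a (ec_x (\<Phi> c P)) = theta (to_ac k) (mob a (ec_x P))" if "P \<in> E" for P
      unfolding cP(1)[OF that] ka by (rule q.mob_velu)
    show "mob a (ec_x (\<Phi> \<pi> P)) = map_proj_line (\<lambda>z. z ^ CARD('p)) (mob a (ec_x P))" if P: "P \<in> E" for P
    proof -
      have "\<Phi> \<pi> P = frobenius CARD('p) P" using P by (simp only: Phi_pi restrict_apply if_True)
      moreover have "ec_x (frobenius CARD('p) P) = map_proj_line (\<lambda>z. z ^ CARD('p)) (ec_x P)"
        by (cases P) simp_all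
      ultimately have "ec_x (\<Phi> \<pi> P) = map_proj_line (\<lambda>z. z ^ CARD('p)) (ec_x P)" by (simp only:)
      moreover have "mob a (map_proj_line (\<lambda>z. z ^ CARD('p)) (ec_x P)) = map_proj_line (\<lambda>z. z ^ CARD('p)) (mob a (ec_x P))"
      proof (rule q.mob_power_card)
        fix x y :: "'p mod_ring alg_closure"
        show "(x - y) ^ CARD('p) = x ^ CARD('p) - y ^ CARD('p)" using power_card_diff[of x y 1] by (simp only: power_one_right)
        show "x = y" if "x ^ CARD('p) = y ^ CARD('p)"
          by (rule iffD1[OF power_card_inj[of x 1 y, unfolded power_one_right] that])
        show "(x * y) ^ CARD('p) = x ^ CARD('p) * y ^ CARD('p)" by (rule power_mult_distrib)
        show "(x / y) ^ CARD('p) = x ^ CARD('p) / y ^ CARD('p)" by (rule power_divide)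
      qed (rule apw power_one spw)+
      ultimately show ?thesis by (simp only:)
    qed
    show "mob a (ec_x P) = mob a (ec_x Q) \<longleftrightarrow> Q = P \<or> Q = ec_neg P" if "P \<in> E" "Q \<in> E" for P Q
    proof -
      have "mob a (ec_x P) = mob a (ec_x Q) \<longleftrightarrow> ec_x P = ec_x Q"
        by (rule iffI[OF q.mob_inj arg_cong])
      thus ?thesis unfolding ec_x_eq_iff[OF that] .
    qed
    show "\<exists>P\<in>E. mob a (ec_x P) = Fin z" for z
    proof -
      obtain x where x: "mob a x = Fin z" using q.mob_surj by blast
      show ?thesis
      proof (cases x)
        case Infty
        thus ?thesis using x by (intro bexI[of _ EC_Infinity]) auto
      next
        case (Fin y)
        obtain P where "P \<in> E" "ec_x P = Fin y" using ec_x_surj[of A B y] by (elim bexE)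
        moreover have "mob a (Fin y) = Fin z" using x unfolding Fin .
        ultimately show ?thesis by (intro bexI[of _ P]) (simp_all only:)
      qed
    qed
    show "c \<in> R" by (rule c(1))
    show "\<pi> \<in> R" by (rule pi)
    show "rdvd c x \<or> rdvd c (x - 1)" if "x \<in> R" for x by (rule mod[OF that])
    show "\<not> rdvd c 1" by (rule nonunit)
  qed
  have repc: "scales_differential c (1 - a)"
  proof -
    \<comment> \<open>\<open>U'\<close> and \<open>V\<close> share the factor 1 - b / (x - e)^2,
      with coefficients w^2 and w^3, so the multiplier is 1 / w = 1 - a.\<close>
    define U where "U x = q.w\<^sup>2 * (x + q.b / (x - q.e))" for x
    define V where "V x = q.w ^ 3 * (1 - q.b / ((x - q.e) * (x - q.e)))" for x
    define U' where "U' x = 0 * (x + q.b / (x - q.e)) + q.w\<^sup>2 * (1 + (0 * (x - q.e) - q.b * (1 - 0)) / (x - q.e)\<^sup>2)" for x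
    have ne: "\<forall>\<^sub>F x in cofinite. x - q.e \<noteq> 0" using eventually_poly_nonzero[of "[:- q.e, 1:]"] by simp
    have dd: "rat_deriv (\<lambda>x. x - q.e) (\<lambda>_. 1 - 0)" by (intro rat_deriv_diff rat_deriv_ident rat_deriv_const)
    have ne2: "\<forall>\<^sub>F x in cofinite. (x - q.e) * (x - q.e) \<noteq> 0" using ne by eventually_elim simp
    have U: "rat_deriv U U'" unfolding U_def[abs_def] U'_def[abs_def]
      by (intro rat_deriv_mult rat_deriv_add rat_deriv_const rat_deriv_ident rat_deriv_divide[OF rat_deriv_const dd ne infK])
    have V: "\<exists>V'. rat_deriv V V'" unfolding V_def[abs_def]
      using rat_deriv_mult[OF rat_deriv_const rat_deriv_diff[OF rat_deriv_const
        rat_deriv_divide[OF rat_deriv_const rat_deriv_mult[OF dd dd] ne2 infK]]] by blast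
    have pt: "\<forall>\<^sub>F x in cofinite. \<forall>y. y\<^sup>2 = poly cubic x \<longrightarrow> \<Phi> c (Affine x y) = Affine (U x) (y * V x)"
      using ne
    proof eventually_elim
      case (elim x)
      show ?case
      proof (intro allI impI)
        fix y assume "y\<^sup>2 = poly cubic x"
        hence "Affine x y \<in> E" by (simp add: poly_cubic)
        from cP(1)[OF this] elim show "\<Phi> c (Affine x y) = Affine (U x) (y * V x)"
          by (simp add: U_def V_def power2_eq_square mult_ac)
      qed
    qed
    have U'V: "\<forall>\<^sub>F x in cofinite. U' x = (1 - a) * V x"
    proof (rule always_eventually, rule allI)
      fix x
      have w3: "(1 - a) * q.w ^ 3 = q.w\<^sup>2" using q.w_conj by (simp add: power3_eq_cube power2_eq_square mult_ac)
      have "(1 - a) * V x = ((1 - a) * q.w ^ 3) * (1 - q.b / ((x - q.e) * (x - q.e)))" by (simp add: V_def mult_ac)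
      thus "U' x = (1 - a) * V x" unfolding w3 by (simp add: U'_def power2_eq_square)
    qed
    show ?thesis unfolding scales_differential_def using U V pt U'V by blast
  qed
  have notint: "c + of_int m \<noteq> of_int j" for m j
  proof
    assume h: "c + of_int m = of_int j"
    have "Im c = 0" using arg_cong[OF h, of Im] by simp
    thus False using Imc by simp
  qed
  have ni: "c + of_int m \<in> R" "c + of_int m \<noteq> 0" "c + of_int m \<noteq> 1" "c + of_int m \<noteq> - 1" for m
    using notint[of m 0] notint[of m 1] notint[of m "-1"] c(1) by simp_all
  \<comment> \<open>Adding multipliers requires nonzero summands that are not equal up to sign.
    \<open>c\<close> is not real, so steps by 1 or -1 from \<open>c\<close> never meet an excluded
    case.\<close>
  have repcm: "scales_differential (c + of_int m) (1 - a + of_int m)" for m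
  proof (induction m rule: int_induct[of _ 0])
    case base
    thus ?case using repc by simp
  next
    case (step1 i)
    have "scales_differential ((c + of_int i) + 1) ((1 - a + of_int i) + 1)"
      by (rule scales_differential_add[OF _ _ _ _ _ _ step1(2) scales_differential_one]) (use ni[of i] in auto)
    thus ?case by (simp add: add.assoc)
  next
    case (step2 i)
    have "scales_differential ((c + of_int i) + (- 1)) ((1 - a + of_int i) + (- 1))"
      by (rule scales_differential_add[OF _ _ _ _ _ _ step2(2) scales_differential_uminus[OF one_in_R scales_differential_one]]) (use ni[of i] in auto)
    thus ?case by (simp add: algebra_simps)
  qed
  have d1: "rdvd \<pi> (c - of_int \<sigma>)"
  proof -
    have "to_ac (of_int \<sigma>) = to_ac (2 * k + 1)" using \<sigma> by simp
    hence s: "of_int \<sigma> = 1 - a" by (simp add: a_def a0_def)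
    have "scales_differential (c + of_int (- \<sigma>)) 0" using repcm[of "- \<sigma>"] by (simp add: s)
    thus ?thesis using pi_rdvd_if_scales_differential_0[of "c + of_int (- \<sigma>)"] notint[of "- \<sigma>" 0] c(1) by simp
  qed
  \<comment> \<open>The integer p is reached as the sum of c + p and -c, because adding 1 to itself
    would be an excluded case. The multiplier is p = 0.\<close>
  have d2: "rdvd \<pi> (of_nat CARD('p))"
  proof -
    have p0: "of_nat CARD('p) = (0 :: 'p mod_ring alg_closure)"
      by (simp only: of_nat_eq_0_iff_char_dvd CHAR_alg_closure semiring_char_mod_ring dvd_refl)
    have "scales_differential ((c + of_int (int CARD('p))) + (- c)) ((1 - a + of_int (int CARD('p))) + (- (1 - a)))"
    proof (rule scales_differential_add)
      show "c + of_int (int CARD('p)) \<noteq> - c"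
      proof
        assume h: "c + of_int (int CARD('p)) = - c"
        have "Im c = - Im c" using arg_cong[OF h, of Im] by simp
        thus False using Imc by simp
      qed
      show "c + of_int (int CARD('p)) \<noteq> 0" using notint[of "int CARD('p)" 0] by simp
      show "- c \<noteq> 0" using Imc by auto
      show "c + of_int (int CARD('p)) \<in> R" "- c \<in> R" using c(1) of_int_in_R by blast+
      show "c + of_int (int CARD('p)) \<noteq> - (- c)" by simp
      show "scales_differential (c + of_int (int CARD('p))) (1 - a + of_int (int CARD('p)))" by (rule repcm)
      show "scales_differential (- c) (- (1 - a))" by (rule scales_differential_uminus[OF c(1) repc])
    qed
    hence "scales_differential (of_nat CARD('p)) 0" using p0 by (simp add: algebra_simps)
    thus ?thesis using pi_rdvd_if_scales_differential_0[of "of_nat CARD('p)"] of_int_in_R[of "int CARD('p)"] by simp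
  qed
  have rho: "rho0 \<pi> \<sigma> = c"
  proof (cases "c = alpha")
    case True
    thus ?thesis using d1 by (simp add: rho0_def rdvd_iff)
  next
    case False
    hence c1: "c = 1 - alpha" using ca by simp
    \<comment> \<open>Otherwise \<pi> would divide the difference 2 alpha - 1 of the two conjugates,
      whose square is -7. It also divides p, which is prime to 7, so it would be a unit, that is 1
      or -1, which \<open>pi_power_neq\<close> rules out.\<close>
    have "\<not> rdvd \<pi> (alpha - of_int \<sigma>)"
    proof
      assume "rdvd \<pi> (alpha - of_int \<sigma>)"
      from rdvd_diff[OF this d1] have "rdvd \<pi> (2 * alpha - 1)" unfolding c1 by (simp add: algebra_simps)
      from rdvd_mult[OF this, of "2 * alpha - 1"] have "rdvd \<pi> ((2 * alpha - 1) * (2 * alpha - 1))" by auto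
      moreover have "(2 * alpha - 1) * (2 * alpha - 1) = 4 * (alpha * alpha) - 4 * alpha + 1" by (simp add: algebra_simps)
      hence "(2 * alpha - 1) * (2 * alpha - 1) = - 7" unfolding alpha_square by simp
      ultimately have s: "rdvd \<pi> (- 7)" by simp
      have cop: "coprime (int CARD('p)) 7"
      proof -
        have "prime (7::int)" by simp
        moreover have "\<not> 7 dvd CARD('p)" using p7 by (auto simp: dvd_eq_mod_eq_0)
        hence "\<not> int 7 dvd int CARD('p)" by (simp only: int_dvd_int_iff not_False_eq_True)
        hence "\<not> 7 dvd int CARD('p)" by simp
        ultimately have "coprime 7 (int CARD('p))" by (rule prime_imp_coprime)
        thus ?thesis by (simp only: coprime_commute)
      qed
      obtain x y :: int where "x * int CARD('p) + y * 7 = gcd (int CARD('p)) 7"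
        using bezout_int[of "int CARD('p)" 7] by (elim exE)
      hence xy: "x * int CARD('p) + y * 7 = 1" using cop by (simp only: coprime_iff_gcd_eq_1)
      have "rdvd \<pi> (of_nat CARD('p) * of_int x + (- 7) * of_int (- y))"
        by (rule rdvd_add[OF rdvd_mult[OF d2 of_int_in_R] rdvd_mult[OF s of_int_in_R]])
      moreover have "of_nat CARD('p) * of_int x + (- 7) * of_int (- y) = (1::complex)"
      proof -
        have "of_nat CARD('p) * of_int x + (- 7) * of_int (- y) = (of_int (x * int CARD('p) + y * 7) :: complex)" by simp
        thus ?thesis unfolding xy by simp
      qed
      ultimately have "rdvd \<pi> 1" by simp
      then obtain b where b: "b \<in> R" "1 = \<pi> * b" unfolding rdvd_def by blast
      obtain m :: nat where m1: "(cmod \<pi>)\<^sup>2 = real m" using norm[OF pi] by (elim exE)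
      obtain m' :: nat where m2: "(cmod b)\<^sup>2 = real m'" using norm[OF b(1)] by (elim exE)
      note m = m1 m2
      have "1 = (cmod \<pi>)\<^sup>2 * (cmod b)\<^sup>2"
        unfolding power_mult_distrib[symmetric] norm_mult[symmetric] b(2)[symmetric] by simp
      hence "real 1 = real (m * m')" unfolding m by simp
      hence "1 = m * m'" by (simp only: of_nat_eq_iff)
      hence "m = 1" by simp
      hence "(cmod \<pi>)\<^sup>2 = 1" using m1 by simp
      from norm1[OF pi this] show False using pi_power_neq[OF infK, of 1] by auto
    qed
    thus ?thesis using c1 by (simp add: rho0_def rdvd_iff cnj_alpha)
  qed
  \<comment> \<open>The cofactor \<open>1 - c\<close> is prime to \<open>c\<close>, so here
    \<open>v = 1\<close>.\<close>
  have two_fac: "2 = c ^ 1 * (1 - c)" "1 - c \<in> R" "\<not> rdvd c (1 - c)"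
  proof -
    show "2 = c ^ 1 * (1 - c)" using c2 by simp
    show "1 - c \<in> R" using c by simp
    show "\<not> rdvd c (1 - c)" using rdvd_add[of c "1 - c" c] rdvd_self_mult[of 1 c] nonunit by auto
  qed
  \<comment> \<open>The kernel point \<open>T\<close> has its abscissa in the prime field and
    ordinate 0, so Frobenius fixes it. This makes \<open>e0\<close> and, because \<open>c\<close>
    divides 2, also \<open>e1\<close> at least 1.\<close>
  have "rdvd (c ^ Suc 0) (\<pi> - 1)"
  proof (rule rho_power_rdvd_of_ann[OF T(1)])
    have "q.e = to_ac (a0 + 3)" unfolding q.e_def by (simp add: a_def)
    hence "q.e ^ CARD('p) = q.e" using to_ac_power_card[of "a0 + 3" 1] by (simp only: power_one_right)
    hence "\<Phi> \<pi> T = T" unfolding Phi_pi using T(1) by (simp add: T_def)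
    thus "\<Phi> (\<pi> - 1) T = EC_Infinity" using T(1) by (simp add: Phi_diff_eq_infinity)
    show "\<Phi> (c ^ 0) T \<noteq> EC_Infinity" using T(1) by (simp add: T_def)
    show "\<Phi> (c ^ Suc 0) T = EC_Infinity" using cT by simp
  qed simp
  hence d0: "rdvd (c ^ 1) (\<pi> ^ n - 1)" using rdvd_power_diff_one by simp
  have d1': "rdvd (c ^ 1) (\<pi> ^ n + 1)"
  proof -
    have "rdvd (c ^ 1) 2" using two_fac unfolding rdvd_def by blast
    from rdvd_add[OF d0 this] show ?thesis by (simp add: add.commute)
  qed
  obtain E0 m0 where g0: "\<pi> ^ n - 1 = c ^ E0 * m0" "m0 \<in> R" "\<not> rdvd c m0"
    by (rule factor_rho[OF norm nc _ pi_power_neq(1)[OF infK n]]) auto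
  obtain E1 m1 where g1: "\<pi> ^ n + 1 = c ^ E1 * m1" "m1 \<in> R" "\<not> rdvd c m1"
    by (rule factor_rho[OF norm nc _ pi_power_neq(2)[OF infK n]]) auto
  have E: "e0 = E0" "e1 = E1" using e0 e1 ring_valuation_eq[OF g0] ring_valuation_eq[OF g1] unfolding rho by auto
  have ge: "1 \<le> e0" "1 \<le> e1" using power_rdvd_le[OF d0[unfolded g0(1)] g0(3)]
      power_rdvd_le[OF d1'[unfolded g1(1)] g1(3)] E by auto
  thus "e0 > 0" "e1 > 0" by auto
  show "\<exists>d0. \<forall>i. (z i ^ (CARD('p) ^ n) = z i \<longrightarrow> i + d0 \<le> max e0 e1) \<and>
      (\<forall>j\<ge>1. z i ^ (CARD('p) ^ (2 ^ j * n)) = z i \<longleftrightarrow> i + d0 \<le> e0 + e1 + (j - 1) * 1)"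
    if "\<And>i. theta (to_ac k) (Fin (z (Suc i))) = Fin (z i)" "z 0 ^ (CARD('p) ^ n) = z 0"
      "\<not> theta_periodic (to_ac k) (Fin (z 1))"
    by (rule theta_preimages_in_field_iff[OF two_fac g0[folded E] g1[folded E] _ n that]) (use ge in auto)
qed

section \<open>The degrees of the sequence\<close>

lemma theta_neg: "theta (- k) x = map_proj_line uminus (theta k x)"
  by (cases x) auto

lemma theta_odd: "theta k (map_proj_line uminus x) = map_proj_line uminus (theta k x)"
  by (cases x) (auto simp: algebra_simps)

lemma map_uminus_uminus: "map_proj_line uminus (map_proj_line uminus x) = (x :: 'a::field proj_line)"
  by (cases x) auto

lemma theta_power_odd: "(theta k ^^ r) (map_proj_line uminus x) = map_proj_line uminus ((theta k ^^ r) x)"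
  by (induction r) (auto simp: theta_odd)

lemma theta_periodic_minus:
  assumes "theta_periodic k (Fin (- x))"
  shows "theta_periodic k (Fin x)"
proof -
  obtain r where r: "r \<ge> 1" "(theta k ^^ r) (Fin (- x)) = Fin (- x)" using assms unfolding theta_periodic_def by blast
  have "(theta k ^^ r) (Fin x) = map_proj_line uminus ((theta k ^^ r) (Fin (- x)))"
    using theta_power_odd[of r k "Fin (- x)"] by simp
  hence "(theta k ^^ r) (Fin x) = Fin x" using r(2) by simp
  thus ?thesis using r(1) unfolding theta_periodic_def by blast
qed

text \<open>The map for \<open>- k\<close> is minus the map for \<open>k\<close>, and the latter is
  odd, so their second iterates agree; doubling the period absorbs the sign.\<close>

lemma theta_periodic_neg:
  assumes "theta_periodic k x"
  shows "theta_periodic (- k) x"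
proof -
  obtain r where r: "r \<ge> 1" "(theta k ^^ r) x = x" using assms unfolding theta_periodic_def by blast
  have 2: "(theta (- k) ^^ (2 * i)) y = (theta k ^^ (2 * i)) y" for i y
    by (induction i) (auto simp: theta_neg theta_odd map_uminus_uminus)
  have "(theta k ^^ (r + r)) x = x" using r(2) by (simp add: funpow_add)
  hence "(theta (- k) ^^ (2 * r)) x = x" unfolding 2 by (simp add: mult_2)
  thus ?thesis using r(1) unfolding theta_periodic_def by (intro exI[of _ "2 * r"]) simp
qed

text \<open>The orbit of \<open>x\<close> runs into a fixed point other than \<open>x\<close> and
  cannot return.\<close>

lemma not_theta_periodic:
  assumes "(theta k ^^ j) x = y" "theta k y = y" "x \<noteq> y"
  shows "\<not> theta_periodic k x"
proof
  assume "theta_periodic k x"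
  then obtain r where r: "r \<ge> 1" "(theta k ^^ r) x = x" unfolding theta_periodic_def by blast
  have y: "(theta k ^^ i) y = y" for i using assms(2) by (induction i) auto
  have x: "(theta k ^^ (r * i)) x = x" for i using r(2) by (induction i) (auto simp: funpow_add)
  have "r * j = (r * j - j) + j" using r(1) by (cases r) auto
  hence "x = (theta k ^^ ((r * j - j) + j)) x" using x[of j] by simp
  also have "\<dots> = y" unfolding funpow_add comp_apply assms(1) y ..
  finally show False using assms(3) by simp
qed

text \<open>The orbit is 1, 2 \<kappa>, 0, \<infinity>, since the square of 2 \<kappa> is
  -1.\<close>

lemma one_not_periodic_C2:
  fixes \<kappa> :: "'a::field"
  assumes two: "(2::'a) \<noteq> 0" and k: "4 * \<kappa>\<^sup>2 + 1 = 0"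
  shows "\<not> theta_periodic \<kappa> (Fin 1)"
proof (rule not_theta_periodic)
  have "\<kappa> \<noteq> 0" using k by auto
  hence nz: "2 * \<kappa> \<noteq> 0" using two by simp
  have "(2 * \<kappa>) * (2 * \<kappa>) = - 1" using k by (simp add: power2_eq_square eq_neg_iff_add_eq_0 mult_ac)
  hence "(2 * \<kappa>) * (- (2 * \<kappa>)) = 1" by (simp only: mult_minus_right minus_minus)
  hence inv: "inverse (2 * \<kappa>) = - (2 * \<kappa>)" by (rule inverse_unique)
  have "theta \<kappa> (Fin (2 * \<kappa>)) = Fin 0"
    by (simp only: theta.simps if_not_P[OF nz] inv add.right_inverse mult_zero_right)
  moreover have "theta \<kappa> (Fin 1) = Fin (2 * \<kappa>)" by simp
  moreover have "theta \<kappa> (Fin 0) = Infty" by simp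
  ultimately show "(theta \<kappa> ^^ 3) (Fin 1) = Infty"
    by (simp only: numeral_3_eq_3 funpow.simps comp_apply id_apply)
qed auto

lemma one_not_periodic_C3:
  fixes \<kappa> :: "'a::field"
  assumes two: "(2::'a) \<noteq> 0" and k: "2 * \<kappa>\<^sup>2 + \<kappa> + 1 = 0"
  shows "\<not> theta_periodic \<kappa> (Fin 1)"
proof (rule not_theta_periodic)
  \<comment> \<open>The image of 2 \<kappa>, and equal to its inverse by the equation for \<kappa>,
    hence a fixed point. It differs from 1, since equality would give 2 \<kappa> = -3 and then 8 =
    0.\<close>
  define y where "y = 2 * \<kappa>\<^sup>2 + 1 / 2"
  have k0: "\<kappa> \<noteq> 0" using k by auto
  hence nz: "2 * \<kappa> \<noteq> 0" using two by simp
  have y2: "2 * y = - (2 * \<kappa> + 1)"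
  proof -
    have "2 * y = 2 * (2 * \<kappa>\<^sup>2 + \<kappa> + 1) - 2 * \<kappa> - 1" using two by (simp add: y_def algebra_simps)
    thus ?thesis unfolding k by simp
  qed
  have "\<kappa> * (2 * y) = 1"
  proof -
    have "\<kappa> * (2 * y) = - (2 * \<kappa>\<^sup>2 + \<kappa> + 1) + 1" unfolding y2 by (simp add: algebra_simps power2_eq_square)
    thus ?thesis unfolding k by simp
  qed
  hence yk: "y * (2 * \<kappa>) = 1" by (simp add: mult_ac)
  have y0: "y \<noteq> 0" using yk by auto
  have iy: "inverse y = 2 * \<kappa>" using yk by (rule inverse_unique)
  have ik: "inverse (2 * \<kappa>) = y" using yk by (intro inverse_unique) (simp add: mult.commute)
  have th: "\<kappa> * (2 * \<kappa> + y) = y"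
  proof -
    have "\<kappa> * y = 1 / 2" using yk two by (simp add: eq_divide_eq mult_ac)
    thus ?thesis by (simp add: distrib_left y_def power2_eq_square)
  qed
  have "theta \<kappa> (Fin (2 * \<kappa>)) = Fin y" by (simp only: theta.simps if_not_P[OF nz] ik th)
  moreover have "theta \<kappa> (Fin 1) = Fin (2 * \<kappa>)" by simp
  ultimately show "(theta \<kappa> ^^ 2) (Fin 1) = Fin y"
    by (simp only: numeral_2_eq_2 funpow.simps comp_apply id_apply)
  show "theta \<kappa> (Fin y) = Fin y" using y0 iy th by (simp add: add.commute)
  show "Fin 1 \<noteq> Fin y"
  proof
    assume "Fin 1 = Fin y"
    hence "2 * 1 = - (2 * \<kappa> + 1)" using y2 by simp
    hence h: "2 * \<kappa> = - 3" by (simp add: eq_neg_iff_add_eq_0 algebra_simps)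
    have "2 * (2 * \<kappa>\<^sup>2 + \<kappa> + 1) = (2 * \<kappa>) * (2 * \<kappa>) + 2 * \<kappa> + 2" by (simp add: power2_eq_square algebra_simps)
    hence "(2::'a) * 2 * 2 = 0" unfolding h k by simp
    thus False using two by (simp only: mult_eq_0_iff) simp
  qed
qed

lemma theorem3p1_from_field_membership:
  fixes k :: "'p::prime_card mod_ring"
  assumes k: "k \<noteq> 0" and f0: "f0 \<in> Irr_deg n" and e: "e0 > 0" "e1 > 0"
    and np: "\<not> theta_periodic (to_ac k) (Fin 1)"
    and core: "\<And>z. (\<And>i. theta (to_ac k) (Fin (z (Suc i))) = Fin (z i)) \<Longrightarrow> z 0 ^ (CARD('p) ^ n) = z 0 \<Longrightarrow>
      \<not> theta_periodic (to_ac k) (Fin (z 1)) \<Longrightarrow>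
      \<exists>d0. \<forall>i. (z i ^ (CARD('p) ^ n) = z i \<longrightarrow> i + d0 \<le> max e0 e1) \<and>
      (\<forall>j\<ge>1. z i ^ (CARD('p) ^ (2 ^ j * n)) = z i \<longleftrightarrow> i + d0 \<le> e0 + e1 + (j - 1) * v)"
  shows "(\<exists>f1. first_step k n f0 f1) \<and> (\<forall>g\<in>Irr. \<exists>h. next_step k g h) \<and>
    (\<forall>f. f 0 = f0 \<and> first_step k n (f 0) (f 1) \<and> (\<forall>i\<ge>2. next_step k (f (i - 1)) (f i)) \<longrightarrow>
      (\<exists>s t. t > 0 \<and> s \<le> max e0 e1 \<and> s + t \<le> e0 + e1 \<and>
       f ` {0..s} \<subseteq> Irr_deg n \<and> f ` {s + 1..s + t} \<subseteq> Irr_deg (2 * n) \<and>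
       (\<forall>j\<ge>1. \<forall>i. (j - 1) * v < i \<and> i \<le> j * v \<longrightarrow> f (s + t + i) \<in> Irr_deg (2 ^ (j + 1) * n))))"
proof (intro conjI allI impI ballI)
  have "\<not> theta_periodic (to_ac k) (Fin (- 1))" using np theta_periodic_minus by blast
  thus "\<exists>f1. first_step k n f0 f1" by (rule first_step_exists[OF k f0 np])
  show "\<exists>h. next_step k g h" if "g \<in> Irr" for g by (rule next_step_exists[OF k that])
  fix f :: "nat \<Rightarrow> 'p mod_ring poly" assume f: "f 0 = f0 \<and> first_step k n (f 0) (f 1) \<and> (\<forall>i\<ge>2. next_step k (f (i - 1)) (f i))"
  have f0': "f 0 \<in> Irr_deg n" using f f0 by simp
  show "\<exists>s t. t > 0 \<and> s \<le> max e0 e1 \<and> s + t \<le> e0 + e1 \<and>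
       f ` {0..s} \<subseteq> Irr_deg n \<and> f ` {s + 1..s + t} \<subseteq> Irr_deg (2 * n) \<and>
       (\<forall>j\<ge>1. \<forall>i. (j - 1) * v < i \<and> i \<le> j * v \<longrightarrow> f (s + t + i) \<in> Irr_deg (2 ^ (j + 1) * n))"
    by (rule sequence_degrees[where f = f, OF k f0' _ _ e core]) (use f in blast)+
qed

text \<open>\<open>\<theta>\<^sub>-\<^sub>k\<close> and \<open>\<theta>\<^sub>k\<close> agree up to sign, so changing every other sign turns orbits of one into orbits of the other.\<close>

lemma field_membership_neg:
  fixes k :: "'p::prime_card mod_ring"
  assumes core: "\<And>z. (\<And>i. theta (to_ac (- k)) (Fin (z (Suc i))) = Fin (z i)) \<Longrightarrow> z 0 ^ (CARD('p) ^ n) = z 0 \<Longrightarrow>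
      \<not> theta_periodic (to_ac (- k)) (Fin (z 1)) \<Longrightarrow>
      \<exists>d0. \<forall>i. (z i ^ (CARD('p) ^ n) = z i \<longrightarrow> i + d0 \<le> M) \<and>
      (\<forall>j\<ge>1. z i ^ (CARD('p) ^ (2 ^ j * n)) = z i \<longleftrightarrow> i + d0 \<le> N j)"
    and z: "\<And>i. theta (to_ac k) (Fin (z (Suc i))) = Fin (z i)" "z 0 ^ (CARD('p) ^ n) = z 0"
      "\<not> theta_periodic (to_ac k) (Fin (z 1))"
  shows "\<exists>d0. \<forall>i. (z i ^ (CARD('p) ^ n) = z i \<longrightarrow> i + d0 \<le> M) \<and>
      (\<forall>j\<ge>1. z i ^ (CARD('p) ^ (2 ^ j * n)) = z i \<longleftrightarrow> i + d0 \<le> N j)"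
proof -
  define y where "y i = (- 1) ^ i * z i" for i
  have ypm: "y i = z i \<or> y i = - z i" for i by (cases "even i") (simp_all add: y_def)
  have yfix: "y i ^ (CARD('p) ^ m) = y i \<longleftrightarrow> z i ^ (CARD('p) ^ m) = z i" for i m
    using ypm[of i] by (auto simp: power_card_minus)
  have "theta (to_ac (- k)) (Fin (y (Suc i))) = Fin (y i)" for i
  proof -
    have z0: "z (Suc i) \<noteq> 0" and zi: "to_ac k * (z (Suc i) + inverse (z (Suc i))) = z i"
      using z(1)[of i] by (auto split: if_splits)
    have s: "inverse ((- 1) ^ i :: 'p mod_ring alg_closure) = (- 1) ^ i" by (cases "even i") simp_all
    have "- to_ac k * (y (Suc i) + inverse (y (Suc i))) = (- 1) ^ i * (to_ac k * (z (Suc i) + inverse (z (Suc i))))"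
      by (simp add: y_def s algebra_simps)
    thus ?thesis unfolding zi using z0 by (simp add: y_def)
  qed
  moreover have "y 0 ^ (CARD('p) ^ n) = y 0" using z(2) by (simp add: y_def)
  moreover have "\<not> theta_periodic (to_ac (- k)) (Fin (y 1))"
  proof
    assume "theta_periodic (to_ac (- k)) (Fin (y 1))"
    from theta_periodic_neg[OF this] have "theta_periodic (to_ac k) (Fin (- z 1))" by (simp add: y_def)
    thus False using theta_periodic_minus z(3) by blast
  qed
  ultimately have "\<exists>d0. \<forall>i. (y i ^ (CARD('p) ^ n) = y i \<longrightarrow> i + d0 \<le> M) \<and>
      (\<forall>j\<ge>1. y i ^ (CARD('p) ^ (2 ^ j * n)) = y i \<longleftrightarrow> i + d0 \<le> N j)" by (rule core)
  thus ?thesis unfolding yfix .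
qed

lemma C3_equation:
  fixes k :: "'p::prime_card mod_ring"
  assumes two: "(2 :: 'p mod_ring) \<noteq> 0" and "k \<in> C3"
  shows "2 * k\<^sup>2 + k + 1 = 0"
proof -
  have "2 * k\<^sup>2 + k + 1 = 2 * (k\<^sup>2 + 1 / 2 * k + 1 / 2)" using two by (simp add: distrib_left)
  also have "k\<^sup>2 + 1 / 2 * k + 1 / 2 = 0" using assms(2) by (simp add: C3_def)
  finally show ?thesis by simp
qed

lemma C2_equation:
  fixes k :: "'p::prime_card mod_ring"
  assumes two: "(2 :: 'p mod_ring) \<noteq> 0" and "k \<in> C2"
  shows "4 * k\<^sup>2 + 1 = 0"
proof -
  have "(4 :: 'p mod_ring) = 2 * 2" by simp
  hence "(4 :: 'p mod_ring) \<noteq> 0" using two by (simp only: mult_eq_0_iff) simp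
  hence "4 * k\<^sup>2 + 1 = 4 * (k\<^sup>2 + 1 / 4)" by (simp add: distrib_left)
  also have "k\<^sup>2 + 1 / 4 = 0" using assms(2) by (simp add: C2_def)
  finally show ?thesis by simp
qed

text \<open>This settles which of the two tails applies to a given \<open>k\<close>, and which sign
  of \<open>k\<close> enters the congruence for \<sigma>.\<close>

lemma C_disjoint:
  fixes k :: "'p::prime_card mod_ring"
  assumes two: "(2 :: 'p mod_ring) \<noteq> 0"
  shows "k \<in> C2 \<Longrightarrow> k \<notin> C3 \<union> C3_neg" "k \<in> C3_neg \<Longrightarrow> k \<notin> C3"
proof -
  have A: False if "4 * x\<^sup>2 + 1 = 0" "2 * x\<^sup>2 + x + 1 = 0" for x :: "'p mod_ring"
  proof -
    have "2 * x + 1 = 2 * (2 * x\<^sup>2 + x + 1) - (4 * x\<^sup>2 + 1)" by (simp add: algebra_simps)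
    hence h: "2 * x + 1 = 0" by (simp only: that mult_zero_right diff_zero)
    have "2 = (4 * x\<^sup>2 + 1) - (2 * x - 1) * (2 * x + 1)" by (simp add: algebra_simps power2_eq_square)
    thus False using two by (simp only: that h mult_zero_right diff_zero)
  qed
  show "k \<notin> C3 \<union> C3_neg" if k: "k \<in> C2"
  proof
    assume "k \<in> C3 \<union> C3_neg"
    thus False
    proof
      assume "k \<in> C3"
      thus False using A[OF C2_equation[OF two k] C3_equation[OF two]] by blast
    next
      assume "k \<in> C3_neg"
      hence "- k \<in> C3" by (simp add: C3_neg_def)
      moreover have "4 * (- k)\<^sup>2 + 1 = 0" using C2_equation[OF two k] by simp
      ultimately show False using A[of "- k"] C3_equation[OF two] by blast
    qed
  qed
  show "k \<notin> C3" if k: "k \<in> C3_neg"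
  proof
    assume "k \<in> C3"
    hence 1: "2 * k\<^sup>2 + k + 1 = 0" by (rule C3_equation[OF two])
    have 2: "2 * (- k)\<^sup>2 + (- k) + 1 = 0" using k by (intro C3_equation[OF two]) (simp add: C3_neg_def)
    have "2 * k = (2 * k\<^sup>2 + k + 1) - (2 * (- k)\<^sup>2 + (- k) + 1)" by (simp add: algebra_simps)
    hence "2 * k = 0" by (simp only: 1 2 diff_self)
    hence "k = 0" using two by simp
    thus False using 1 by simp
  qed
qed
theorem theorem3p1:
  fixes k :: "'p::prime_card mod_ring"
    and f0 :: "'p mod_ring poly"
    and n e0 e1 :: nat
    and \<pi> :: complex
    and \<sigma> :: int
  assumes "odd CARD('p)"
    and "n > 0"
    and "f0 \<in> Irr_deg n"
    and "k \<in> C2 \<union> C3 \<union> C3_neg"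
    and "k \<in> C2 \<Longrightarrow>
           represents_frobenius (Z_adjoin \<i>) (1 :: 'p mod_ring) 0 \<pi> \<and>
           e0 = multiplicity 2 (gauss_norm (\<pi> ^ n - 1)) \<and>
           e1 = multiplicity 2 (gauss_norm (\<pi> ^ n + 1))"
    and "k \<in> C3 \<union> C3_neg \<Longrightarrow>
           represents_frobenius (Z_adjoin alpha) (- 35 :: 'p mod_ring) 98 \<pi> \<and>
           of_int \<sigma> = 2 * (if k \<in> C3 then k else - k) + 1 \<and>
           e0 = ring_valuation (Z_adjoin alpha) (rho0 \<pi> \<sigma>) (\<pi> ^ n - 1) \<and>
           e1 = ring_valuation (Z_adjoin alpha) (rho0 \<pi> \<sigma>) (\<pi> ^ n + 1)"
  shows "(\<exists>f1. first_step k n f0 f1) \<and>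
         (\<forall>g\<in>Irr. \<exists>h. next_step k g h) \<and>
         (\<forall>f. f 0 = f0 \<and> first_step k n (f 0) (f 1) \<and> (\<forall>i\<ge>2. next_step k (f (i - 1)) (f i)) \<longrightarrow>
            (\<exists>s t. t > 0 \<and> s \<le> max e0 e1 \<and> s + t \<le> e0 + e1 \<and>
               f ` {0..s} \<subseteq> Irr_deg n \<and> f ` {s + 1..s + t} \<subseteq> Irr_deg (2 * n) \<and>
               (k \<in> C2 \<longrightarrow>
                  (\<forall>j\<ge>1. {f (s + t + 2 * j - 1), f (s + t + 2 * j)} \<subseteq> Irr_deg (2 ^ (j + 1) * n))) \<and>
               (k \<in> C3 \<union> C3_neg \<longrightarrow>
                  (\<forall>j\<ge>1. f (s + t + j) \<in> Irr_deg (2 ^ (j + 1) * n)))))"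
proof -
  have two: "(2 :: 'p mod_ring) \<noteq> 0" by (rule two_neq_zero_mod_ring[OF assms(1)])
  have two_ac: "(2 :: 'p mod_ring alg_closure) \<noteq> 0" by (rule two_neq_zero_ac[OF assms(1)])
  have np3: "\<not> theta_periodic (to_ac c) (Fin 1)" if "c \<in> C3" for c :: "'p mod_ring"
  proof (rule one_not_periodic_C3[OF two_ac])
    have "to_ac (2 * c\<^sup>2 + c + 1) = 0" using C3_equation[OF two that] by simp
    thus "2 * (to_ac c)\<^sup>2 + to_ac c + 1 = 0"
      by (simp only: to_ac_add to_ac_mult to_ac_power to_ac_numeral to_ac_1)
  qed
  \<comment> \<open>Blocks of length \<open>v = 2\<close> are the pairs \<open>2 * j - 1\<close>,
    \<open>2 * j\<close>, blocks of length 1 single indices. Of the two tails in the claim, the one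
    that does not apply is vacuous.\<close>
  have finish: ?thesis
    if cases: "k \<in> C2 \<and> v = 2 \<and> k \<notin> C3 \<union> C3_neg \<or> k \<notin> C2 \<and> v = 1"
      and core: "(\<exists>f1. first_step k n f0 f1) \<and> (\<forall>g\<in>Irr. \<exists>h. next_step k g h) \<and>
    (\<forall>f. f 0 = f0 \<and> first_step k n (f 0) (f 1) \<and> (\<forall>i\<ge>2. next_step k (f (i - 1)) (f i)) \<longrightarrow>
      (\<exists>s t. t > 0 \<and> s \<le> max e0 e1 \<and> s + t \<le> e0 + e1 \<and>
       f ` {0..s} \<subseteq> Irr_deg n \<and> f ` {s + 1..s + t} \<subseteq> Irr_deg (2 * n) \<and>
       (\<forall>j\<ge>1. \<forall>i. (j - 1) * v < i \<and> i \<le> j * v \<longrightarrow> f (s + t + i) \<in> Irr_deg (2 ^ (j + 1) * n))))" for v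
  proof (intro conjI allI impI)
    show "\<exists>f1. first_step k n f0 f1" by (rule conjunct1[OF core])
    show "\<forall>g\<in>Irr. \<exists>h. next_step k g h" by (rule conjunct1[OF conjunct2[OF core]])
    fix f :: "nat \<Rightarrow> 'p mod_ring poly"
    assume "f 0 = f0 \<and> first_step k n (f 0) (f 1) \<and> (\<forall>i\<ge>2. next_step k (f (i - 1)) (f i))"
    from mp[OF spec[OF conjunct2[OF conjunct2[OF core]], of f] this] obtain s t where st: "t > 0" "s \<le> max e0 e1" "s + t \<le> e0 + e1"
        "f ` {0..s} \<subseteq> Irr_deg n" "f ` {s + 1..s + t} \<subseteq> Irr_deg (2 * n)"
      and tail: "\<And>j i. j \<ge> 1 \<Longrightarrow> (j - 1) * v < i \<Longrightarrow> i \<le> j * v \<Longrightarrow> f (s + t + i) \<in> Irr_deg (2 ^ (j + 1) * n)"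
      by (elim exE conjE) simp
    have pair: "{f (s + t + 2 * j - 1), f (s + t + 2 * j)} \<subseteq> Irr_deg (2 ^ (j + 1) * n)" if "k \<in> C2" "j \<ge> 1" for j
    proof -
      have v: "v = 2" using cases that(1) by blast
      have "f (s + t + (2 * j - 1)) \<in> Irr_deg (2 ^ (j + 1) * n)" "f (s + t + 2 * j) \<in> Irr_deg (2 ^ (j + 1) * n)"
        by (rule tail; use that(2) v in simp)+
      moreover have "s + t + (2 * j - 1) = s + t + 2 * j - 1" using that(2) by simp
      ultimately show ?thesis by simp
    qed
    have single: "f (s + t + j) \<in> Irr_deg (2 ^ (j + 1) * n)" if "k \<in> C3 \<union> C3_neg" "j \<ge> 1" for j
      by (rule tail) (use that cases in auto)
    show "\<exists>s t. t > 0 \<and> s \<le> max e0 e1 \<and> s + t \<le> e0 + e1 \<and>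
               f ` {0..s} \<subseteq> Irr_deg n \<and> f ` {s + 1..s + t} \<subseteq> Irr_deg (2 * n) \<and>
               (k \<in> C2 \<longrightarrow>
                  (\<forall>j\<ge>1. {f (s + t + 2 * j - 1), f (s + t + 2 * j)} \<subseteq> Irr_deg (2 ^ (j + 1) * n))) \<and>
               (k \<in> C3 \<union> C3_neg \<longrightarrow>
                  (\<forall>j\<ge>1. f (s + t + j) \<in> Irr_deg (2 ^ (j + 1) * n)))"
      by (rule exI[of _ s], rule exI[of _ t]) (intro conjI st impI allI pair single)
  qed
  consider (gauss) "k \<in> C2" | (pos) "k \<notin> C2" "k \<in> C3" | (neg) "k \<notin> C2" "k \<in> C3_neg" using assms(4) by blast
  thus ?thesis
  proof cases
    case gauss
    note d = assms(5)[OF gauss]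
    have eq: "k\<^sup>2 + 1 / 4 = 0" using gauss by (simp add: C2_def)
    note eq4 = C2_equation[OF two gauss]
    have k0: "k \<noteq> 0" using eq4 by auto
    have np: "\<not> theta_periodic (to_ac k) (Fin 1)"
    proof (rule one_not_periodic_C2[OF two_ac])
      have "to_ac (4 * k\<^sup>2 + 1) = 0" using eq4 by simp
      thus "4 * (to_ac k)\<^sup>2 + 1 = 0"
        by (simp only: to_ac_add to_ac_mult to_ac_power to_ac_numeral to_ac_1)
    qed
    note c2 = C2_case[OF assms(1,2) eq conjunct1[OF d] conjunct1[OF conjunct2[OF d]] conjunct2[OF conjunct2[OF d]]]
    show ?thesis
      by (rule finish[OF _ theorem3p1_from_field_membership[OF k0 assms(3) c2(1,2) np c2(3)]])
        (use gauss C_disjoint(1)[OF two gauss] in blast)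
  next
    case pos
    have d: "represents_frobenius (Z_adjoin alpha) (- 35 :: 'p mod_ring) 98 \<pi>"
      "of_int \<sigma> = 2 * k + 1"
      "e0 = ring_valuation (Z_adjoin alpha) (rho0 \<pi> \<sigma>) (\<pi> ^ n - 1)"
      "e1 = ring_valuation (Z_adjoin alpha) (rho0 \<pi> \<sigma>) (\<pi> ^ n + 1)"
      using assms(6) pos(2) by simp_all
    have eq: "k\<^sup>2 + 1 / 2 * k + 1 / 2 = 0" and p7: "CARD('p) mod 7 \<in> {1, 2, 4}"
      using pos(2) unfolding C3_def by blast+
    have k0: "k \<noteq> 0" using C3_equation[OF two pos(2)] by auto
    note c3 = C3_case[OF assms(1,2) eq p7 d]
    show ?thesis
      by (rule finish[OF _ theorem3p1_from_field_membership[OF k0 assms(3) c3(1,2) np3[OF pos(2)] c3(3)]])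
        (use pos in blast)
  next
    case neg
    have mk: "- k \<in> C3" using neg(2) by (simp add: C3_neg_def)
    have d: "represents_frobenius (Z_adjoin alpha) (- 35 :: 'p mod_ring) 98 \<pi>"
      "of_int \<sigma> = 2 * (- k) + 1"
      "e0 = ring_valuation (Z_adjoin alpha) (rho0 \<pi> \<sigma>) (\<pi> ^ n - 1)"
      "e1 = ring_valuation (Z_adjoin alpha) (rho0 \<pi> \<sigma>) (\<pi> ^ n + 1)"
      using assms(6) neg(2) C_disjoint(2)[OF two neg(2)] by simp_all
    have eq: "(- k)\<^sup>2 + 1 / 2 * (- k) + 1 / 2 = 0" and p7: "CARD('p) mod 7 \<in> {1, 2, 4}"
      using mk unfolding C3_def by blast+
    have k0: "k \<noteq> 0" using C3_equation[OF two mk] by auto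
    have np: "\<not> theta_periodic (to_ac k) (Fin 1)"
    proof
      assume "theta_periodic (to_ac k) (Fin 1)"
      from theta_periodic_neg[OF this] have "theta_periodic (to_ac (- k)) (Fin 1)" by simp
      thus False using np3[OF mk] by simp
    qed
    note c3 = C3_case[OF assms(1,2) eq p7 d]
    \<comment> \<open>The valuations belong to \<open>- k\<close>, whereas the polynomials are built
      with \<open>k\<close>; only the statement about chains of roots is carried over.\<close>
    note core = field_membership_neg[of k n "max e0 e1" "\<lambda>j. e0 + e1 + (j - 1) * 1", OF c3(3)]
    show ?thesis
      by (rule finish[OF _ theorem3p1_from_field_membership[OF k0 assms(3) c3(1,2) np core]])
        (use neg in blast)
  qed
qed

end
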